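(* If $H$ is a fixed graph (not necessarily connected) with at least two edges and $m(H)\le 1$, then $$f^-_H(n)=\Omega\big(n^{1/m(H)}\big)\qquad (n\to\infty).$$
   Context: All graphs are finite and simple; $H$ is fixed and $n\to\infty$, and the implied constant may depend on $H$. Let $H$ be a graph with at least two edges and let $n,b$ be positive integers. In the $(1:b)$ (strict) Avoider--Enforcer $H$-game on $K_n$, two players, Avoider and Enforcer, alternately claim previously unclaimed edges of $K_n$, Avoider moving first. Avoider claims exactly one edge per turn and Enforcer claims exactly $b$ edges per turn; if strictly fewer than $b$ edges are unclaimed before a move of Enforcer, he claims all of them. The game ends when all edges are claimed. Avoider loses (Enforcer wins) if the graph of Avoider's edges then contains a copy of $H$; otherwise Avoider wins. The lower threshold $f^-_H(n)$ is the largest integer such that for every $b\le f^-_H(n)$ Enforcer has a winning strategy in the $(1:b)$ $H$-game on $K_n$. $m(H)=\max_{F\subseteq H,\ v(F)\ge 1} e(F)/v(F)$, where $v(F)$ and $e(F)$ are the numbers of vertices and edges of $F$. *)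

theory Defs
  imports Complex_Main "HOL-Library.Landau_Symbols"
begin

type_synonym 'a graph = "'a set \<times> 'a set set"

abbreviation verts :: "'a graph \<Rightarrow> 'a set" where
  "verts G \<equiv> fst G"

abbreviation edges :: "'a graph \<Rightarrow> 'a set set" where
  "edges G \<equiv> snd G"

definition simple_graph :: "'a graph \<Rightarrow> bool" where
  "simple_graph G \<longleftrightarrow> (\<forall>e\<in>edges G. e \<subseteq> verts G \<and> card e = 2)"

definition finite_simple_graph :: "'a graph \<Rightarrow> bool" where
  "finite_simple_graph G \<longleftrightarrow> finite (verts G) \<and> simple_graph G"

definition subgraph :: "'a graph \<Rightarrow> 'a graph \<Rightarrow> bool" where
  "subgraph F G \<longleftrightarrow> simple_graph F \<and> verts F \<subseteq> verts G \<and> edges F \<subseteq> edges G"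

definition max_density :: "'a graph \<Rightarrow> real" where
  "max_density H =
     Max {real (card (edges F)) / real (card (verts F)) |F. subgraph F H \<and> card (verts F) \<ge> 1}"

text \<open>A copy is a not necessarily induced subgraph isomorphic to \<open>H\<close>; isolated vertices of
  \<open>H\<close> have to be embedded as well.\<close>

definition contains_copy :: "'b graph \<Rightarrow> 'a graph \<Rightarrow> bool" where
  "contains_copy G H \<longleftrightarrow>
     (\<exists>\<phi>. inj_on \<phi> (verts H) \<and> \<phi> ` verts H \<subseteq> verts G \<and> (\<forall>e\<in>edges H. \<phi> ` e \<in> edges G))"

definition complete_edges :: "nat \<Rightarrow> nat set set" where
  "complete_edges n = {e. e \<subseteq> {..<n} \<and> card e = 2}"

text \<open>A round consists of the edge claimed by Avoider and the set of edges with which Enforcer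
  answers. A history is the list of the completed rounds, in chronological order.\<close>

type_synonym round = "nat set \<times> nat set set"

definition avoider_edges :: "round list \<Rightarrow> nat set set" where
  "avoider_edges h = fst ` set h"

definition enforcer_edges :: "round list \<Rightarrow> nat set set" where
  "enforcer_edges h = \<Union> (snd ` set h)"

definition unclaimed :: "nat \<Rightarrow> round list \<Rightarrow> nat set set" where
  "unclaimed n h = complete_edges n - (avoider_edges h \<union> enforcer_edges h)"

text \<open>A strategy of Enforcer receives the history and the edge Avoider has just claimed.\<close>

type_synonym strategy = "round list \<Rightarrow> nat set \<Rightarrow> nat set set"

inductive play :: "nat \<Rightarrow> strategy \<Rightarrow> round list \<Rightarrow> bool" for n \<sigma> where
  start: "play n \<sigma> []"
| round: "play n \<sigma> h \<Longrightarrow> e \<in> unclaimed n h \<Longrightarrow> play n \<sigma> (h @ [(e, \<sigma> h e)])"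

text \<open>Under the strict rules Enforcer claims exactly \<open>b\<close> edges, or all remaining edges if fewer
  than \<open>b\<close> (possibly none) are left. Legality matters only at the histories that can arise when
  Enforcer follows the strategy.\<close>

definition legal_strategy :: "nat \<Rightarrow> nat \<Rightarrow> strategy \<Rightarrow> bool" where
  "legal_strategy n b \<sigma> \<longleftrightarrow>
     (\<forall>h e. play n \<sigma> h \<longrightarrow> e \<in> unclaimed n h \<longrightarrow>
        \<sigma> h e \<subseteq> unclaimed n h - {e} \<and>
        card (\<sigma> h e) = min b (card (unclaimed n h - {e})))"

definition winning_strategy :: "'a graph \<Rightarrow> nat \<Rightarrow> nat \<Rightarrow> strategy \<Rightarrow> bool" where
  "winning_strategy H n b \<sigma> \<longleftrightarrow> legal_strategy n b \<sigma> \<and>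
     (\<forall>h. play n \<sigma> h \<longrightarrow> unclaimed n h = {} \<longrightarrow> contains_copy ({..<n}, avoider_edges h) H)"

definition enforcer_wins :: "'a graph \<Rightarrow> nat \<Rightarrow> nat \<Rightarrow> bool" where
  "enforcer_wins H n b \<longleftrightarrow> (\<exists>\<sigma>. winning_strategy H n b \<sigma>)"

text \<open>The bias is a positive integer, so \<open>0\<close> always qualifies. The candidates are bounded when
  \<open>H\<close> has at least two edges: if \<open>b\<close> is at least the number of edges of the complete graph,
  Avoider claims at most one edge.\<close>

definition lower_threshold :: "'a graph \<Rightarrow> nat \<Rightarrow> nat" where
  "lower_threshold H n = (GREATEST k. \<forall>b. 1 \<le> b \<and> b \<le> k \<longrightarrow> enforcer_wins H n b)"

end

theory Submission imports Defs begin

text \<open>Enforcer declares some unclaimed pairs open and claims the others first. Once these are used up,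
  every move of Avoider has to be an open pair, so Avoider takes about one open pair for every \<open>b\<close> that
  Enforcer claims.

  If \<open>m(H) < 1\<close>, then \<open>H\<close> is a forest. Distribute its vertices as labels over the vertices of
  \<open>K\<^sub>n\<close>. Enforcer keeps large banks of disjoint copies of subtrees in Avoider's graph and, one
  edge of \<open>H\<close> at a time, opens the pairs between two banks that would merge two subtrees. With bias
  \<open>\<lambda> n\<close> about \<open>n / \<lambda> ^ (s - 1)\<close> copies of a subtree on \<open>s\<close> vertices survive, and
  \<open>\<lambda> = n powr (1 / m(H) - 1)\<close> up to a constant is small enough for every component of \<open>H\<close>.

  If \<open>m(H) = 1\<close>, every component of \<open>H\<close> has at most one cycle. On linearly large disjoint boards
  Enforcer forces a cycle of prescribed length inside a vertex set in which Avoider's graph has large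
  minimum degree. Such sets accommodate \<open>H\<close>: vertices of degree at most one are embedded last, and
  what remains after peeling them off is a disjoint union of cycles.\<close>

section \<open>The game as a recursion on positions\<close>

text \<open>Avoider picks the open pair and decides when to use up junk, so the next edge can never
  be dictated; a stage has to profit from every possible open move. Progress is therefore measured
  in kills, not in rounds: a stage succeeds if its supply of pairs to kill exceeds \<open>b\<close>
  times the number of open moves plus one. Two banks of sizes w and w' offer w * w' pairs, hence
  about w * w' / (\<lambda> n) merges. Starting from n single vertices this yields the sizes n /
  \<lambda>^(s-1). A tree on s vertices has density (s-1)/s \<le> m(H), so the exponent 1/m(H) - 1
  is at most 1/(s-1), and \<lambda>^(s-1) is at most of order n. A pair that closes a cycle lies
  inside one component, so merging banks never produces it. In the density-one case closing is
  postponed until every board has linearly many closing pairs at the same time. From then on a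
  bounded number of open moves is enough, and the kills they allow number only O(b), less than the
  supply on each board.\<close>

definition unc :: "nat \<Rightarrow> nat set set \<Rightarrow> nat set set \<Rightarrow> nat set set" where
  "unc n A D = complete_edges n - (A \<union> D)"

text \<open>\<open>A\<close> and \<open>D\<close> are the edges of Avoider and Enforcer; Avoider is to move in
  \<open>ewin\<close>, Enforcer in \<open>reply\<close>.\<close>

inductive ewin :: "'a graph \<Rightarrow> nat \<Rightarrow> nat \<Rightarrow> nat set set \<Rightarrow> nat set set \<Rightarrow> bool"
  for H n b where
  goal: "contains_copy ({..<n}, A) H \<Longrightarrow> ewin H n b A D"
| move: "unc n A D \<noteq> {} \<Longrightarrow>
    (\<And>e. e \<in> unc n A D \<Longrightarrow> \<exists>Y \<subseteq> unc n (insert e A) D.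
        card Y = min b (card (unc n (insert e A) D)) \<and> ewin H n b (insert e A) (D \<union> Y)) \<Longrightarrow>
    ewin H n b A D"

definition reply :: "'a graph \<Rightarrow> nat \<Rightarrow> nat \<Rightarrow> nat set set \<Rightarrow> nat set set \<Rightarrow> bool" where
  "reply H n b A D \<longleftrightarrow>
     (\<exists>Y \<subseteq> unc n A D. card Y = min b (card (unc n A D)) \<and> ewin H n b A (D \<union> Y))"

lemma finite_complete_edges [simp]: "finite (complete_edges n)"
  unfolding complete_edges_def by (rule finite_subset[of _ "Pow {..<n}"]) auto

lemma finite_unc [simp]: "finite (unc n A D)"
  unfolding unc_def by simp

lemma unc_insertA: "unc n (insert e A) D = unc n A D - {e}"
  unfolding unc_def by auto

lemma ewin_moveI:
  assumes "unc n A D \<noteq> {}" "\<And>e. e \<in> unc n A D \<Longrightarrow> reply H n b (insert e A) D"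
  shows "ewin H n b A D"
  using assms unfolding reply_def by (auto intro: ewin.move)

lemma contains_copy_mono:
  assumes "contains_copy ({..<n}, A) H" "A \<subseteq> A'"
  shows "contains_copy ({..<n}, A') H"
  using assms unfolding contains_copy_def by fastforce

lemma reply_goal:
  assumes "contains_copy ({..<n}, A) H"
  shows "reply H n b A D"
proof -
  obtain Y where "Y \<subseteq> unc n A D" "card Y = min b (card (unc n A D))"
    by (meson min.cobounded2 obtain_subset_with_card_n)
  then show ?thesis
    unfolding reply_def using assms ewin.goal by blast
qed

text \<open>Play goes on after the copy of H has appeared, so the case \<open>goal\<close> needs a
  legal answer too; the copy survives because Avoider's edges only grow.\<close>

lemma ewin_step:
  assumes "ewin H n b A D" "e \<in> unc n A D"
  shows "reply H n b (insert e A) D"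
  using assms(1)
proof cases
  case goal
  then show ?thesis
    using reply_goal contains_copy_mono by (metis subset_insertI)
next
  case move
  then show ?thesis
    using assms(2) unfolding reply_def by blast
qed

lemma avoider_edges_snoc [simp]: "avoider_edges (h @ [(e, Y)]) = insert e (avoider_edges h)"
  and enforcer_edges_snoc [simp]: "enforcer_edges (h @ [(e, Y)]) = enforcer_edges h \<union> Y"
  unfolding avoider_edges_def enforcer_edges_def by auto

lemma unclaimed_unc: "unclaimed n h = unc n (avoider_edges h) (enforcer_edges h)"
  unfolding unclaimed_def unc_def by simp

text \<open>The strategy picks some legal answer that keeps \<open>ewin\<close>. When no edge is
  left, \<open>ewin\<close> can only stem from the rule \<open>goal\<close>, since
  \<open>move\<close> needs an unclaimed edge.\<close>

lemma enforcer_wins_if_ewin: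
  assumes "ewin H n b {} {}"
  shows "enforcer_wins H n b"
proof -
  define good where "good h e Y \<longleftrightarrow> Y \<subseteq> unclaimed n h - {e} \<and>
      card Y = min b (card (unclaimed n h - {e})) \<and>
      ewin H n b (insert e (avoider_edges h)) (enforcer_edges h \<union> Y)" for h e Y
  define \<sigma> :: strategy where "\<sigma> h e = (SOME Y. good h e Y)" for h e
  have good: "good h e (\<sigma> h e)"
    if "ewin H n b (avoider_edges h) (enforcer_edges h)" "e \<in> unclaimed n h" for h e
  proof -
    have "reply H n b (insert e (avoider_edges h)) (enforcer_edges h)"
      using ewin_step[OF that(1)] that(2) by (simp add: unclaimed_unc)
    then have "\<exists>Y. good h e Y"
      unfolding reply_def good_def unclaimed_unc unc_insertA by blast
    then show ?thesis
      unfolding \<sigma>_def by (rule someI_ex)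
  qed
  have inv: "ewin H n b (avoider_edges h) (enforcer_edges h)" if "play n \<sigma> h" for h
    using that
  proof induction
    case start
    then show ?case
      using assms by (simp add: avoider_edges_def enforcer_edges_def)
  next
    case (round h e)
    then show ?case
      using good[of h e] by (simp add: good_def)
  qed
  have "contains_copy ({..<n}, avoider_edges h) H"
    if "play n \<sigma> h" "unclaimed n h = {}" for h
    using inv[OF that(1)] that(2) by (cases rule: ewin.cases) (auto simp: unclaimed_unc)
  moreover have "legal_strategy n b \<sigma>"
    unfolding legal_strategy_def using good inv by (auto simp: good_def)
  ultimately show ?thesis
    unfolding enforcer_wins_def winning_strategy_def by blast
qed

section \<open>Forcing Avoider into open edges\<close>

text \<open>Enforcer claims unclaimed edges outside \<open>op g\<close> (junk) as long as there are any and only then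
  an open edge (a kill). A kill creates no junk, so after a move with a kill there is no junk left
  and Avoider has to take an open edge. Thus the number \<open>\<kappa>\<close> of kills is at most \<open>b\<close> times the number
  \<open>m\<close> of open moves of Avoider whenever Enforcer is to move.\<close>

locale pressure =
  fixes H :: "'a graph" and n b mmax :: nat
    and R :: "nat \<Rightarrow> nat \<Rightarrow> 'g \<Rightarrow> nat set set \<Rightarrow> nat set set \<Rightarrow> bool"
    and op :: "'g \<Rightarrow> nat set set" and fin :: "nat \<Rightarrow> 'g \<Rightarrow> bool"
  assumes junkD: "R m \<kappa> g A D \<Longrightarrow> y \<in> unc n A D \<Longrightarrow> y \<notin> op g \<Longrightarrow> R m \<kappa> g A (insert y D)"
    and kill: "R m \<kappa> g A D \<Longrightarrow> \<not> fin m g \<Longrightarrow> \<kappa> \<le> b * (mmax + 1) \<Longrightarrow>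
      \<exists>y \<in> unc n A D \<inter> op g. R m (Suc \<kappa>) g A (insert y D)"
    and junkA: "R m \<kappa> g A D \<Longrightarrow> y \<in> unc n A D \<Longrightarrow> y \<notin> op g \<Longrightarrow> R m \<kappa> g (insert y A) D"
    and openA: "R m \<kappa> g A D \<Longrightarrow> \<not> fin m g \<Longrightarrow> y \<in> unc n A D \<Longrightarrow> y \<in> op g \<Longrightarrow>
      \<exists>g'. R (Suc m) \<kappa> g' (insert y A) D"
    and bound: "R m \<kappa> g A D \<Longrightarrow> m \<le> mmax"
    and fin: "R m \<kappa> g A D \<Longrightarrow> fin m g \<Longrightarrow> reply H n b A D"
begin

text \<open>The edges of one answer are claimed one at a time with \<open>g\<close> fixed, junk
  first. That \<open>t\<close> edges can be found even when the junk runs out is due to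
  \<open>kill\<close>.\<close>

lemma batch:
  assumes "R m \<kappa> g A D" "\<not> fin m g" "\<kappa> + t \<le> b * (mmax + 1)"
  shows "\<exists>Y \<kappa>'. Y \<subseteq> unc n A D \<and> card Y = t \<and> R m \<kappa>' g A (D \<union> Y) \<and> \<kappa>' \<le> \<kappa> + t \<and>
           (\<kappa>' = \<kappa> \<or> unc n A (D \<union> Y) \<subseteq> op g)"
  using assms(3)
proof (induction t)
  case 0
  show ?case
    using assms(1) by (intro exI[of _ "{}"] exI[of _ \<kappa>]) auto
next
  case (Suc t)
  then obtain Y \<kappa>' where Y: "Y \<subseteq> unc n A D" "card Y = t" "R m \<kappa>' g A (D \<union> Y)" "\<kappa>' \<le> \<kappa> + t"
    "\<kappa>' = \<kappa> \<or> unc n A (D \<union> Y) \<subseteq> op g"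
    by auto
  have step: "insert y Y \<subseteq> unc n A D \<and> card (insert y Y) = Suc t"
    if "y \<in> unc n A (D \<union> Y)" for y
  proof -
    have "finite Y"
      using Y(1) finite_unc finite_subset by blast
    moreover have "y \<notin> Y" "y \<in> unc n A D"
      using that unfolding unc_def by auto
    ultimately show ?thesis
      using Y by auto
  qed
  show ?case
  proof (cases "unc n A (D \<union> Y) \<subseteq> op g")
    case False
    then obtain y where y: "y \<in> unc n A (D \<union> Y)" "y \<notin> op g"
      by auto
    have "R m \<kappa>' g A (D \<union> insert y Y)"
      using junkD[OF Y(3) y] by simp
    then show ?thesis
      using False step[OF y(1)] Y(4,5)
      by (intro exI[of _ "insert y Y"] exI[of _ \<kappa>']) auto
  next
    case True
    obtain y where y: "y \<in> unc n A (D \<union> Y)" "R m (Suc \<kappa>') g A (insert y (D \<union> Y))"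
      using kill[OF Y(3) assms(2)] Y(4) Suc.prems by auto
    have "unc n A (D \<union> insert y Y) \<subseteq> op g"
      using True by (auto simp: unc_def)
    then show ?thesis
      using step[OF y(1)] y(2) Y(4)
      by (intro exI[of _ "insert y Y"] exI[of _ "Suc \<kappa>'"]) auto
  qed
qed

lemma reply_if_R:
  "R m \<kappa> g A D \<Longrightarrow> \<kappa> \<le> b * m \<Longrightarrow> reply H n b A D"
proof (induction "card (unc n A D)" arbitrary: m \<kappa> g A D rule: less_induct)
  case less
  show ?case
  proof (cases "fin m g")
    case True
    then show ?thesis
      using fin less.prems by blast
  next
    case nfin: False
    have m: "m \<le> mmax"
      using bound less.prems by blast
    \<comment> \<open>At most \<open>b * m\<close> kills lie before this answer and \<open>b\<close>
      within it; this is where the budget \<open>b * (mmax + 1)\<close> in \<open>kill\<close> comes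
      from.\<close>
    have mm: "b * m + b \<le> b * (mmax + 1)"
      using m by (metis add_le_mono1 add_mult_distrib2 mult.right_neutral mult_le_mono2)
    then obtain Y \<kappa>' where Y: "Y \<subseteq> unc n A D" "card Y = b" "R m \<kappa>' g A (D \<union> Y)" "\<kappa>' \<le> \<kappa> + b"
      "\<kappa>' = \<kappa> \<or> unc n A (D \<union> Y) \<subseteq> op g"
      using batch[OF less.prems(1) nfin, of b] less.prems(2) by (meson add_right_mono le_trans)
    have \<kappa>': "\<kappa>' \<le> b * m + b"
      using Y(4) less.prems(2) by simp
    \<comment> \<open>The short last answer of the strict rules cannot occur during a stage, because
      \<open>batch\<close> has found \<open>b\<close> edges.\<close>
    have "min b (card (unc n A D)) = b"
      using Y(1,2) card_mono[OF finite_unc Y(1)] by simp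
    moreover have "ewin H n b A (D \<union> Y)"
    proof (rule ewin_moveI)
      show "unc n A (D \<union> Y) \<noteq> {}"
        using kill[OF Y(3) nfin le_trans[OF \<kappa>' mm]] by auto
    next
      fix e assume e: "e \<in> unc n A (D \<union> Y)"
      have small: "card (unc n (insert e A) (D \<union> Y)) < card (unc n A D)"
      proof (rule psubset_card_mono)
        show "unc n (insert e A) (D \<union> Y) \<subset> unc n A D"
          using e unfolding unc_def by auto
      qed simp
      show "reply H n b (insert e A) (D \<union> Y)"
      proof (cases "e \<in> op g")
        case False
        \<comment> \<open>Avoider took junk, so junk was left and this answer contained no kill; the
          bound \<open>b * m\<close> persists although \<open>m\<close> has not grown.\<close>
        then have "\<kappa>' = \<kappa>"
          using Y(5) e by auto
        then show ?thesis
          using less.hyps[OF small junkA[OF Y(3) e False]] less.prems by simp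
      next
        case True
        \<comment> \<open>The open move raises \<open>m\<close> by one, which pays for the at most
          \<open>b\<close> kills of this answer.\<close>
        then obtain g' where "R (Suc m) \<kappa>' g' (insert e A) (D \<union> Y)"
          using openA[OF Y(3) nfin e] by blast
        then show ?thesis
          using less.hyps[OF small] \<kappa>' by simp
      qed
    qed
    ultimately show ?thesis
      unfolding reply_def using Y(1,2) by auto
  qed
qed

lemma ewin_if_R:
  assumes "R m 0 g A D" "\<not> fin m g"
  shows "ewin H n b A D"
proof (rule ewin_moveI)
  show "unc n A D \<noteq> {}"
    using kill[OF assms] by auto
next
  fix e assume e: "e \<in> unc n A D"
  show "reply H n b (insert e A) D"
  proof (cases "e \<in> op g")
    case False
    then show ?thesis
      using junkA[OF assms(1) e] reply_if_R by blast
  next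
    case True
    then show ?thesis
      using openA[OF assms e] reply_if_R by blast
  qed
qed

end

section \<open>Forests\<close>

locale fin_graph =
  fixes H :: "'a graph"
  assumes fsg: "finite_simple_graph H"
begin

definition hin :: "'a set \<Rightarrow> 'a set set" where
  "hin S = {e \<in> edges H. e \<subseteq> S}"

lemma finite_verts [simp]: "finite (verts H)"
  using fsg by (simp add: finite_simple_graph_def)

lemma edge_card: "e \<in> edges H \<Longrightarrow> card e = 2"
  and edge_sub: "e \<in> edges H \<Longrightarrow> e \<subseteq> verts H"
  using fsg by (auto simp: finite_simple_graph_def simple_graph_def)

lemma finite_edges [simp]: "finite (edges H)"
  by (rule finite_subset[of _ "Pow (verts H)"]) (use edge_sub in auto)

lemma finite_hin [simp]: "finite (hin S)"
  unfolding hin_def by simp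

lemma edge_neq: "{x, y} \<in> edges H \<Longrightarrow> x \<noteq> y"
  using edge_card by fastforce

end

text \<open>The integer form of m(H) < 1, which amounts to acyclicity.\<close>

locale forest = fin_graph +
  assumes sparse: "S \<subseteq> verts H \<Longrightarrow> S \<noteq> {} \<Longrightarrow> card (hin S) < card S"
begin

text \<open>In a forest, a vertex set is connected iff it spans one edge less than it has elements.\<close>

definition conn :: "'a set \<Rightarrow> bool" where
  "conn S \<longleftrightarrow> S \<subseteq> verts H \<and> card (hin S) + 1 = card S"

lemma conn_finite: "conn S \<Longrightarrow> finite S"
  unfolding conn_def using finite_subset finite_verts by blast

lemma conn_nonempty: "conn S \<Longrightarrow> S \<noteq> {}"
  unfolding conn_def by auto

text \<open>The edges inside C, those inside D and the edge joining them already number |C| + |D| -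
  1, the maximum that \<open>sparse\<close> allows. So C \<union> D spans nothing else; in
  particular only one edge of H joins C and D.\<close>

lemma conn_union:
  assumes "conn C" "conn D" "C \<inter> D = {}" "x \<in> C" "y \<in> D" "{x, y} \<in> edges H"
  shows "conn (C \<union> D)" "hin (C \<union> D) = insert {x, y} (hin C \<union> hin D)"
proof -
  have fin: "finite C" "finite D"
    using assms conn_finite by auto
  have disj: "hin C \<inter> hin D = {}"
  proof -
    have "e = {}" if "e \<in> hin C" "e \<in> hin D" for e
      using that assms(3) unfolding hin_def by auto
    then show ?thesis
      using edge_card unfolding hin_def by fastforce
  qed
  have new: "{x, y} \<notin> hin C \<union> hin D"
    using assms(3-5) unfolding hin_def by auto
  have sub: "insert {x, y} (hin C \<union> hin D) \<subseteq> hin (C \<union> D)"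
    using assms(4-6) unfolding hin_def by auto
  have c1: "card (insert {x, y} (hin C \<union> hin D)) = card (hin C) + card (hin D) + 1"
    using new disj by (simp add: card_Un_disjoint)
  have c2: "card (C \<union> D) = card C + card D"
    using fin assms(3) by (rule card_Un_disjoint)
  have V: "C \<union> D \<subseteq> verts H" "C \<union> D \<noteq> {}"
    using assms unfolding conn_def by auto
  have "card (hin (C \<union> D)) < card (C \<union> D)"
    by (rule sparse[OF V])
  moreover have "card (insert {x, y} (hin C \<union> hin D)) \<le> card (hin (C \<union> D))"
    by (rule card_mono[OF finite_hin sub])
  ultimately have eq: "card (hin (C \<union> D)) = card (insert {x, y} (hin C \<union> hin D))"
    using assms(1,2) c1 c2 unfolding conn_def by linarith
  show "hin (C \<union> D) = insert {x, y} (hin C \<union> hin D)"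
    using card_subset_eq[OF finite_hin sub eq[symmetric]] by simp
  show "conn (C \<union> D)"
    using eq c1 c2 V assms(1,2) unfolding conn_def by auto
qed

end

section \<open>Copies of subtrees as labelled vertex sets\<close>

locale labelled_forest = forest H for H :: "'a graph" +
  fixes n :: nat and lab :: "nat \<Rightarrow> 'a"
begin

definition xp :: "nat set \<Rightarrow> nat set \<Rightarrow> nat set set" where
  "xp X Y = {{u, v} |u v. u \<in> X \<and> v \<in> Y \<and> {lab u, lab v} \<in> edges H}"

text \<open>\<open>comp A X\<close>: Avoider's edges on \<open>X\<close> contain a copy of the subgraph of \<open>H\<close> induced by the
  label set \<open>lab ` X\<close>, embedded by the inverse of \<open>lab\<close>.\<close>

definition comp :: "nat set set \<Rightarrow> nat set \<Rightarrow> bool" where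
  "comp A X \<longleftrightarrow> X \<subseteq> {..<n} \<and> inj_on lab X \<and> conn (lab ` X) \<and>
     (\<forall>e \<in> hin (lab ` X). \<exists>p \<in> A. p \<subseteq> X \<and> lab ` p = e)"

lemma comp_D:
  assumes "comp A X"
  shows "X \<subseteq> {..<n}" "inj_on lab X" "conn (lab ` X)"
    "e \<in> hin (lab ` X) \<Longrightarrow> \<exists>p \<in> A. p \<subseteq> X \<and> lab ` p = e"
  using assms unfolding comp_def by blast+

lemma xp_commute: "xp X Y = xp Y X"
  unfolding xp_def by (metis (no_types, opaque_lifting) insert_commute)

lemma xp_Un: "xp (X \<union> Y) Z = xp X Z \<union> xp Y Z"
  unfolding xp_def by auto

lemma xp_meets:
  assumes "p \<in> xp X Y"
  shows "p \<inter> X \<noteq> {}" "p \<inter> Y \<noteq> {}" "p \<subseteq> X \<union> Y"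
  using assms unfolding xp_def by auto

lemma comp_finite: "comp A X \<Longrightarrow> finite X"
  unfolding comp_def using finite_subset by blast

lemma comp_nonempty: "comp A X \<Longrightarrow> X \<noteq> {}"
  unfolding comp_def using conn_nonempty by auto

lemma comp_mono:
  assumes "comp A X" "A \<subseteq> A'"
  shows "comp A' X"
proof -
  have "\<exists>p \<in> A'. p \<subseteq> X \<and> lab ` p = e" if "e \<in> hin (lab ` X)" for e
    using comp_D(4)[OF assms(1) that] assms(2) by (meson subsetD)
  then show ?thesis
    unfolding comp_def by (intro conjI ballI comp_D(1-3)[OF assms(1)])
qed

lemma comp_card: "comp A X \<Longrightarrow> card (lab ` X) = card X"
  unfolding comp_def by (simp add: card_image)

lemma xp_complete:
  assumes "comp A X" "comp A Y" "p \<in> xp X Y"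
  shows "p \<in> complete_edges n"
proof -
  obtain u v where "p = {u, v}" "u \<in> X" "v \<in> Y" "{lab u, lab v} \<in> edges H"
    using assms(3) unfolding xp_def by auto
  then show ?thesis
    using comp_D(1)[OF assms(1)] comp_D(1)[OF assms(2)] edge_neq[of "lab u" "lab v"]
    unfolding complete_edges_def by (auto simp: card_insert_if)
qed

text \<open>By \<open>conn_union\<close> the two label sets are joined by a single edge of H, so one
  edge of Avoider completes the larger copy.\<close>

lemma comp_merge:
  assumes "comp A X" "comp A Y" "lab ` X \<inter> lab ` Y = {}" "p \<in> xp X Y"
  shows "comp (insert p A) (X \<union> Y)"
proof -
  obtain u v where uv: "p = {u, v}" "u \<in> X" "v \<in> Y" "{lab u, lab v} \<in> edges H"
    using assms(4) unfolding xp_def by auto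
  have c: "conn (lab ` X)" "conn (lab ` Y)"
    by (rule comp_D(3)[OF assms(1)], rule comp_D(3)[OF assms(2)])
  note cu = conn_union[OF c assms(3) imageI[OF uv(2), of lab] imageI[OF uv(3), of lab] uv(4)]
  have "\<exists>q \<in> insert p A. q \<subseteq> X \<union> Y \<and> lab ` q = e" if "e \<in> hin (lab ` (X \<union> Y))" for e
  proof -
    have "e \<in> insert {lab u, lab v} (hin (lab ` X) \<union> hin (lab ` Y))"
      using that cu(2) by (simp only: image_Un)
    then consider "e = {lab u, lab v}" | "e \<in> hin (lab ` X)" | "e \<in> hin (lab ` Y)"
      by blast
    then show ?thesis
    proof cases
      case 1
      then have "lab ` p = e" "p \<subseteq> X \<union> Y"
        using uv(1-3) by auto
      then show ?thesis
        by blast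
    next
      case 2
      then obtain q where "q \<in> A" "q \<subseteq> X" "lab ` q = e"
        using comp_D(4)[OF assms(1)] by metis
      then show ?thesis
        by (intro bexI[of _ q]) auto
    next
      case 3
      then obtain q where "q \<in> A" "q \<subseteq> Y" "lab ` q = e"
        using comp_D(4)[OF assms(2)] by metis
      then show ?thesis
        by (intro bexI[of _ q]) auto
    qed
  qed
  moreover have "inj_on lab (X \<union> Y)"
    using comp_D(2)[OF assms(1)] comp_D(2)[OF assms(2)] assms(3)
    unfolding inj_on_def by (metis IntI UnE emptyE imageI)
  moreover have "X \<union> Y \<subseteq> {..<n}"
    using comp_D(1)[OF assms(1)] comp_D(1)[OF assms(2)] by simp
  moreover have "conn (lab ` (X \<union> Y))"
    using cu(1) by (simp only: image_Un)
  ultimately show ?thesis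
    unfolding comp_def by blast
qed

definition adj :: "'a set \<Rightarrow> 'a set \<Rightarrow> bool" where
  "adj C D \<longleftrightarrow> (\<exists>x \<in> C. \<exists>y \<in> D. {x, y} \<in> edges H)"

end

text \<open>One stage of the game: the components in \<open>g0\<close> carry label sets from the partition \<open>CC\<close> of
  the vertices of \<open>H\<close>. Components merge whenever Avoider takes a pair between components with disjoint
  label sets, while Enforcer kills only pairs between \<open>Ca\<close> and \<open>Da\<close>.\<close>

locale stage = labelled_forest H n lab for H :: "'a graph" and n lab +
  fixes CC :: "'a set set" and g0 Ca Da :: "nat set set" and C1 D1 :: "'a set"
    and b M :: nat
  assumes CC_disj: "C \<in> CC \<Longrightarrow> C' \<in> CC \<Longrightarrow> C \<noteq> C' \<Longrightarrow> C \<inter> C' = {}"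
    and g0_lab: "X \<in> g0 \<Longrightarrow> lab ` X \<in> CC"
    and g0_disj: "X \<in> g0 \<Longrightarrow> Y \<in> g0 \<Longrightarrow> X \<noteq> Y \<Longrightarrow> X \<inter> Y = {}"
    and C1D1: "C1 \<in> CC" "D1 \<in> CC" "C1 \<noteq> D1" "adj C1 D1"
    and Ca: "Ca \<subseteq> g0" "\<And>X. X \<in> Ca \<Longrightarrow> lab ` X = C1"
    and Da: "Da \<subseteq> g0" "\<And>X. X \<in> Da \<Longrightarrow> lab ` X = D1"
    and region: "b * (M + 1) < (card Ca - 2 * M) * (card Da - 2 * M)"
begin

definition fresh_xp :: "nat set set \<Rightarrow> nat set set" where
  "fresh_xp U = {p. \<exists>X \<in> Ca \<inter> U. \<exists>Y \<in> Da \<inter> U. p \<in> xp X Y}"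

text \<open>\<open>T\<close> holds the components touched by Avoider, \<open>U\<close> the others.\<close>

definition R :: "nat \<Rightarrow> nat \<Rightarrow> nat set set \<times> nat set set \<Rightarrow> nat set set \<Rightarrow> nat set set \<Rightarrow> bool" where
  "R m \<kappa> g A D \<longleftrightarrow> (case g of (T, U) \<Rightarrow>
     A \<union> D \<subseteq> complete_edges n \<and>
     (\<forall>X \<in> T \<union> U. \<forall>Y \<in> T \<union> U. X \<noteq> Y \<longrightarrow> X \<inter> Y = {}) \<and> T \<inter> U = {} \<and>
     (\<forall>X \<in> T \<union> U. comp A X) \<and> U \<subseteq> g0 \<and>
     (\<forall>X \<in> T. (\<exists>C \<in> CC. \<exists>C' \<in> CC. C \<noteq> C' \<and> adj C C' \<and> C \<union> C' \<subseteq> lab ` X)) \<and>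
     (\<forall>X \<in> T. \<forall>C \<in> CC. C \<subseteq> lab ` X \<or> C \<inter> lab ` X = {}) \<and>
     m \<le> M \<and> m \<le> (\<Sum>X\<in>T. card X - 1) \<and> card (g0 - U) \<le> 2 * m \<and>
     (\<forall>X \<in> T \<union> U. \<forall>B \<in> U. B \<notin> Ca \<union> Da \<longrightarrow> lab ` X \<inter> lab ` B = {} \<longrightarrow> xp X B \<inter> (A \<union> D) = {}) \<and>
     fresh_xp U \<inter> A = {} \<and> card (D \<inter> fresh_xp U) \<le> \<kappa>)"

text \<open>Every pair that could merge two components is open, although only pairs between
  \<open>Ca\<close> and \<open>Da\<close> get killed. Otherwise Enforcer would have to use up the
  remaining ones as junk, and components saved for later stages would no longer be joined by free
  pairs.\<close>

definition op :: "nat set set \<times> nat set set \<Rightarrow> nat set set" where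
  "op g = (case g of (T, U) \<Rightarrow>
     {p. \<exists>X \<in> T \<union> U. \<exists>Y \<in> T \<union> U. lab ` X \<inter> lab ` Y = {} \<and> p \<in> xp X Y})"

lemma fresh_xp_op: "fresh_xp U \<subseteq> op (T, U)"
proof
  fix p assume "p \<in> fresh_xp U"
  then obtain X Y where XY: "X \<in> Ca" "X \<in> U" "Y \<in> Da" "Y \<in> U" "p \<in> xp X Y"
    unfolding fresh_xp_def by auto
  then have "lab ` X \<inter> lab ` Y = {}"
    using Ca(2) Da(2) CC_disj[OF C1D1(1-3)] by simp
  then show "p \<in> op (T, U)"
    using XY unfolding op_def by auto
qed

text \<open>At most 2 * M components have been touched, so at least \<open>card Ca - 2 * M\<close>
  and \<open>card Da - 2 * M\<close> are fresh on the two sides. A fixed edge of H between the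
  classes gives one pair for each choice of a fresh component on either side, and
  \<open>region\<close> compares this product with the kill budget.\<close>

lemma fresh_xp_large:
  assumes "U \<subseteq> g0" "card (g0 - U) \<le> 2 * M" "finite g0" "\<And>X. X \<in> U \<Longrightarrow> comp A X"
  shows "b * (M + 1) < card (fresh_xp U)"
proof -
  have large: "card S - 2 * M \<le> card (S \<inter> U)" if "S \<subseteq> g0" for S
  proof -
    have "S = (S \<inter> U) \<union> (S - U)" "(S \<inter> U) \<inter> (S - U) = {}"
      by auto
    then have "card S = card (S \<inter> U) + card (S - U)"
      using card_Un_disjoint[of "S \<inter> U" "S - U"] that assms(3) finite_subset by fastforce
    moreover have "card (S - U) \<le> card (g0 - U)"
      using that assms(3) by (intro card_mono) auto
    ultimately show ?thesis
      using assms(2) by linarith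
  qed
  obtain x y where xy: "x \<in> C1" "y \<in> D1" "{x, y} \<in> edges H"
    using C1D1(4) unfolding adj_def by auto
  define f where "f X = (SOME u. u \<in> X \<and> lab u = x)" for X
  define h where "h Y = (SOME u. u \<in> Y \<and> lab u = y)" for Y
  have f: "f X \<in> X" "lab (f X) = x" if "X \<in> Ca" for X
  proof -
    have "\<exists>u. u \<in> X \<and> lab u = x"
      using Ca(2)[OF that] xy(1) by auto
    from someI_ex[OF this] show "f X \<in> X" "lab (f X) = x"
      unfolding f_def by auto
  qed
  have h: "h Y \<in> Y" "lab (h Y) = y" if "Y \<in> Da" for Y
  proof -
    have "\<exists>u. u \<in> Y \<and> lab u = y"
      using Da(2)[OF that] xy(2) by auto
    from someI_ex[OF this] show "h Y \<in> Y" "lab (h Y) = y"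
      unfolding h_def by auto
  qed
  define F where "F = (\<lambda>(X, Y). {f X, h Y})"
  have xney: "x \<noteq> y"
    using edge_neq xy(3) by blast
  have "inj_on F ((Ca \<inter> U) \<times> (Da \<inter> U))"
  proof (rule inj_onI, clarify)
    fix X Y X' Y'
    assume in1: "X \<in> Ca" "X \<in> U" "Y \<in> Da" "Y \<in> U" and in2: "X' \<in> Ca" "X' \<in> U" "Y' \<in> Da" "Y' \<in> U"
      and eq: "F (X, Y) = F (X', Y')"
    have "f X = f X' \<and> h Y = h Y'"
      using eq f(2)[OF in1(1)] f(2)[OF in2(1)] h(2)[OF in1(3)] h(2)[OF in2(3)] xney
      unfolding F_def by (auto simp: doubleton_eq_iff)
    then have "X \<inter> X' \<noteq> {}" "Y \<inter> Y' \<noteq> {}"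
      using f(1)[OF in1(1)] f(1)[OF in2(1)] h(1)[OF in1(3)] h(1)[OF in2(3)] by auto
    then show "X = X' \<and> Y = Y'"
      using g0_disj in1 in2 assms(1) by (meson subsetD)
  qed
  then have "card (F ` ((Ca \<inter> U) \<times> (Da \<inter> U))) = card (Ca \<inter> U) * card (Da \<inter> U)"
    by (simp add: card_image card_cartesian_product)
  moreover have "F ` ((Ca \<inter> U) \<times> (Da \<inter> U)) \<subseteq> fresh_xp U"
  proof clarify
    fix X Y assume XY: "X \<in> Ca" "X \<in> U" "Y \<in> Da" "Y \<in> U"
    have "{lab (f X), lab (h Y)} \<in> edges H"
      using f(2)[OF XY(1)] h(2)[OF XY(3)] xy(3) by simp
    then have "F (X, Y) \<in> xp X Y"
      using f(1)[OF XY(1)] h(1)[OF XY(3)] unfolding F_def xp_def by auto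
    then show "F (X, Y) \<in> fresh_xp U"
      using XY unfolding fresh_xp_def by blast
  qed
  moreover have "finite (fresh_xp U)"
  proof (rule finite_subset[OF _ finite_complete_edges])
    show "fresh_xp U \<subseteq> complete_edges n"
      unfolding fresh_xp_def using xp_complete assms(4) by blast
  qed
  ultimately have "card (Ca \<inter> U) * card (Da \<inter> U) \<le> card (fresh_xp U)"
    by (metis card_mono)
  moreover have "(card Ca - 2 * M) * (card Da - 2 * M) \<le> card (Ca \<inter> U) * card (Da \<inter> U)"
    using large Ca(1) Da(1) by (intro mult_le_mono) auto
  ultimately show ?thesis
    using region by linarith
qed

lemma R_D:
  assumes "R m \<kappa> (T, U) A D"
  shows "A \<union> D \<subseteq> complete_edges n"
    "\<And>X Y. X \<in> T \<union> U \<Longrightarrow> Y \<in> T \<union> U \<Longrightarrow> X \<noteq> Y \<Longrightarrow> X \<inter> Y = {}" "T \<inter> U = {}"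
    "\<And>X. X \<in> T \<union> U \<Longrightarrow> comp A X" "U \<subseteq> g0"
    "\<And>X. X \<in> T \<Longrightarrow> \<exists>C \<in> CC. \<exists>C' \<in> CC. C \<noteq> C' \<and> adj C C' \<and> C \<union> C' \<subseteq> lab ` X"
    "\<And>X C. X \<in> T \<Longrightarrow> C \<in> CC \<Longrightarrow> C \<subseteq> lab ` X \<or> C \<inter> lab ` X = {}"
    "m \<le> M" "m \<le> (\<Sum>X\<in>T. card X - 1)" "card (g0 - U) \<le> 2 * m"
    "\<And>X B. X \<in> T \<union> U \<Longrightarrow> B \<in> U \<Longrightarrow> B \<notin> Ca \<union> Da \<Longrightarrow> lab ` X \<inter> lab ` B = {} \<Longrightarrow>
       xp X B \<inter> (A \<union> D) = {}"
    "fresh_xp U \<inter> A = {}" "card (D \<inter> fresh_xp U) \<le> \<kappa>"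
proof -
  note R = assms[unfolded R_def split]
  show "A \<union> D \<subseteq> complete_edges n"
    by (rule R[THEN conjunct1, rule_format])
  show "\<And>X Y. X \<in> T \<union> U \<Longrightarrow> Y \<in> T \<union> U \<Longrightarrow> X \<noteq> Y \<Longrightarrow> X \<inter> Y = {}"
    by (rule R[THEN conjunct2, THEN conjunct1, rule_format])
  show "T \<inter> U = {}"
    by (rule R[THEN conjunct2, THEN conjunct2, THEN conjunct1, rule_format])
  show "\<And>X. X \<in> T \<union> U \<Longrightarrow> comp A X"
    by (rule R[THEN conjunct2, THEN conjunct2, THEN conjunct2, THEN conjunct1, rule_format])
  show "U \<subseteq> g0"
    by (rule R[THEN conjunct2, THEN conjunct2, THEN conjunct2, THEN conjunct2, THEN conjunct1, rule_format])
  show "\<And>X. X \<in> T \<Longrightarrow> \<exists>C \<in> CC. \<exists>C' \<in> CC. C \<noteq> C' \<and> adj C C' \<and> C \<union> C' \<subseteq> lab ` X"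
    by (rule R[THEN conjunct2, THEN conjunct2, THEN conjunct2, THEN conjunct2, THEN conjunct2, THEN conjunct1, rule_format])
  show "\<And>X C. X \<in> T \<Longrightarrow> C \<in> CC \<Longrightarrow> C \<subseteq> lab ` X \<or> C \<inter> lab ` X = {}"
    by (rule R[THEN conjunct2, THEN conjunct2, THEN conjunct2, THEN conjunct2, THEN conjunct2, THEN conjunct2, THEN conjunct1, rule_format])
  show "m \<le> M"
    by (rule R[THEN conjunct2, THEN conjunct2, THEN conjunct2, THEN conjunct2, THEN conjunct2, THEN conjunct2, THEN conjunct2, THEN conjunct1, rule_format])
  show "m \<le> (\<Sum>X\<in>T. card X - 1)"
    by (rule R[THEN conjunct2, THEN conjunct2, THEN conjunct2, THEN conjunct2, THEN conjunct2, THEN conjunct2, THEN conjunct2, THEN conjunct2, THEN conjunct1, rule_format])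
  show "card (g0 - U) \<le> 2 * m"
    by (rule R[THEN conjunct2, THEN conjunct2, THEN conjunct2, THEN conjunct2, THEN conjunct2, THEN conjunct2, THEN conjunct2, THEN conjunct2, THEN conjunct2, THEN conjunct1, rule_format])
  show "\<And>X B. X \<in> T \<union> U \<Longrightarrow> B \<in> U \<Longrightarrow> B \<notin> Ca \<union> Da \<Longrightarrow> lab ` X \<inter> lab ` B = {} \<Longrightarrow>
       xp X B \<inter> (A \<union> D) = {}"
    by (rule R[THEN conjunct2, THEN conjunct2, THEN conjunct2, THEN conjunct2, THEN conjunct2, THEN conjunct2, THEN conjunct2, THEN conjunct2, THEN conjunct2, THEN conjunct2, THEN conjunct1, rule_format])
  show "fresh_xp U \<inter> A = {}"
    by (rule R[THEN conjunct2, THEN conjunct2, THEN conjunct2, THEN conjunct2, THEN conjunct2, THEN conjunct2, THEN conjunct2, THEN conjunct2, THEN conjunct2, THEN conjunct2, THEN conjunct2, THEN conjunct1, rule_format])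
  show "card (D \<inter> fresh_xp U) \<le> \<kappa>"
    by (rule R[THEN conjunct2, THEN conjunct2, THEN conjunct2, THEN conjunct2, THEN conjunct2, THEN conjunct2, THEN conjunct2, THEN conjunct2, THEN conjunct2, THEN conjunct2, THEN conjunct2, THEN conjunct2, rule_format])
qed

lemma R_I:
  assumes "A \<union> D \<subseteq> complete_edges n"
    "\<And>X Y. X \<in> T \<union> U \<Longrightarrow> Y \<in> T \<union> U \<Longrightarrow> X \<noteq> Y \<Longrightarrow> X \<inter> Y = {}" "T \<inter> U = {}"
    "\<And>X. X \<in> T \<union> U \<Longrightarrow> comp A X" "U \<subseteq> g0"
    "\<And>X. X \<in> T \<Longrightarrow> \<exists>C \<in> CC. \<exists>C' \<in> CC. C \<noteq> C' \<and> adj C C' \<and> C \<union> C' \<subseteq> lab ` X"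
    "\<And>X C. X \<in> T \<Longrightarrow> C \<in> CC \<Longrightarrow> C \<subseteq> lab ` X \<or> C \<inter> lab ` X = {}"
    "m \<le> M" "m \<le> (\<Sum>X\<in>T. card X - 1)" "card (g0 - U) \<le> 2 * m"
    "\<And>X B. X \<in> T \<union> U \<Longrightarrow> B \<in> U \<Longrightarrow> B \<notin> Ca \<union> Da \<Longrightarrow> lab ` X \<inter> lab ` B = {} \<Longrightarrow>
       xp X B \<inter> (A \<union> D) = {}"
    "fresh_xp U \<inter> A = {}" "card (D \<inter> fresh_xp U) \<le> \<kappa>"
  shows "R m \<kappa> (T, U) A D"
  unfolding R_def split by (intro conjI ballI impI; (rule assms; assumption))

lemma R_junk:
  assumes R: "R m \<kappa> (T, U) A D" and y: "y \<in> unc n A D" "y \<notin> op (T, U)"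
  shows "R m \<kappa> (T, U) (insert y A) D" "R m \<kappa> (T, U) A (insert y D)"
proof -
  note R = R_D[OF R]
  have yc: "insert y A \<union> D \<subseteq> complete_edges n" "A \<union> insert y D \<subseteq> complete_edges n"
    using y R(1) unfolding unc_def by auto
  have y1: "y \<notin> fresh_xp U"
    using fresh_xp_op y(2) by auto
  have y2: "xp X B \<inter> (insert y A \<union> D) = {}" "xp X B \<inter> (A \<union> insert y D) = {}"
    if "X \<in> T \<union> U" "B \<in> U" "B \<notin> Ca \<union> Da" "lab ` X \<inter> lab ` B = {}" for X B
  proof -
    have "y \<notin> xp X B"
      using y(2) that unfolding op_def by blast
    then show "xp X B \<inter> (insert y A \<union> D) = {}" "xp X B \<inter> (A \<union> insert y D) = {}"
      using R(11)[OF that] by auto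
  qed
  have cm: "comp (insert y A) X" if "X \<in> T \<union> U" for X
    using comp_mono[OF R(4)[OF that]] by blast
  have fr: "fresh_xp U \<inter> insert y A = {}"
    using R(12) y1 by auto
  show "R m \<kappa> (T, U) (insert y A) D"
    by (rule R_I) (fact yc R cm y2 fr)+
  have "insert y D \<inter> fresh_xp U = D \<inter> fresh_xp U"
    using y1 by auto
  then have k: "card (insert y D \<inter> fresh_xp U) \<le> \<kappa>"
    using R(13) by simp
  show "R m \<kappa> (T, U) A (insert y D)"
    by (rule R_I) (fact yc R y2 k)+
qed

text \<open>The killed pair lies between two untouched components of \<open>Ca\<close> and
  \<open>Da\<close>. By disjointness it meets no other component, so the pairs at the saved
  components stay free.\<close>

lemma R_kill:
  assumes R: "R m \<kappa> (T, U) A D" and \<kappa>: "\<kappa> \<le> b * (M + 1)" and "finite g0"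
  shows "\<exists>y \<in> unc n A D \<inter> op (T, U). R m (Suc \<kappa>) (T, U) A (insert y D)"
proof -
  note R = R_D[OF R]
  have "card (g0 - U) \<le> 2 * M"
    using R(8,10) by linarith
  then have "b * (M + 1) < card (fresh_xp U)"
    using fresh_xp_large[of U A] R(4,5) assms(3) by blast
  then have "card (D \<inter> fresh_xp U) < card (fresh_xp U)"
    using R(13) \<kappa> by linarith
  then have "D \<inter> fresh_xp U \<noteq> fresh_xp U"
    by auto
  then obtain y where y: "y \<in> fresh_xp U" "y \<notin> D"
    by auto
  obtain X Y where XY: "X \<in> Ca \<inter> U" "Y \<in> Da \<inter> U" "y \<in> xp X Y"
    using y(1) unfolding fresh_xp_def by auto
  have yc: "y \<in> complete_edges n"
    using xp_complete XY R(4) by blast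
  have y2: "xp Z B \<inter> (A \<union> insert y D) = {}"
    if "Z \<in> T \<union> U" "B \<in> U" "B \<notin> Ca \<union> Da" "lab ` Z \<inter> lab ` B = {}" for Z B
  proof (rule ccontr)
    assume "xp Z B \<inter> (A \<union> insert y D) \<noteq> {}"
    then have "y \<in> xp Z B"
      using R(11)[OF that] by auto
    then have "B \<inter> (X \<union> Y) \<noteq> {}"
      using xp_meets(2)[of y Z B] xp_meets(3)[OF XY(3)] by blast
    then have "B = X \<or> B = Y"
      using R(2)[of B X] R(2)[of B Y] XY that by blast
    then show False
      using that(3) XY by auto
  qed
  have "insert y D \<inter> fresh_xp U = insert y (D \<inter> fresh_xp U)"
    using y by auto
  moreover have "card (insert y (D \<inter> fresh_xp U)) \<le> Suc (card (D \<inter> fresh_xp U))"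
    by (rule card_insert_le_m1) auto
  ultimately have k: "card (insert y D \<inter> fresh_xp U) \<le> Suc \<kappa>"
    using R(13) by simp
  have yD: "A \<union> insert y D \<subseteq> complete_edges n"
    using R(1) yc by auto
  have "R m (Suc \<kappa>) (T, U) A (insert y D)"
    by (rule R_I) (fact yD R y2 k)+
  moreover have "y \<in> unc n A D \<inter> op (T, U)"
    using yc y R(12) fresh_xp_op[of U T] unfolding unc_def by auto
  ultimately show ?thesis
    by blast
qed

text \<open>Whichever pair Avoider picks, at most two components leave \<open>U\<close>, so the
  supply of kills shrinks by a controlled amount. Pairs at saved components stay free because the
  new edge lies inside X \<union> Y.\<close>

lemma R_open:
  assumes R: "R m \<kappa> (T, U) A D" and "m \<noteq> M" and y: "y \<in> unc n A D" "y \<in> op (T, U)"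
    and "finite g0"
  shows "\<exists>g'. R (Suc m) \<kappa> g' (insert y A) D"
proof -
  note R = R_D[OF R]
  obtain X Y where XY: "X \<in> T \<union> U" "Y \<in> T \<union> U" "lab ` X \<inter> lab ` Y = {}" "y \<in> xp X Y"
    using y(2) unfolding op_def by auto
  have ne: "X \<noteq> {}" "Y \<noteq> {}" "finite X" "finite Y"
    using comp_nonempty comp_finite R(4) XY by blast+
  have neq: "X \<noteq> Y"
    using XY(3) ne by auto
  have XYd: "X \<inter> Y = {}"
    using R(2) XY neq by blast
  define T' where "T' = insert (X \<union> Y) (T - {X, Y})"
  define U' where "U' = U - {X, Y}"
  have other: "Z \<inter> (X \<union> Y) = {}" if "Z \<in> T \<union> U" "Z \<noteq> X" "Z \<noteq> Y" for Z
    using R(2) that XY by blast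
  have new: "X \<union> Y \<notin> (T \<union> U) - {X, Y}"
    using other[of "X \<union> Y"] ne by auto
  have yc: "y \<in> complete_edges n"
    using y unfolding unc_def by auto
  have ysub: "y \<subseteq> X \<union> Y"
    using xp_meets(3)[OF XY(4)] .
  have cm: "comp (insert y A) Z" if "Z \<in> T' \<union> U'" for Z
  proof (cases "Z = X \<union> Y")
    case True
    then show ?thesis
      using comp_merge R(4) XY by blast
  next
    case False
    then have "Z \<in> T \<union> U"
      using that unfolding T'_def U'_def by auto
    then show ?thesis
      using comp_mono[OF R(4)] by blast
  qed
  have disj: "Z \<inter> Z' = {}" if "Z \<in> T' \<union> U'" "Z' \<in> T' \<union> U'" "Z \<noteq> Z'" for Z Z'
  proof -
    have old: "Z \<in> T \<union> U \<and> Z \<noteq> X \<and> Z \<noteq> Y" if "Z \<in> T' \<union> U'" "Z \<noteq> X \<union> Y" for Z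
      using that unfolding T'_def U'_def by auto
    show ?thesis
      using old[of Z] old[of Z'] other[of Z] other[of Z'] R(2)[of Z Z'] that
      by (metis Int_commute)
  qed
  have TU': "T' \<inter> U' = {}"
    using R(3) new unfolding T'_def U'_def by auto
  have U'g: "U' \<subseteq> g0"
    using R(5) unfolding U'_def by auto
  have P1: "\<exists>C \<in> CC. \<exists>C' \<in> CC. C \<noteq> C' \<and> adj C C' \<and> C \<union> C' \<subseteq> lab ` Z" if "Z \<in> T'" for Z
  proof (cases "Z = X \<union> Y")
    case True
    consider "X \<in> T" | "Y \<in> T" | "X \<in> U" "Y \<in> U"
      using XY by blast
    then show ?thesis
    proof cases
      case 1
      then obtain C C' where C: "C \<in> CC" "C' \<in> CC" "C \<noteq> C'" "adj C C'" "C \<union> C' \<subseteq> lab ` X"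
        using R(6) by metis
      have sub: "lab ` X \<subseteq> lab ` Z"
        using True by auto
      have "C \<union> C' \<subseteq> lab ` Z"
        by (rule order_trans[OF C(5) sub])
      then show ?thesis
        using C(1-4) by metis
    next
      case 2
      then obtain C C' where C: "C \<in> CC" "C' \<in> CC" "C \<noteq> C'" "adj C C'" "C \<union> C' \<subseteq> lab ` Y"
        using R(6) by metis
      have sub: "lab ` Y \<subseteq> lab ` Z"
        using True by auto
      have "C \<union> C' \<subseteq> lab ` Z"
        by (rule order_trans[OF C(5) sub])
      then show ?thesis
        using C(1-4) by metis
    next
      case 3
      have "adj (lab ` X) (lab ` Y)"
        using XY(4) unfolding adj_def xp_def by auto
      moreover have "lab ` X \<in> CC" "lab ` Y \<in> CC"
        using 3 R(5) g0_lab by auto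
      moreover have "lab ` X \<noteq> lab ` Y"
        using XY(3) ne by auto
      moreover have "lab ` X \<union> lab ` Y \<subseteq> lab ` Z"
        using True by auto
      ultimately show ?thesis
        by metis
    qed
  next
    case False
    then show ?thesis
      using R(6) that unfolding T'_def by blast
  qed
  have cl: "C \<subseteq> lab ` Z \<or> C \<inter> lab ` Z = {}" if "Z \<in> T \<union> U" "C \<in> CC" for Z C
  proof (cases "Z \<in> T")
    case True
    then show ?thesis
      using R(7) that by blast
  next
    case False
    then have "lab ` Z \<in> CC"
      using g0_lab R(5) that by auto
    then show ?thesis
      using CC_disj[OF that(2)] by auto
  qed
  have P2: "C \<subseteq> lab ` Z \<or> C \<inter> lab ` Z = {}" if "Z \<in> T'" "C \<in> CC" for Z C
  proof (cases "Z = X \<union> Y")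
    case True
    then have "lab ` Z = lab ` X \<union> lab ` Y"
      by auto
    then show ?thesis
      using cl[OF XY(1) that(2)] cl[OF XY(2) that(2)] by (metis Int_Un_distrib le_supI1 le_supI2 sup_bot.left_neutral)
  next
    case False
    then show ?thesis
      using cl[of Z C] that unfolding T'_def by blast
  qed
  have finT: "finite T"
    by (rule finite_subset[of _ "Pow {..<n}"], use R(4) comp_D(1) in blast, simp)
  \<comment> \<open>The sum counts the edges of the tree copies in \<open>T\<close>. Components have
    bounded size, so a large sum forces many touched components. Joining X and Y raises it by at
    least one.\<close>
  have P3: "Suc m \<le> (\<Sum>Z\<in>T'. card Z - 1)"
  proof -
    let ?f = "\<lambda>Z::nat set. card Z - 1"
    have "sum ?f T = sum ?f (T \<inter> {X, Y}) + sum ?f (T - {X, Y})"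
      using finT by (rule sum.Int_Diff)
    also have "sum ?f (T \<inter> {X, Y}) \<le> sum ?f {X, Y}"
      by (rule sum_mono2) auto
    also have "sum ?f {X, Y} = ?f X + ?f Y"
      using neq by simp
    finally have 1: "sum ?f T \<le> sum ?f (T - {X, Y}) + (?f X + ?f Y)"
      by simp
    have "sum ?f T' = ?f (X \<union> Y) + sum ?f (T - {X, Y})"
      unfolding T'_def using finT new by (subst sum.insert) auto
    moreover have "card (X \<union> Y) = card X + card Y"
      using XYd ne by (simp add: card_Un_disjoint)
    moreover have "card X \<ge> 1" "card Y \<ge> 1"
      using ne by (simp_all add: Suc_leI card_gt_0_iff)
    ultimately show ?thesis
      using 1 R(9) by linarith
  qed
  have P4: "card (g0 - U') \<le> 2 * Suc m"
  proof -
    have "g0 - U' \<subseteq> (g0 - U) \<union> {X, Y}"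
      unfolding U'_def by auto
    then have "card (g0 - U') \<le> card ((g0 - U) \<union> {X, Y})"
      using \<open>finite g0\<close> by (intro card_mono) auto
    moreover have "card ((g0 - U) \<union> {X, Y}) \<le> card (g0 - U) + card {X, Y}"
      by (rule card_Un_le)
    moreover have "card {X, Y} \<le> 2"
      by (simp add: card_insert_if)
    ultimately show ?thesis
      using R(10) by simp
  qed
  have P5: "xp Z B \<inter> (insert y A \<union> D) = {}"
    if "Z \<in> T' \<union> U'" "B \<in> U'" "B \<notin> Ca \<union> Da" "lab ` Z \<inter> lab ` B = {}" for Z B
  proof -
    have B: "B \<in> U" "B \<noteq> X" "B \<noteq> Y"
      using that unfolding U'_def by auto
    have "y \<inter> B = {}"
      using ysub other[OF _ B(2,3)] B(1) by auto
    then have "y \<notin> xp Z B"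
      using xp_meets(2) by auto
    moreover have "xp Z B \<inter> (A \<union> D) = {}"
    proof (cases "Z = X \<union> Y")
      case True
      have "lab ` X \<inter> lab ` B = {}" "lab ` Y \<inter> lab ` B = {}"
        using that(4) unfolding True by auto
      then have "xp X B \<inter> (A \<union> D) = {}" "xp Y B \<inter> (A \<union> D) = {}"
        using R(11)[OF XY(1) B(1) that(3)] R(11)[OF XY(2) B(1) that(3)] by auto
      then show ?thesis
        unfolding True xp_Un by auto
    next
      case False
      then have "Z \<in> T \<union> U"
        using that(1) unfolding T'_def U'_def by auto
      then show ?thesis
        using R(11)[OF _ B(1) that(3,4)] by simp
    qed
    ultimately show ?thesis
      by auto
  qed
  have fr: "fresh_xp U' \<subseteq> fresh_xp U"
    unfolding fresh_xp_def U'_def by auto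
  have "y \<notin> fresh_xp U'"
  proof
    assume "y \<in> fresh_xp U'"
    then obtain Z B where B: "B \<in> U'" "y \<in> xp Z B"
      unfolding fresh_xp_def by auto
    then have "y \<inter> B = {}"
      using ysub other[of B] unfolding U'_def by auto
    then show False
      using xp_meets(2)[OF B(2)] by simp
  qed
  then have P6: "fresh_xp U' \<inter> insert y A = {}"
    using R(12) fr by auto
  have finD: "finite D"
    using R(1) finite_subset[OF _ finite_complete_edges] by auto
  have "card (D \<inter> fresh_xp U') \<le> card (D \<inter> fresh_xp U)"
    using fr finD by (intro card_mono) auto
  then have P7: "card (D \<inter> fresh_xp U') \<le> \<kappa>"
    using R(13) by linarith
  have yA: "insert y A \<union> D \<subseteq> complete_edges n"
    using R(1) yc by auto
  have "Suc m \<le> M"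
    using R(8) \<open>m \<noteq> M\<close> by simp
  have "R (Suc m) \<kappa> (T', U') (insert y A) D"
    by (rule R_I, rule yA, (rule disj; assumption), rule TU', (rule cm; assumption), rule U'g,
        (rule P1; assumption), (rule P2; assumption), fact, rule P3, rule P4,
        (rule P5; assumption), rule P6, rule P7)
  then show ?thesis
    by (rule exI)
qed

lemma reply_stage:
  assumes A: "A \<union> D \<subseteq> complete_edges n" and cm: "\<And>X. X \<in> g0 \<Longrightarrow> comp A X"
    and un: "\<And>X Y. X \<in> g0 \<Longrightarrow> Y \<in> g0 \<Longrightarrow> lab ` X \<inter> lab ` Y = {} \<Longrightarrow> xp X Y \<inter> (A \<union> D) = {}"
    and nxt: "\<And>\<kappa> T U A D. R M \<kappa> (T, U) A D \<Longrightarrow> reply H n b A D"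
  shows "reply H n b A D"
proof -
  have fing0: "finite g0"
    by (rule finite_subset[of _ "Pow {..<n}"], use cm comp_D(1) in blast, simp)
  have pr: "pressure H n b M R op (\<lambda>m _. m = M)"
  proof (rule pressure.intro)
    fix m \<kappa> g A D assume R: "R m \<kappa> g A D"
    obtain T U where g: "g = (T, U)"
      by (cases g)
    note R = R[unfolded g]
    show "m \<le> M"
      by (rule R_D(8)[OF R])
    show "reply H n b A D" if "m = M"
      using nxt R unfolding that by metis
    show "R m \<kappa> g (insert y A) D" "R m \<kappa> g A (insert y D)" if "y \<in> unc n A D" "y \<notin> op g" for y
      unfolding g by (rule R_junk[OF R that[unfolded g]])+
    show "\<exists>y\<in>unc n A D \<inter> op g. R m (Suc \<kappa>) g A (insert y D)" if "\<kappa> \<le> b * (M + 1)"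
      unfolding g by (rule R_kill[OF R that fing0])
    show "\<exists>g'. R (Suc m) \<kappa> g' (insert y A) D" if "m \<noteq> M" "y \<in> unc n A D" "y \<in> op g" for y
      by (rule R_open[OF R that[unfolded g] fing0])
  qed
  have fr: "fresh_xp g0 \<inter> A = {}" "D \<inter> fresh_xp g0 = {}"
  proof -
    have "p \<notin> A \<union> D" if p: "p \<in> fresh_xp g0" for p
    proof -
      obtain X Y where XY: "X \<in> Ca" "Y \<in> Da" "p \<in> xp X Y"
        using p unfolding fresh_xp_def by auto
      have "lab ` X \<inter> lab ` Y = {}"
        using Ca(2)[OF XY(1)] Da(2)[OF XY(2)] CC_disj[OF C1D1(1-3)] by simp
      then show ?thesis
        using un[of X Y] XY Ca(1) Da(1) by auto
    qed
    then show "fresh_xp g0 \<inter> A = {}" "D \<inter> fresh_xp g0 = {}"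
      by auto
  qed
  have "R 0 0 ({}, g0) A D"
    by (rule R_I) (use A cm un g0_disj fr in simp_all)
  then show ?thesis
    by (rule pressure.reply_if_R[OF pr]) simp
qed

end

section \<open>From one stage to the next\<close>

lemma pigeonhole_fibre:
  assumes "finite T" "finite B" "f ` T \<subseteq> B" "T \<noteq> {}"
  shows "\<exists>y \<in> B. card T \<le> card B * card {x \<in> T. f x = y}"
proof (rule ccontr)
  assume "\<not> ?thesis"
  then have less: "card B * card {x \<in> T. f x = y} < card T" if "y \<in> B" for y
    using that by auto
  have B: "B \<noteq> {}"
    using assms by auto
  have "card T = (\<Sum>y\<in>B. card {x \<in> T. f x = y})"
    using sum.group[OF assms(1,2,3), of "\<lambda>_. 1::nat"] by simp
  then have "card B * card T = (\<Sum>y\<in>B. card B * card {x \<in> T. f x = y})"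
    by (simp add: sum_distrib_left)
  also have "\<dots> < (\<Sum>y\<in>B. card T)"
    using assms(2) B less by (intro sum_strict_mono) auto
  finally show False
    by simp
qed

context labelled_forest
begin

definition bank :: "nat set set \<Rightarrow> 'a set \<Rightarrow> nat set set" where
  "bank g C = {X \<in> g. lab ` X = C}"

text \<open>The components \<open>bank g0 C\<close> with label set \<open>C\<close> number at least \<open>c * w C\<close>. The weights play the
  role of \<open>n / lam ^ (card C - 1)\<close>; the last condition says that the number of merges that the
  next stage produces is at most the size of every bank.\<close>

definition pos :: "real \<Rightarrow> real \<Rightarrow> 'a set set \<Rightarrow> ('a set \<Rightarrow> real) \<Rightarrow> nat set set \<Rightarrow>
    nat set set \<Rightarrow> nat set set \<Rightarrow> bool" where
  "pos c lam CC w g0 A D \<longleftrightarrow>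
     \<Union> CC = verts H \<and> (\<forall>C\<in>CC. \<forall>C'\<in>CC. C \<noteq> C' \<longrightarrow> C \<inter> C' = {}) \<and>
     A \<union> D \<subseteq> complete_edges n \<and>
     (\<forall>X\<in>g0. \<forall>Y\<in>g0. X \<noteq> Y \<longrightarrow> X \<inter> Y = {}) \<and>
     (\<forall>X\<in>g0. comp A X) \<and> (\<forall>X\<in>g0. lab ` X \<in> CC) \<and>
     (\<forall>X\<in>g0. \<forall>Y\<in>g0. lab ` X \<inter> lab ` Y = {} \<longrightarrow> xp X Y \<inter> (A \<union> D) = {}) \<and>
     (\<forall>C\<in>CC. 0 < w C \<and> w C \<le> real n \<and> real n \<le> w C * lam ^ (card C - 1) \<and>
        c * w C \<le> real (card (bank g0 C))) \<and>
     (\<forall>C\<in>CC. \<forall>D\<in>CC. \<forall>C'\<in>CC. C \<noteq> D \<longrightarrow> adj C D \<longrightarrow> w C * w D \<le> real n * lam * w C')"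

lemma pos_D:
  assumes "pos c lam CC w g0 A D"
  shows "\<Union> CC = verts H" "\<And>C C'. C \<in> CC \<Longrightarrow> C' \<in> CC \<Longrightarrow> C \<noteq> C' \<Longrightarrow> C \<inter> C' = {}"
    "A \<union> D \<subseteq> complete_edges n"
    "\<And>X Y. X \<in> g0 \<Longrightarrow> Y \<in> g0 \<Longrightarrow> X \<noteq> Y \<Longrightarrow> X \<inter> Y = {}"
    "\<And>X. X \<in> g0 \<Longrightarrow> comp A X" "\<And>X. X \<in> g0 \<Longrightarrow> lab ` X \<in> CC"
    "\<And>X Y. X \<in> g0 \<Longrightarrow> Y \<in> g0 \<Longrightarrow> lab ` X \<inter> lab ` Y = {} \<Longrightarrow> xp X Y \<inter> (A \<union> D) = {}"
    "\<And>C. C \<in> CC \<Longrightarrow> 0 < w C" "\<And>C. C \<in> CC \<Longrightarrow> w C \<le> real n"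
    "\<And>C. C \<in> CC \<Longrightarrow> real n \<le> w C * lam ^ (card C - 1)"
    "\<And>C. C \<in> CC \<Longrightarrow> c * w C \<le> real (card (bank g0 C))"
    "\<And>C D C'. C \<in> CC \<Longrightarrow> D \<in> CC \<Longrightarrow> C' \<in> CC \<Longrightarrow> C \<noteq> D \<Longrightarrow> adj C D \<Longrightarrow>
       w C * w D \<le> real n * lam * w C'"
  using assms unfolding pos_def by simp_all

lemma bank_nonempty:
  assumes "pos c lam CC w g0 A D" "0 < c" "C \<in> CC"
  shows "bank g0 C \<noteq> {}"
proof -
  have "0 < c * w C"
    using pos_D(8)[OF assms(1,3)] assms(2) by simp
  then have "0 < card (bank g0 C)"
    using pos_D(11)[OF assms(1,3)] by linarith
  then show ?thesis
    by auto
qed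

lemma pos_conn:
  assumes "pos c lam CC w g0 A D" "0 < c" "C \<in> CC"
  shows "conn C"
proof -
  obtain X where "X \<in> g0" "lab ` X = C"
    using bank_nonempty[OF assms] unfolding bank_def by auto
  then show ?thesis
    using comp_D(3)[OF pos_D(5)[OF assms(1)]] by auto
qed

text \<open>Without adjacent classes every edge of H lies inside one class. Choosing one component
  from each bank and inverting the labelling there embeds H; injectivity is automatic because the
  labels differ.\<close>

lemma pos_final:
  assumes pos: "pos c lam CC w g0 A D" and "0 < c"
    and na: "\<And>C D. C \<in> CC \<Longrightarrow> D \<in> CC \<Longrightarrow> C \<noteq> D \<Longrightarrow> \<not> adj C D"
  shows "contains_copy ({..<n}, A) H"
proof -
  define f where "f C = (SOME X. X \<in> bank g0 C)" for C
  have f: "f C \<in> g0" "lab ` f C = C" if "C \<in> CC" for C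
  proof -
    have "\<exists>X. X \<in> bank g0 C"
      using bank_nonempty[OF assms(1,2) that] by auto
    from someI_ex[OF this] show "f C \<in> g0" "lab ` f C = C"
      unfolding f_def bank_def by auto
  qed
  define cl where "cl x = (SOME C. C \<in> CC \<and> x \<in> C)" for x
  have cl: "cl x \<in> CC" "x \<in> cl x" if "x \<in> verts H" for x
  proof -
    have "\<exists>C. C \<in> CC \<and> x \<in> C"
      using pos_D(1)[OF pos] that by auto
    from someI_ex[OF this] show "cl x \<in> CC" "x \<in> cl x"
      unfolding cl_def by auto
  qed
  define \<phi> where "\<phi> x = (SOME u. u \<in> f (cl x) \<and> lab u = x)" for x
  have \<phi>: "\<phi> x \<in> f (cl x)" "lab (\<phi> x) = x" if "x \<in> verts H" for x
  proof -
    have "x \<in> lab ` f (cl x)"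
      using cl[OF that] f(2)[OF cl(1)[OF that]] by simp
    then have "\<exists>u. u \<in> f (cl x) \<and> lab u = x"
      by auto
    from someI_ex[OF this] show "\<phi> x \<in> f (cl x)" "lab (\<phi> x) = x"
      unfolding \<phi>_def by auto
  qed
  have "inj_on \<phi> (verts H)"
    using \<phi>(2) by (metis inj_onI)
  moreover have "\<phi> ` verts H \<subseteq> {..<n}"
  proof
    fix u assume "u \<in> \<phi> ` verts H"
    then obtain x where x: "x \<in> verts H" "u = \<phi> x"
      by auto
    show "u \<in> {..<n}"
      using comp_D(1)[OF pos_D(5)[OF pos f(1)[OF cl(1)[OF x(1)]]]] \<phi>(1)[OF x(1)] x(2) by auto
  qed
  moreover have "\<phi> ` e \<in> A" if e: "e \<in> edges H" for e
  proof -
    obtain x y where xy: "e = {x, y}" "x \<noteq> y"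
      using edge_card[OF e] by (meson card_2_iff)
    have V: "x \<in> verts H" "y \<in> verts H"
      using edge_sub[OF e] xy by auto
    have same: "cl y = cl x"
      using na[OF cl(1)[OF V(1)] cl(1)[OF V(2)]] cl(2)[OF V(1)] cl(2)[OF V(2)] e xy(1)
      unfolding adj_def by auto
    let ?X = "f (cl x)"
    have cm: "comp A ?X"
      by (rule pos_D(5)[OF pos f(1)[OF cl(1)[OF V(1)]]])
    have labX: "lab ` ?X = cl x"
      by (rule f(2)[OF cl(1)[OF V(1)]])
    have "e \<in> hin (lab ` ?X)"
      unfolding labX hin_def using e xy cl(2)[OF V(1)] cl(2)[OF V(2)] same by auto
    then obtain p where p: "p \<in> A" "p \<subseteq> ?X" "lab ` p = e"
      using comp_D(4)[OF cm] by metis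
    have "\<phi> ` e \<subseteq> ?X" "lab ` \<phi> ` e = e"
      using \<phi>[OF V(1)] \<phi>[OF V(2)] same xy by auto
    then have "p = \<phi> ` e"
      using p inj_on_image_eq_iff[OF comp_D(2)[OF cm]] by metis
    then show ?thesis
      using p(1) by simp
  qed
  ultimately show ?thesis
    unfolding contains_copy_def by auto
qed

text \<open>The stage is played on the adjacent classes with the largest product of weights. Avoider
  may merge other classes instead, but their products are no larger, so one weight \<mu> suits every
  label set that can arise, and the product condition of \<open>pos\<close> is inherited.\<close>

lemma pos_step:
  fixes c lam \<delta> :: real
  defines "k \<equiv> card (verts H)"
  defines "c' \<equiv> c\<^sup>2 / (128 * real k * 2 ^ k)"
  assumes pos: "pos c lam CC w g0 A D" and c: "0 < c" "c \<le> 1" and lam: "1 \<le> lam"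
    and b: "real b \<le> lam * real n" and \<delta>: "0 < \<delta>" "\<delta> \<le> c\<^sup>2 / 64"
    and small: "\<And>S. conn S \<Longrightarrow> lam ^ (card S - 1) \<le> \<delta> * real n"
    and ex: "C0 \<in> CC" "D0 \<in> CC" "C0 \<noteq> D0" "adj C0 D0"
    and IH: "\<And>CC' w' g' A' D'. pos c' lam CC' w' g' A' D' \<Longrightarrow> card CC' < card CC \<Longrightarrow>
               reply H n b A' D'"
  shows "reply H n b A D"
proof -
  note P = pos_D[OF pos]
  note conn = pos_conn[OF pos c(1)]
  have finCC: "finite CC"
    using P(1) finite_verts by (simp add: finite_UnionD)
  define PP where "PP = {(C, D). C \<in> CC \<and> D \<in> CC \<and> C \<noteq> D \<and> adj C D}"
  have "PP \<subseteq> CC \<times> CC"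
    unfolding PP_def by auto
  then have finPP: "finite PP"
    using finCC finite_subset by blast
  define val where "val = (\<lambda>(C, D). w C * w D)"
  have "Max (val ` PP) \<in> val ` PP"
    using finPP ex unfolding PP_def by (intro Max_in) auto
  then obtain C1 D1 where CD: "(C1, D1) \<in> PP" "val (C1, D1) = Max (val ` PP)"
    by auto
  have mx: "w C * w D \<le> w C1 * w D1" if "C \<in> CC" "D \<in> CC" "C \<noteq> D" "adj C D" for C D
  proof -
    have "(C, D) \<in> PP"
      using that unfolding PP_def by auto
    then have "val (C, D) \<le> val (C1, D1)"
      unfolding CD(2) using finPP by (intro Max_ge) auto
    then show ?thesis
      unfolding val_def by simp
  qed
  have C1: "C1 \<in> CC" "D1 \<in> CC" "C1 \<noteq> D1" "adj C1 D1"
    using CD(1) unfolding PP_def by auto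
  \<comment> \<open>The number of pairs between the two banks divided by the bias: up to constants,
    the number of merges that can be forced. By the last condition of \<open>pos\<close> it is below
    every old weight.\<close>
  define \<mu> where "\<mu> = w C1 * w D1 / (real n * lam)"
  have n: "0 < real n"
    using P(8)[OF C1(1)] P(9)[OF C1(1)] by linarith
  have nl: "0 < real n * lam"
    using n lam by simp
  have \<mu>pos: "0 < \<mu>"
    unfolding \<mu>_def using P(8)[OF C1(1)] P(8)[OF C1(2)] nl by simp
  have \<mu>w: "w C1 * w D1 = real n * lam * \<mu>"
    unfolding \<mu>_def using n lam by simp
  have \<mu>le: "\<mu> \<le> w C" if "C \<in> CC" for C
    using P(12)[OF C1(1,2) that C1(3,4)] unfolding \<mu>w mult_le_cancel_left_pos[OF nl] .
  have \<mu>ge: "real n \<le> \<mu> * lam ^ (card L - 1)"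
    if C: "C \<in> CC" "D \<in> CC" "C \<noteq> D" "adj C D" and L: "C \<union> D \<subseteq> L" "finite L" for C D L
  proof -
    have card: "card C \<ge> 1" "card D \<ge> 1"
      using conn[OF C(1)] conn[OF C(2)] unfolding conn_def by linarith+
    have "card (C \<union> D) = card C + card D"
      using conn_finite[OF conn[OF C(1)]] conn_finite[OF conn[OF C(2)]] P(2)[OF C(1-3)]
      by (simp add: card_Un_disjoint)
    then have "card C + card D \<le> card L"
      using card_mono[OF L(2,1)] by simp
    then have le: "lam ^ ((card C - 1) + (card D - 1) + 1) \<le> lam ^ (card L - 1)"
      using card lam by (intro power_increasing) auto
    have "real n * real n \<le> (w C * lam ^ (card C - 1)) * (w D * lam ^ (card D - 1))"
      using P(10)[OF C(1)] P(10)[OF C(2)] n by (intro mult_mono) auto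
    also have "\<dots> = (w C * w D) * lam ^ ((card C - 1) + (card D - 1))"
      by (simp add: power_add)
    also have "\<dots> \<le> (w C1 * w D1) * lam ^ ((card C - 1) + (card D - 1))"
      using mx[OF C] lam by (intro mult_right_mono) auto
    also have "\<dots> = real n * (\<mu> * lam ^ ((card C - 1) + (card D - 1) + 1))"
      unfolding \<mu>w by simp
    finally have "real n \<le> \<mu> * lam ^ ((card C - 1) + (card D - 1) + 1)"
      using n by simp
    also have "\<dots> \<le> \<mu> * lam ^ (card L - 1)"
      using le \<mu>pos by simp
    finally show ?thesis .
  qed
  have connU: "conn (C1 \<union> D1)"
    using C1(4) conn_union(1)[OF conn[OF C1(1)] conn[OF C1(2)] P(2)[OF C1(1-3)]]
    unfolding adj_def by auto
  have "real n \<le> \<mu> * lam ^ (card (C1 \<union> D1) - 1)"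
    by (rule \<mu>ge[OF C1 subset_refl conn_finite[OF connU]])
  \<comment> \<open>\<open>small\<close> for the union of the two classes shows that \<mu> is at
    least 1 / \<delta>, which makes \<open>M\<close> below positive.\<close>
  also have "\<dots> \<le> \<mu> * (\<delta> * real n)"
    using small[OF connU] \<mu>pos by simp
  finally have "1 \<le> \<mu> * \<delta>"
    using n by simp
  also have "\<dots> \<le> \<mu> * (c\<^sup>2 / 64)"
    using \<delta>(2) \<mu>pos by simp
  finally have big: "1 \<le> c\<^sup>2 * \<mu> / 64"
    by (simp add: mult.commute)
  \<comment> \<open>Halves of the two banks keep at least c * w / 4 fresh components each, hence at
    least c^2 * n * lam * \<mu> / 16 pairs. The budget b * (M + 1) is at most 2 * b * M, so the
    constant 64 leaves a factor of two.\<close>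
  define M where "M = nat \<lfloor>c\<^sup>2 * \<mu> / 64\<rfloor>"
  have M1: "1 \<le> M"
    unfolding M_def using big by linarith
  have Mle: "real M \<le> c\<^sup>2 * \<mu> / 64"
    unfolding M_def using big by linarith
  have Mr: "real M = real_of_int \<lfloor>c\<^sup>2 * \<mu> / 64\<rfloor>"
    unfolding M_def using big by simp
  have "c\<^sup>2 * \<mu> / 64 < real M + 1"
    unfolding Mr by (rule real_of_int_floor_add_one_gt)
  then have Mge: "c\<^sup>2 * \<mu> / 128 \<le> real M"
    using M1 by linarith
  have Mw: "real M \<le> c * w C / 64" if "C \<in> CC" for C
  proof -
    have "c * \<mu> \<le> 1 * w C"
      using c \<mu>le[OF that] \<mu>pos by (intro mult_mono) auto
    then have "c * (c * \<mu>) \<le> c * w C"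
      using c(1) by simp
    then have "c\<^sup>2 * \<mu> \<le> c * w C"
      by (simp add: power2_eq_square mult.assoc)
    then show ?thesis
      using Mle by linarith
  qed
  have fing0: "finite g0"
    by (rule finite_subset[of _ "Pow {..<n}"], use P(5) comp_D(1) in blast, simp)
  have finbank: "finite (bank g0 C)" for C
    using fing0 unfolding bank_def by simp
  \<comment> \<open>Only half of each bank is exposed to kills. The new label set may be disjoint
    from C1 or D1, and then the other half, whose pairs are still free, has to serve as the bank of
    that class.\<close>
  obtain Ca where Ca: "Ca \<subseteq> bank g0 C1" "card Ca = card (bank g0 C1) div 2"
    by (meson obtain_subset_with_card_n div_le_dividend)
  obtain Da where Da: "Da \<subseteq> bank g0 D1" "card Da = card (bank g0 D1) div 2"
    by (meson obtain_subset_with_card_n div_le_dividend)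
  have half: "c * w C / 4 \<le> real (N div 2 - 2 * M)"
    if "C \<in> CC" "N = card (bank g0 C)" for C N
  proof -
    have "c * w C \<le> real N"
      using P(11) that by simp
    moreover have "real N \<le> 2 * real (N div 2) + 1"
      by linarith
    moreover have "64 \<le> c * w C" "real M \<le> c * w C / 64"
      using Mw[OF that(1)] M1 by linarith+
    moreover have "real (N div 2) - 2 * real M \<le> real (N div 2 - 2 * M)"
      by linarith
    ultimately show ?thesis
      by linarith
  qed
  have region: "b * (M + 1) < (card Ca - 2 * M) * (card Da - 2 * M)"
  proof -
    have "real (b * (M + 1)) \<le> (lam * real n) * (2 * real M)"
      unfolding of_nat_mult using b M1 by (intro mult_mono) auto
    also have "\<dots> \<le> (lam * real n) * (c\<^sup>2 * \<mu> / 32)"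
      using Mle lam by (intro mult_left_mono) auto
    also have "\<dots> = c\<^sup>2 * (w C1 * w D1) / 32"
      unfolding \<mu>w by simp
    also have "\<dots> < c\<^sup>2 * (w C1 * w D1) / 16"
      using c P(8)[OF C1(1)] P(8)[OF C1(2)] by simp
    also have "\<dots> = (c * w C1 / 4) * (c * w D1 / 4)"
      by (simp add: power2_eq_square)
    also have "\<dots> \<le> real (card Ca - 2 * M) * real (card Da - 2 * M)"
      unfolding Ca(2) Da(2) using half[OF C1(1) refl] half[OF C1(2) refl] c P(8)[OF C1(2)]
      by (intro mult_mono) auto
    finally show ?thesis
      by (metis of_nat_less_iff of_nat_mult)
  qed
  interpret st: stage H n lab CC g0 Ca Da C1 D1 b M
  proof
    show "C \<inter> C' = {}" if "C \<in> CC" "C' \<in> CC" "C \<noteq> C'" for C C'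
      using P(2) that by blast
    show "lab ` X \<in> CC" if "X \<in> g0" for X
      using P(6) that by blast
    show "X \<inter> Y = {}" if "X \<in> g0" "Y \<in> g0" "X \<noteq> Y" for X Y
      using P(4) that by blast
  qed (use C1 Ca(1) Da(1) region in \<open>auto simp: bank_def\<close>)
  show ?thesis
  proof (rule st.reply_stage)
    show "A \<union> D \<subseteq> complete_edges n"
      by (rule P(3))
    show "comp A X" if "X \<in> g0" for X
      by (rule P(5)[OF that])
    show "xp X Y \<inter> (A \<union> D) = {}" if "X \<in> g0" "Y \<in> g0" "lab ` X \<inter> lab ` Y = {}" for X Y
      by (rule P(7)[OF that])
  next
    fix \<kappa> T U A' D' assume R: "st.R M \<kappa> (T, U) A' D'"
    note R = st.R_D[OF R]
    have finT: "finite T"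
      by (rule finite_subset[of _ "Pow {..<n}"], use R(4) comp_D(1) in blast, simp)
    have labT: "lab ` X \<subseteq> verts H" if "X \<in> T" for X
      using comp_D(3)[OF R(4)] that unfolding conn_def by auto
    have cardT: "card X \<le> k" if "X \<in> T" for X
    proof -
      have "card X = card (lab ` X)"
        using comp_card[OF R(4)] that by simp
      also have "\<dots> \<le> k"
        unfolding k_def by (rule card_mono[OF finite_verts labT[OF that]])
      finally show ?thesis .
    qed
    have "(\<Sum>X\<in>T. card X - 1) \<le> (\<Sum>X\<in>T. k)"
      using cardT diff_le_self le_trans by (intro sum_mono) metis
    then have MT: "M \<le> k * card T"
      using R(9) by (simp add: mult.commute)
    have Tne: "T \<noteq> {}"
      using MT M1 by auto
    \<comment> \<open>Avoider controls which label sets arise, but there are at most 2^k, so one of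
      them is carried by a fraction 2^(-k) of \<open>T\<close>. Since components have at most
      \<open>k\<close> vertices, \<open>T\<close> has at least M / k members. Together with M \<ge>
      c^2 * \<mu> / 128 this gives the constant \<open>c'\<close>.\<close>
    have "(\<lambda>X. lab ` X) ` T \<subseteq> Pow (verts H)"
      using labT by auto
    then have "\<exists>L \<in> Pow (verts H). card T \<le> card (Pow (verts H)) * card {X \<in> T. lab ` X = L}"
      using finT Tne by (intro pigeonhole_fibre) simp_all
    then obtain L where L: "L \<in> Pow (verts H)"
      "card T \<le> card (Pow (verts H)) * card {X \<in> T. lab ` X = L}"
      by (rule bexE)
    define TL where "TL = {X \<in> T. lab ` X = L}"
    have cT: "card T \<le> 2 ^ k * card TL"
      using L(2) unfolding TL_def k_def by (simp add: card_Pow)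
    have "TL \<noteq> {}"
      using cT Tne finT by auto
    then obtain X0 where X0: "X0 \<in> T" "lab ` X0 = L"
      unfolding TL_def by auto
    have connL: "conn L"
      using comp_D(3)[OF R(4)] X0 by auto
    have finL: "finite L"
      by (rule conn_finite[OF connL])
    obtain C2 D2 where C2: "C2 \<in> CC" "D2 \<in> CC" "C2 \<noteq> D2" "adj C2 D2" "C2 \<union> D2 \<subseteq> L"
      using R(6)[OF X0(1)] unfolding X0(2) by metis
    have CL: "C \<subseteq> L \<or> C \<inter> L = {}" if "C \<in> CC" for C
      using R(7)[OF X0(1) that] unfolding X0(2) .
    have k: "0 < real k"
      using MT M1 by (cases "k = 0") auto
    have TLge: "c' * \<mu> \<le> real (card TL)"
    proof -
      have "c\<^sup>2 * \<mu> / 128 \<le> real (k * card T)"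
        using Mge MT by linarith
      also have "\<dots> \<le> real (k * (2 ^ k * card TL))"
        using cT by (simp only: of_nat_le_iff mult_le_mono2)
      finally have "c\<^sup>2 * \<mu> / 128 \<le> (real k * 2 ^ k) * real (card TL)"
        by simp
      then have "c\<^sup>2 * \<mu> / 128 / (real k * 2 ^ k) \<le> real (card TL)"
        using k by (subst pos_divide_le_eq) (auto simp: mult.commute)
      then show ?thesis
        unfolding c'_def by simp
    qed
    have c'4: "c' \<le> c / 4"
    proof -
      have "1 \<le> real k"
        using k by simp
      then have "1 * 1 \<le> real k * 2 ^ k"
        by (intro mult_mono) auto
      then have "c\<^sup>2 / 128 / (real k * 2 ^ k) \<le> c\<^sup>2 / 128 / 1"
        using k by (intro divide_left_mono) auto
      then have "c' \<le> c\<^sup>2 / 128"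
        by (simp only: c'_def divide_divide_eq_left mult.assoc div_by_1)
      also have "\<dots> \<le> c / 4"
        using c by (simp add: power2_eq_square mult_le_cancel_left1)
      finally show ?thesis .
    qed
    \<comment> \<open>Touched components survive only if they carry the popular label set
      \<open>L\<close>. Untouched ones survive if they were not exposed to kills and their labels
      avoid \<open>L\<close>.\<close>
    define g' where "g' = TL \<union> {B \<in> U. B \<notin> Ca \<union> Da \<and> lab ` B \<inter> L = {}}"
    define CC0 where "CC0 = {C \<in> CC. C \<inter> L = {}}"
    define w' where "w' = w(L := \<mu>)"
    have Lne: "L \<noteq> {}"
      by (rule conn_nonempty[OF connL])
    have w'0: "w' C = w C" if "C \<in> CC0" for C
      using that Lne unfolding w'_def CC0_def by auto
    have w'L: "w' L = \<mu>"
      unfolding w'_def by simp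
    have g'sub: "g' \<subseteq> T \<union> U"
      unfolding g'_def TL_def by auto
    have CC0: "C \<in> CC" "C \<inter> L = {}" if "C \<in> CC0" for C
      using that unfolding CC0_def by auto
    have oldbank: "c' * w C \<le> real (card (bank g' C))" if C: "C \<in> CC0" for C
    proof -
      let ?N = "card (bank g0 C)"
      have sub: "bank g0 C - (Ca \<union> Da) - (g0 - U) \<subseteq> bank g' C"
        unfolding bank_def g'_def using CC0(2)[OF C] by auto
      have "card (bank g0 C \<inter> (Ca \<union> Da)) \<le> ?N div 2"
      proof -
        have "bank g0 C \<inter> (Ca \<union> Da) \<subseteq> (if C = C1 then Ca else if C = D1 then Da else {})"
          using Ca(1) Da(1) C1(3) unfolding bank_def by auto
        then have "card (bank g0 C \<inter> (Ca \<union> Da)) \<le>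
            card (if C = C1 then Ca else if C = D1 then Da else {})"
          using finite_subset[OF Ca(1) finbank] finite_subset[OF Da(1) finbank]
          by (intro card_mono) auto
        also have "\<dots> \<le> ?N div 2"
          using Ca(2) Da(2) by simp
        finally show ?thesis .
      qed
      moreover have "?N \<le> card (bank g0 C - (Ca \<union> Da)) + card (bank g0 C \<inter> (Ca \<union> Da))"
        using card_Un_le[of "bank g0 C - (Ca \<union> Da)" "bank g0 C \<inter> (Ca \<union> Da)"]
        by (simp only: Un_Diff_Int)
      moreover have "card (bank g0 C - (Ca \<union> Da)) \<le>
          card (bank g0 C - (Ca \<union> Da) - (g0 - U)) + card (g0 - U)"
        using diff_card_le_card_Diff[of "g0 - U" "bank g0 C - (Ca \<union> Da)"] fing0 by simp
      moreover have "card (bank g0 C - (Ca \<union> Da) - (g0 - U)) \<le> card (bank g' C)"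
      proof (rule card_mono[OF _ sub])
        show "finite (bank g' C)"
          using finT finite_subset[OF R(5) fing0] unfolding bank_def g'_def TL_def by simp
      qed
      ultimately have "?N \<le> card (bank g' C) + 2 * M + ?N div 2"
        using R(10) by linarith
      then have "real ?N / 2 \<le> real (card (bank g' C)) + 2 * real M"
        by linarith
      moreover have "c * w C \<le> real ?N"
        by (rule P(11)[OF CC0(1)[OF C]])
      moreover have "0 < c * w C"
        using c(1) P(8)[OF CC0(1)[OF C]] by simp
      ultimately have "c * w C / 4 \<le> real (card (bank g' C))"
        using Mw[OF CC0(1)[OF C]] by linarith
      moreover have "c' * w C \<le> c / 4 * w C"
        using c'4 P(8)[OF CC0(1)[OF C]] by (intro mult_right_mono) auto
      ultimately show ?thesis
        by linarith
    qed
    have Lbank: "c' * \<mu> \<le> real (card (bank g' L))"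
    proof -
      have "TL \<subseteq> bank g' L"
        unfolding bank_def g'_def TL_def by auto
      moreover have "finite (bank g' L)"
        using finT finite_subset[OF R(5) fing0] unfolding bank_def g'_def TL_def by simp
      ultimately have "card TL \<le> card (bank g' L)"
        by (intro card_mono)
      then show ?thesis
        using TLge by linarith
    qed
    have \<mu>n: "\<mu> \<le> real n"
      using \<mu>le[OF C1(1)] P(9)[OF C1(1)] by linarith
    have adjw: "w' C * w' D \<le> real n * lam * w' C'"
      if "C \<in> insert L CC0" "D \<in> insert L CC0" "C' \<in> insert L CC0" "C \<noteq> D" "adj C D" for C D C'
    proof -
      note h = that
      have lb: "\<mu> \<le> w' C'"
        using that(3) \<mu>le[OF CC0(1)] w'0 w'L by (metis insertE order_refl)
      have ub: "w' C * w' D \<le> real n * lam * \<mu>"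
      proof (cases "C = L \<or> D = L")
        case False
        then have CD: "C \<in> CC0" "D \<in> CC0"
          using that by auto
        show ?thesis
          using mx[OF CC0(1)[OF CD(1)] CC0(1)[OF CD(2)] that(4,5)] \<mu>w w'0 CD by simp
      next
        case True
        obtain E where E: "E \<in> CC0" "w' C * w' D = \<mu> * w E"
        proof (cases "C = L")
          case True
          then have "D \<in> CC0"
            using h(2,4) by simp
          then show ?thesis
            using that True w'0 w'L by simp
        next
          case False
          then have "C \<in> CC0" "D = L"
            using h(1) \<open>C = L \<or> D = L\<close> by simp_all
          then show ?thesis
            using that w'0 w'L by (simp add: mult.commute)
        qed
        have "1 * real n \<le> lam * real n"
          using lam by (intro mult_right_mono) auto
        then have "real n \<le> real n * lam"
          by (simp add: mult.commute)
        then have "w E \<le> real n * lam"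
          using P(9)[OF CC0(1)[OF E(1)]] by linarith
        then show ?thesis
          using E \<mu>pos by (simp add: mult.commute)
      qed
      have "real n * lam * \<mu> \<le> real n * lam * w' C'"
        by (rule mult_left_mono[OF lb less_imp_le[OF nl]])
      then show ?thesis
        using ub by linarith
    qed
    have pos': "pos c' lam (insert L CC0) w' g' A' D'"
      unfolding pos_def
    proof (intro conjI ballI impI)
      have "x \<in> \<Union> (insert L CC0)" if x: "x \<in> verts H" for x
      proof -
        obtain C where C: "C \<in> CC" "x \<in> C"
          using x P(1) by auto
        show ?thesis
          using CL[OF C(1)] C unfolding CC0_def by auto
      qed
      moreover have "\<Union> (insert L CC0) \<subseteq> verts H"
        using L(1) P(1) unfolding CC0_def by auto
      ultimately show "\<Union> (insert L CC0) = verts H"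
        by auto
    next
      fix C C' assume "C \<in> insert L CC0" "C' \<in> insert L CC0" "C \<noteq> C'"
      then show "C \<inter> C' = {}"
        using P(2)[of C C'] CC0[of C] CC0[of C'] by (metis Int_commute insertE)
    next
      show "A' \<union> D' \<subseteq> complete_edges n"
        by (rule R(1))
    next
      fix X Y assume "X \<in> g'" "Y \<in> g'" "X \<noteq> Y"
      then show "X \<inter> Y = {}"
        using R(2)[of X Y] g'sub by auto
    next
      fix X assume "X \<in> g'"
      then show "comp A' X"
        using R(4)[of X] g'sub by auto
      show "lab ` X \<in> insert L CC0"
        using \<open>X \<in> g'\<close> R(5) P(6)[of X] unfolding g'_def TL_def CC0_def by auto
    next
      fix X Y assume X: "X \<in> g'" and Y: "Y \<in> g'" and dj: "lab ` X \<inter> lab ` Y = {}"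
      \<comment> \<open>Two members of \<open>TL\<close> have the same labels, so of two
        label-disjoint components at least one is outside \<open>TL\<close>; that one is untouched
        and was not exposed to kills.\<close>
      have key: "xp Z B \<inter> (A' \<union> D') = {}" if "Z \<in> g'" "B \<in> g'" "B \<notin> TL" "lab ` Z \<inter> lab ` B = {}"
        for Z B
        using R(11)[of Z B] that g'sub unfolding g'_def by auto
      show "xp X Y \<inter> (A' \<union> D') = {}"
      proof (cases "Y \<in> TL")
        case False
        then show ?thesis
          using key[OF X Y] dj by simp
      next
        case True
        then have "lab ` Y = L"
          unfolding TL_def by auto
        then have "X \<notin> TL"
          using dj Lne unfolding TL_def by auto
        then show ?thesis
          using key[OF Y X] dj by (simp add: xp_commute[of X Y] Int_commute)
      qed
    next
      fix C assume C: "C \<in> insert L CC0"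
      show "0 < w' C"
        using C \<mu>pos P(8)[OF CC0(1)] w'0 w'L by auto
      show "w' C \<le> real n"
        using C \<mu>n P(9)[OF CC0(1)] w'0 w'L by auto
      show "real n \<le> w' C * lam ^ (card C - 1)"
      proof (cases "C = L")
        case True
        then show ?thesis
          using \<mu>ge[OF C2 finL] w'L by simp
      next
        case False
        then show ?thesis
          using C P(10)[OF CC0(1)] w'0 by simp
      qed
      show "c' * w' C \<le> real (card (bank g' C))"
        using C oldbank Lbank w'0 w'L by auto
    next
      fix C D C' assume "C \<in> insert L CC0" "D \<in> insert L CC0" "C' \<in> insert L CC0" "C \<noteq> D" "adj C D"
      then show "w' C * w' D \<le> real n * lam * w' C'"
        by (rule adjw)
    qed
    \<comment> \<open>\<open>L\<close> swallows the two classes C2 and D2, whether or not these are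
      the classes C1 and D1 that Enforcer played on.\<close>
    have "card (insert L CC0) < card CC"
    proof -
      have ne: "C2 \<noteq> {}" "D2 \<noteq> {}"
        using conn[OF C2(1)] conn[OF C2(2)] conn_nonempty by auto
      have fin0: "finite CC0"
        using finCC unfolding CC0_def by simp
      have "C2 \<notin> CC0" "D2 \<notin> CC0"
        using C2(5) ne unfolding CC0_def by auto
      then have "card (insert C2 (insert D2 CC0)) = card CC0 + 2"
        using C2(3) fin0 by simp
      moreover have "card (insert C2 (insert D2 CC0)) \<le> card CC"
        using C2 finCC unfolding CC0_def by (intro card_mono) auto
      moreover have "card (insert L CC0) \<le> Suc (card CC0)"
        using fin0 by (simp add: card_insert_if)
      ultimately show ?thesis
        by linarith
    qed
    then show "reply H n b A' D'"
      by (rule IH[OF pos'])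
  qed
qed

end

context forest
begin

text \<open>A stage lowers the number of classes and replaces \<open>c\<close> by \<open>c'\<close>,
  which depends only on \<open>c\<close> and H. So \<delta> can be the minimum of the value for
  \<open>c'\<close> and the one that \<open>pos_step\<close> asks for, independently of n.\<close>

lemma reply_if_pos:
  "0 < c \<Longrightarrow> c \<le> 1 \<Longrightarrow> \<exists>\<delta>>0. \<forall>n lab lam b CC w g0 A D.
     card CC \<le> N \<longrightarrow> labelled_forest.pos H n lab c lam CC w g0 A D \<longrightarrow> 1 \<le> lam \<longrightarrow>
     real b \<le> lam * real n \<longrightarrow> (\<forall>S. conn S \<longrightarrow> lam ^ (card S - 1) \<le> \<delta> * real n) \<longrightarrow>
     reply H n b A D"
proof (induction N arbitrary: c)
  case 0
  have "reply H n b A D"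
    if "card CC \<le> 0" "labelled_forest.pos H n lab c lam CC w g0 A D" for n lab lam b CC w g0 A D
  proof -
    interpret labelled_forest H n lab
      by unfold_locales
    have "finite CC"
      using pos_D(1)[OF that(2)] finite_verts by (simp add: finite_UnionD)
    then have "CC = {}"
      using that(1) by simp
    then show ?thesis
      by (intro reply_goal pos_final[OF that(2) 0(1)]) simp
  qed
  then show ?case
    by (intro exI[of _ 1] conjI allI impI) simp_all
next
  case (Suc N)
  define k where "k = card (verts H)"
  define c' where "c' = c\<^sup>2 / (128 * real k * 2 ^ k)"
  have IHk: "\<exists>\<delta>>0. \<forall>n lab lam b CC w g0 A D.
     card CC \<le> N \<longrightarrow> labelled_forest.pos H n lab c' lam CC w g0 A D \<longrightarrow> 1 \<le> lam \<longrightarrow>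
     real b \<le> lam * real n \<longrightarrow> (\<forall>S. conn S \<longrightarrow> lam ^ (card S - 1) \<le> \<delta> * real n) \<longrightarrow>
     reply H n b A D" if "0 < k"
  proof (rule Suc.IH)
    show "0 < c'"
      unfolding c'_def using Suc.prems that by simp
    have "c\<^sup>2 \<le> 1"
      using Suc.prems by (simp add: power_le_one)
    moreover have "1 * 1 \<le> real k * 2 ^ k"
      using that by (intro mult_mono) auto
    ultimately show "c' \<le> 1"
      unfolding c'_def by (simp add: divide_le_eq_1)
  qed
  \<comment> \<open>If H has no vertex, then \<open>c'\<close> is 0 through division by zero and the
    induction hypothesis does not apply. Any \<delta>' serves, because no two classes can be
    adjacent.\<close>
  have "\<exists>\<delta>'>0. 0 < k \<longrightarrow> (\<forall>n lab lam b CC w g0 A D.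
     card CC \<le> N \<longrightarrow> labelled_forest.pos H n lab c' lam CC w g0 A D \<longrightarrow> 1 \<le> lam \<longrightarrow>
     real b \<le> lam * real n \<longrightarrow> (\<forall>S. conn S \<longrightarrow> lam ^ (card S - 1) \<le> \<delta>' * real n) \<longrightarrow>
     reply H n b A D)"
  proof (cases "0 < k")
    case True
    show ?thesis
      using IHk[OF True] True by simp
  next
    case False
    then show ?thesis
      by (intro exI[of _ 1]) simp
  qed
  then obtain \<delta>' where \<delta>': "0 < \<delta>'" "0 < k \<longrightarrow> (\<forall>n lab lam b CC w g0 A D.
     card CC \<le> N \<longrightarrow> labelled_forest.pos H n lab c' lam CC w g0 A D \<longrightarrow> 1 \<le> lam \<longrightarrow>
     real b \<le> lam * real n \<longrightarrow> (\<forall>S. conn S \<longrightarrow> lam ^ (card S - 1) \<le> \<delta>' * real n) \<longrightarrow>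
     reply H n b A D)"
    by (elim exE conjE)
  define \<delta> where "\<delta> = min \<delta>' (c\<^sup>2 / 64)"
  have \<delta>: "0 < \<delta>" "\<delta> \<le> c\<^sup>2 / 64" "\<delta> \<le> \<delta>'"
    using \<delta>'(1) Suc.prems unfolding \<delta>_def by auto
  have "reply H n b A D"
    if cC: "card CC \<le> Suc N" and pos: "labelled_forest.pos H n lab c lam CC w g0 A D" and lam: "1 \<le> lam"
      and b: "real b \<le> lam * real n" and small: "\<forall>S. conn S \<longrightarrow> lam ^ (card S - 1) \<le> \<delta> * real n"
    for n lab lam b CC w g0 A D
  proof -
    interpret labelled_forest H n lab
      by unfold_locales
    show ?thesis
    proof (cases "\<exists>C \<in> CC. \<exists>D \<in> CC. C \<noteq> D \<and> adj C D")
      case False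
      then show ?thesis
        by (intro reply_goal pos_final[OF pos Suc.prems(1)]) (use False in metis)
    next
      case True
      then obtain C0 D0 where CD: "C0 \<in> CC" "D0 \<in> CC" "C0 \<noteq> D0" "adj C0 D0"
        by auto
      have "0 < k"
      proof -
        have "conn C0"
          by (rule pos_conn[OF pos Suc.prems(1) CD(1)])
        then have "verts H \<noteq> {}"
          unfolding conn_def by auto
        then show ?thesis
          unfolding k_def by (simp add: card_gt_0_iff)
      qed
      show ?thesis
      proof (rule pos_step[OF pos Suc.prems lam b \<delta>(1,2) _ CD])
        show "lam ^ (card S - 1) \<le> \<delta> * real n" if "conn S" for S
          using small[rule_format, OF that] .
      next
        fix CC' w' g' A' D'
        assume p: "pos (c\<^sup>2 / (128 * real (card (verts H)) * 2 ^ card (verts H))) lam CC' w' g' A' D'"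
          and "card CC' < card CC"
        then have "card CC' \<le> N"
          using cC by linarith
        moreover have "\<forall>S. conn S \<longrightarrow> lam ^ (card S - 1) \<le> \<delta>' * real n"
        proof (intro allI impI)
          fix S assume "conn S"
          then have "lam ^ (card S - 1) \<le> \<delta> * real n"
            using small by simp
          also have "\<dots> \<le> \<delta>' * real n"
            using \<delta>(3) by (intro mult_right_mono) auto
          finally show "lam ^ (card S - 1) \<le> \<delta>' * real n" .
        qed
        ultimately show "reply H n b A' D'"
          using \<delta>'(2)[rule_format, OF \<open>0 < k\<close>, of CC' n lab lam w' g' A' D' b] p lam b
          unfolding c'_def k_def by simp
      qed
    qed
  qed
  then show ?case
    using \<delta>(1) by (intro exI[of _ \<delta>] conjI allI impI) simp_all
qed

text \<open>Residues modulo \<open>k\<close> spread the labels evenly. A label gets at least n / k -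
  1 vertices, of which Avoider's first edge \<open>e\<close> spoils at most two; for n \<ge> 6 * k
  at least n / (2 * k) remain. Leaving out the ends of \<open>e\<close> keeps all pairs between the
  singletons free.\<close>

lemma initial_pos:
  fixes vs :: "nat \<Rightarrow> 'a" and n k :: nat and lam :: real
  defines "lab \<equiv> \<lambda>u. vs (u mod k)"
  assumes k: "k = card (verts H)" "0 < k" and n: "6 * k \<le> n" and e: "e \<in> complete_edges n"
    and vs: "bij_betw vs {..<k} (verts H)" and lam: "1 \<le> lam"
  shows "labelled_forest.pos H n lab (1 / (2 * real k)) lam ((\<lambda>x. {x}) ` verts H) (\<lambda>_. real n)
    {{u} |u. u < n \<and> u \<notin> e} {e} {}"
proof -
  interpret labelled_forest H n lab
    by unfold_locales
  have hin1: "hin {x} = {}" for x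
    unfolding hin_def using edge_card by (fastforce simp: subset_singleton_iff)
  have lab: "lab u \<in> verts H" for u
    using vs k(2) unfolding lab_def by (auto dest: bij_betwE)
  have e2: "finite e" "card e = 2"
    using e unfolding complete_edges_def by (auto intro: card_ge_0_finite)
  have bk: "1 / (2 * real k) * real n \<le> real (card (bank {{u} |u. u < n \<and> u \<notin> e} {x}))"
    if x: "x \<in> verts H" for x
  proof -
    have "x \<in> vs ` {..<k}"
      using vs x unfolding bij_betw_def by simp
    then obtain i where i: "i < k" "vs i = x"
      by auto
    define q where "q = n div k"
    define J where "J = {j. j < q \<and> j * k + i \<notin> e}"
    define J' where "J' = {j. j < q \<and> j * k + i \<in> e}"
    have "(\<lambda>j. j * k + i) ` J' \<subseteq> e" "inj_on (\<lambda>j. j * k + i) J'"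
      using k(2) unfolding J'_def by (auto simp: inj_on_def)
    then have "card J' \<le> 2"
      using card_inj_on_le[of "\<lambda>j. j * k + i" J' e] e2 by simp
    moreover have "{..<q} = J \<union> J'"
      unfolding J_def J'_def by auto
    then have "q \<le> card J + card J'"
      using card_Un_le[of J J'] by (metis card_lessThan)
    moreover have "card J \<le> card (bank {{u} |u. u < n \<and> u \<notin> e} {x})"
    proof (rule card_inj_on_le)
      show "inj_on (\<lambda>j. {j * k + i}) J"
        using k(2) by (auto simp: inj_on_def)
      have "j * k + i < n" if "j < q" for j
      proof -
        have "j * k + i < Suc j * k"
          using i(1) by simp
        also have "\<dots> \<le> (q) * k"
          using that by (intro mult_le_mono1) simp
        also have "\<dots> \<le> n"
          by (simp add: q_def)
        finally show ?thesis .
      qed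
      then show "(\<lambda>j. {j * k + i}) ` J \<subseteq> bank {{u} |u. u < n \<and> u \<notin> e} {x}"
        unfolding J_def bank_def using i by (auto simp: lab_def)
      have "bank {{u} |u. u < n \<and> u \<notin> e} {x} \<subseteq> Pow {..<n}"
        unfolding bank_def by auto
      then show "finite (bank {{u} |u. u < n \<and> u \<notin> e} {x})"
        by (rule finite_subset) simp
    qed
    ultimately have 1: "q \<le> card (bank {{u} |u. u < n \<and> u \<notin> e} {x}) + 2"
      by linarith
    have "real n < real (Suc q * k)"
      using dividend_less_div_times[OF k(2), of n] by (simp only: of_nat_less_iff) (simp add: q_def)
    then have f1: "real n / real k \<le> real q + 1"
      using k(2) by (simp add: pos_divide_le_eq algebra_simps)
    have f2: "6 \<le> real n / real k"
    proof -
      have "real (6 * k) \<le> real n"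
        using n by (simp only: of_nat_le_iff)
      then show ?thesis
        using k(2) by (simp add: pos_le_divide_eq)
    qed
    have f3: "real q \<le> real (card (bank {{u} |u. u < n \<and> u \<notin> e} {x})) + 2"
      using of_nat_mono[OF 1, where ?'a = real] by simp
    have "y / 2 \<le> c" if "y \<le> a + 1" "6 \<le> y" "a \<le> c + 2" for a c y :: real
      using that by linarith
    from this[OF f1 f2 f3]
    have "real n / real k / 2 \<le> real (card (bank {{u} |u. u < n \<and> u \<notin> e} {x}))" .
    then show ?thesis
      by simp
  qed
  show ?thesis
    unfolding pos_def
  proof (intro conjI ballI impI)
    fix X assume "X \<in> {{u} |u. u < n \<and> u \<notin> e}"
    then obtain u where u: "X = {u}" "u < n"
      by auto
    then show "comp {e} X"
      unfolding comp_def conn_def using lab by (simp add: hin1)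
    show "lab ` X \<in> (\<lambda>x. {x}) ` verts H"
      using u lab by auto
  next
    fix X Y assume "X \<in> {{u} |u. u < n \<and> u \<notin> e}" "Y \<in> {{u} |u. u < n \<and> u \<notin> e}"
    then show "xp X Y \<inter> ({e} \<union> {}) = {}"
      unfolding xp_def by auto
  next
    fix C assume "C \<in> (\<lambda>x. {x}) ` verts H"
    then show "1 / (2 * real k) * real n \<le> real (card (bank {{u} |u. u < n \<and> u \<notin> e} C))"
      using bk by auto
    show "real n \<le> real n * lam ^ (card C - 1)"
      using lam by (simp add: mult_le_cancel_left1)
  next
    show "real n * real n \<le> real n * lam * real n"
      using lam by (simp add: mult_le_cancel_left1 mult_right_mono)
  qed (use e n k(2) in auto)
qed

theorem ewin_forest:
  assumes "verts H \<noteq> {}"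
  shows "\<exists>\<delta>>0. \<exists>n0. \<forall>n\<ge>n0. \<forall>lam b. 1 \<le> lam \<longrightarrow> real b \<le> lam * real n \<longrightarrow>
    (\<forall>S. conn S \<longrightarrow> lam ^ (card S - 1) \<le> \<delta> * real n) \<longrightarrow> ewin H n b {} {}"
proof -
  define k where "k = card (verts H)"
  have k: "0 < k"
    using assms unfolding k_def by (simp add: card_gt_0_iff)
  have "0 < 1 / (2 * real k)" "1 / (2 * real k) \<le> 1"
    using k by simp_all
  from reply_if_pos[OF this, of k] obtain \<delta> where \<delta>: "0 < \<delta>" "\<And>n lab lam b CC w g0 A D.
     card CC \<le> k \<Longrightarrow> labelled_forest.pos H n lab (1 / (2 * real k)) lam CC w g0 A D \<Longrightarrow> 1 \<le> lam \<Longrightarrow>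
     real b \<le> lam * real n \<Longrightarrow> (\<forall>S. conn S \<longrightarrow> lam ^ (card S - 1) \<le> \<delta> * real n) \<Longrightarrow>
     reply H n b A D"
    by (elim exE conjE) (simp only:)
  obtain vs where vs: "bij_betw vs {..<k} (verts H)"
    using ex_bij_betw_nat_finite[OF finite_verts] unfolding k_def atLeast0LessThan by auto
  have "ewin H n b {} {}"
    if n: "6 * k \<le> n" and lam: "1 \<le> lam" and b: "real b \<le> lam * real n"
      and small: "\<forall>S. conn S \<longrightarrow> lam ^ (card S - 1) \<le> \<delta> * real n" for n lam b
  proof (rule ewin_moveI)
    have "{0, 1} \<in> complete_edges n"
      using n k unfolding complete_edges_def by auto
    then show "unc n {} {} \<noteq> {}"
      unfolding unc_def by auto
  next
    fix e assume "e \<in> unc n {} {}"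
    then have "e \<in> complete_edges n"
      unfolding unc_def by auto
    from initial_pos[OF k_def k n this vs lam] show "reply H n b {e} {}"
      by (rule \<delta>(2)[OF _ _ lam b small, rotated]) (simp add: k_def card_image_le)
  qed
  then show ?thesis
    using \<delta>(1) by (intro exI[of _ \<delta>] exI[of _ "6 * k"] conjI allI impI) simp_all
qed

end

section \<open>Boards for cycles\<close>

definition pairs :: "'a set \<Rightarrow> 'a set set" where
  "pairs U = {e. e \<subseteq> U \<and> card e = 2}"

lemma finite_pairs [simp]: "finite U \<Longrightarrow> finite (pairs U)"
  unfolding pairs_def by (rule finite_subset[of _ "Pow U"]) auto

definition deg :: "'a set set \<Rightarrow> 'a \<Rightarrow> nat" where
  "deg F u = card {e \<in> F. u \<in> e}"

definition nbrs :: "'a set set \<Rightarrow> 'a set \<Rightarrow> 'a \<Rightarrow> 'a set" where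
  "nbrs F Z z = {z' \<in> Z. {z, z'} \<in> F}"

definition gpath :: "'a set set \<Rightarrow> 'a list \<Rightarrow> bool" where
  "gpath F xs \<longleftrightarrow> distinct xs \<and> successively (\<lambda>x y. {x, y} \<in> F) xs"

lemma gpath_mono: "gpath F xs \<Longrightarrow> F \<subseteq> F' \<Longrightarrow> gpath F' xs"
  unfolding gpath_def by (auto elim: successively_mono)

lemma card_nbrs_mono:
  assumes "F \<subseteq> F'" "finite Z"
  shows "card (nbrs F Z z) \<le> card (nbrs F' Z z)"
  using assms unfolding nbrs_def by (intro card_mono) auto

text \<open>Charging every edge of \<open>F\<close> to one of its ends bounds the number of edges inside every set;
  hence a set that spans many edges contains a large subset of large minimum degree.\<close>

lemma charge_sparse:
  assumes "finite F" "\<And>e. e \<in> F \<Longrightarrow> ch e \<in> e" "\<And>u. card {e \<in> F. ch e = u} \<le> \<Delta>" "finite Z"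
  shows "card {e \<in> F. e \<subseteq> Z} \<le> \<Delta> * card Z"
proof -
  have "{e \<in> F. e \<subseteq> Z} \<subseteq> (\<Union>u\<in>Z. {e \<in> F. ch e = u})"
    using assms(2) by auto
  then have "card {e \<in> F. e \<subseteq> Z} \<le> card (\<Union>u\<in>Z. {e \<in> F. ch e = u})"
    using assms(1,4) by (intro card_mono) auto
  also have "\<dots> \<le> (\<Sum>u\<in>Z. card {e \<in> F. ch e = u})"
    by (rule card_UN_le[OF assms(4)])
  also have "\<dots> \<le> (\<Sum>u\<in>Z. \<Delta>)"
    by (intro sum_mono assms(3))
  finally show ?thesis
    by (simp add: mult.commute)
qed

text \<open>Z maximizes the number of edges inside minus d * |Z|. Deleting a vertex with fewer than
  d edges into Z would increase this value.\<close>

lemma dense_core: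
  assumes "finite F" "finite Y"
  shows "\<exists>Z \<subseteq> Y. (\<forall>z \<in> Z. d \<le> card {e \<in> F. e \<subseteq> Z \<and> z \<in> e}) \<and>
     card {e \<in> F. e \<subseteq> Y} + d * card Z \<le> card {e \<in> F. e \<subseteq> Z} + d * card Y"
proof -
  define f where "f Z = int (card {e \<in> F. e \<subseteq> Z}) - int (d * card Z)" for Z
  have "Max (f ` Pow Y) \<in> f ` Pow Y"
    using assms(2) by (intro Max_in) auto
  then obtain Z where Z: "Z \<subseteq> Y" "f Z = Max (f ` Pow Y)"
    by auto
  have mx: "f Z' \<le> f Z" if "Z' \<subseteq> Y" for Z'
    unfolding Z(2) using assms(2) that by (intro Max_ge) auto
  have "d \<le> card {e \<in> F. e \<subseteq> Z \<and> z \<in> e}" if z: "z \<in> Z" for z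
  proof -
    have split: "{e \<in> F. e \<subseteq> Z} = {e \<in> F. e \<subseteq> Z - {z}} \<union> {e \<in> F. e \<subseteq> Z \<and> z \<in> e}"
      by auto
    have "card {e \<in> F. e \<subseteq> Z} \<le> card {e \<in> F. e \<subseteq> Z - {z}} + card {e \<in> F. e \<subseteq> Z \<and> z \<in> e}"
      by (subst split) (rule card_Un_le)
    moreover have "card Z = Suc (card (Z - {z}))"
      by (rule card.remove[OF finite_subset[OF Z(1) assms(2)] z])
    moreover have "f (Z - {z}) \<le> f Z"
      by (rule mx) (use Z(1) in auto)
    ultimately show ?thesis
      unfolding f_def by simp
  qed
  moreover have "card {e \<in> F. e \<subseteq> Y} + d * card Z \<le> card {e \<in> F. e \<subseteq> Z} + d * card Y"
  proof -
    have "int (card {e \<in> F. e \<subseteq> Y}) + int (d * card Z) \<le> int (card {e \<in> F. e \<subseteq> Z}) + int (d * card Y)"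
      using mx[OF subset_refl] unfolding f_def by linarith
    then show ?thesis
      by (simp only: of_nat_add[symmetric] of_nat_le_iff)
  qed
  ultimately show ?thesis
    using Z(1) by blast
qed

lemma degree_le_nbrs:
  assumes "\<And>e. e \<in> F \<Longrightarrow> card e = 2" "finite Z"
  shows "card {e \<in> F. e \<subseteq> Z \<and> z \<in> e} \<le> card (nbrs F Z z)"
proof (rule surj_card_le)
  show "finite (nbrs F Z z)"
    using assms(2) unfolding nbrs_def by simp
  show "{e \<in> F. e \<subseteq> Z \<and> z \<in> e} \<subseteq> (\<lambda>y. {z, y}) ` nbrs F Z z"
  proof
    fix e assume e: "e \<in> {e \<in> F. e \<subseteq> Z \<and> z \<in> e}"
    then obtain x y where "e = {x, y}" "x \<noteq> y"
      using assms(1) by (metis (no_types, lifting) card_2_iff mem_Collect_eq)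
    then obtain y' where "e = {z, y'}"
      using e by auto
    then show "e \<in> (\<lambda>y. {z, y}) ` nbrs F Z z"
      using e unfolding nbrs_def by auto
  qed
qed

lemma sum_deg:
  assumes "finite F" "finite U" "F \<subseteq> pairs U"
  shows "(\<Sum>u\<in>U. deg F u) = 2 * card F"
  unfolding deg_def
proof (rule sum_multicount[OF assms(2,1)])
  show "\<forall>e\<in>F. card {u \<in> U. u \<in> e} = 2"
  proof
    fix e assume "e \<in> F"
    then have "{u \<in> U. u \<in> e} = e" "card e = 2"
      using assms(3) unfolding pairs_def by auto
    then show "card {u \<in> U. u \<in> e} = 2"
      by simp
  qed
qed

lemma gpath_extend:
  assumes "gpath F xs" "xs \<noteq> []" "y \<notin> set xs" "{last xs, y} \<in> F"
  shows "gpath F (xs @ [y])"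
  using assms unfolding gpath_def by (auto simp: successively_append_iff)

text \<open>Greedy extension: while the path has fewer than d vertices, its end has a neighbour in Z
  off the path.\<close>

lemma long_path:
  assumes "z \<in> Z" "finite Z" "\<And>z. z \<in> Z \<Longrightarrow> d \<le> card (nbrs F Z z)" "j < d"
  shows "\<exists>xs. gpath F xs \<and> set xs \<subseteq> Z \<and> hd xs = z \<and> length xs = Suc j"
  using assms(4)
proof (induction j)
  case 0
  then show ?case
    using assms(1) by (intro exI[of _ "[z]"]) (auto simp: gpath_def)
next
  case (Suc j)
  then obtain xs where xs: "gpath F xs" "set xs \<subseteq> Z" "hd xs = z" "length xs = Suc j"
    by auto
  then have ne: "xs \<noteq> []"
    by auto
  have "card (set xs) < card (nbrs F Z (last xs))"
  proof -
    have "last xs \<in> Z"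
      using xs(2) ne by auto
    then show ?thesis
      using assms(3) Suc.prems card_length[of xs] xs(4) by fastforce
  qed
  then have "\<not> nbrs F Z (last xs) \<subseteq> set xs"
    by (meson List.finite_set card_mono not_le)
  then obtain y where y: "y \<in> nbrs F Z (last xs)" "y \<notin> set xs"
    by auto
  then have "gpath F (xs @ [y])"
    using gpath_extend[OF xs(1) ne] unfolding nbrs_def by auto
  then show ?case
    using xs y ne unfolding nbrs_def by (intro exI[of _ "xs @ [y]"]) auto
qed

text \<open>With \<open>j = l - 3\<close> the path has l - 1 vertices, so one further vertex
  adjacent to both ends closes a cycle of length l.\<close>

definition partner :: "'a set set \<Rightarrow> 'a set \<Rightarrow> nat \<Rightarrow> 'a \<Rightarrow> 'a \<Rightarrow> bool" where
  "partner F Z j z y \<longleftrightarrow>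
     (\<exists>xs. gpath F xs \<and> set xs \<subseteq> Z \<and> hd xs = z \<and> last xs = y \<and> length xs = Suc (Suc j))"

text \<open>A greedy path is stopped one vertex early. Its end has at least d - (j + 1) \<ge> 3
  neighbours off the path, and each of them is a partner of z.\<close>

lemma three_partners:
  assumes "z \<in> Z" "finite Z" "\<And>z. z \<in> Z \<Longrightarrow> d \<le> card (nbrs F Z z)" "j + 4 \<le> d"
  shows "\<exists>P \<subseteq> Z. card P = 3 \<and> (\<forall>y \<in> P. partner F Z j z y)"
proof -
  obtain xs where xs: "gpath F xs" "set xs \<subseteq> Z" "hd xs = z" "length xs = Suc j"
    using long_path[OF assms(1-3), of j] assms(4) by auto
  have ne: "xs \<noteq> []"
    using xs(4) by auto
  let ?N = "nbrs F Z (last xs) - set xs"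
  have "d \<le> card (nbrs F Z (last xs))"
    by (rule assms(3)) (use xs(2) ne in auto)
  moreover have "card (nbrs F Z (last xs)) - card (set xs) \<le> card ?N"
    by (rule diff_card_le_card_Diff) simp
  moreover have "card (set xs) \<le> Suc j"
    using card_length[of xs] xs(4) by simp
  ultimately have "3 \<le> card ?N"
    using assms(4) by linarith
  then obtain P where P: "P \<subseteq> ?N" "card P = 3"
    by (meson obtain_subset_with_card_n)
  have "partner F Z j z y" if "y \<in> P" for y
  proof -
    have y: "y \<in> Z" "{last xs, y} \<in> F" "y \<notin> set xs"
      using P(1) that unfolding nbrs_def by auto
    then show ?thesis
      unfolding partner_def using gpath_extend[OF xs(1) ne y(3,2)] xs ne
      by (intro exI[of _ "xs @ [y]"]) auto
  qed
  moreover have "P \<subseteq> Z"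
    using P(1) unfolding nbrs_def by auto
  ultimately show ?thesis
    using P(2) by blast
qed

lemma card_supersets:
  assumes "finite Z" "P \<subseteq> Z"
  shows "card {S \<in> Pow Z. P \<subseteq> S} = 2 ^ (card Z - card P)"
proof -
  have "bij_betw (\<lambda>S. S \<union> P) (Pow (Z - P)) {S \<in> Pow Z. P \<subseteq> S}"
  proof (rule bij_betw_byWitness[where f' = "\<lambda>S. S - P"])
    show "(\<lambda>S. S \<union> P) ` Pow (Z - P) \<subseteq> {S \<in> Pow Z. P \<subseteq> S}"
      using assms(2) by auto
  qed auto
  then have "card {S \<in> Pow Z. P \<subseteq> S} = card (Pow (Z - P))"
    by (simp add: bij_betw_same_card)
  also have "\<dots> = 2 ^ (card Z - card P)"
    using assms finite_subset[OF assms(2,1)] by (simp add: card_Pow card_Diff_subset)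
  finally show ?thesis .
qed

text \<open>A random subset of \<open>Z\<close> contains a given vertex with probability 1/2 and a given set of three
  partners with probability 1/8.\<close>

lemma avoid_partners:
  assumes "finite Z" and P: "\<And>z. z \<in> Z \<Longrightarrow> P z \<subseteq> Z" "\<And>z. z \<in> Z \<Longrightarrow> card (P z) = 3"
  shows "\<exists>S \<subseteq> Z. 3 * card Z \<le> 8 * card S \<and> (\<forall>z \<in> Z. \<exists>y \<in> P z. y \<notin> S)"
proof -
  define bad where "bad S = {z \<in> Z. P z \<subseteq> S}" for S
  \<comment> \<open>The factor 8 clears the denominators of 1/2 and 1/8. Integers are used because a
    set can have more bad vertices than elements.\<close>
  define f where "f S = 8 * (int (card S) - int (card (bad S)))" for S
  have "\<exists>S \<in> Pow Z. 3 * int (card Z) \<le> f S"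
  proof (cases "Z = {}")
    case True
    then show ?thesis
      by (simp add: f_def bad_def)
  next
    case False
    then obtain z where "z \<in> Z"
      by auto
    \<comment> \<open>Ensures that the exponent in \<open>2 ^ (card Z - 3)\<close> is not truncated
      when the bad sets are counted.\<close>
    then have "3 \<le> card Z"
      using P card_mono[OF assms(1)] by metis
    then obtain j where j: "card Z = j + 3"
      by (metis add.commute le_Suc_ex)
    have "(\<Sum>S\<in>Pow Z. card S) = (\<Sum>S\<in>Pow Z. card {z \<in> Z. z \<in> S})"
      by (intro sum.cong refl arg_cong[of _ _ card]) auto
    also have "\<dots> = 2 ^ (j + 2) * card Z"
    proof (rule sum_multicount)
      show "\<forall>z\<in>Z. card {S \<in> Pow Z. z \<in> S} = 2 ^ (j + 2)"
      proof
        fix z assume "z \<in> Z"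
        then show "card {S \<in> Pow Z. z \<in> S} = 2 ^ (j + 2)"
          using card_supersets[OF assms(1), of "{z}"] j by simp
      qed
    qed (use assms(1) in auto)
    finally have s1: "(\<Sum>S\<in>Pow Z. card S) = 2 ^ (j + 2) * card Z" .
    have "(\<Sum>S\<in>Pow Z. card (bad S)) = 2 ^ j * card Z"
      unfolding bad_def
    proof (rule sum_multicount)
      show "\<forall>z\<in>Z. card {S \<in> Pow Z. P z \<subseteq> S} = 2 ^ j"
        using card_supersets[OF assms(1)] P j by simp
    qed (use assms(1) in auto)
    then have "(\<Sum>S\<in>Pow Z. f S) = 8 * (2 ^ (j + 2) * int (card Z) - 2 ^ j * int (card Z))"
      unfolding f_def sum_distrib_left[symmetric] sum_subtractf of_nat_sum[symmetric] s1 by simp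
    also have "\<dots> = (\<Sum>S\<in>Pow Z. 3 * int (card Z))"
      using assms(1) j by (simp add: card_Pow power_add)
    finally have "(\<Sum>S\<in>Pow Z. 3 * int (card Z)) \<le> (\<Sum>S\<in>Pow Z. f S)"
      by simp
    then show ?thesis
      using sum_strict_mono[of "Pow Z" f "\<lambda>_. 3 * int (card Z)"] assms(1)
      by (meson Pow_not_empty finite_Pow_iff linorder_not_less)
  qed
  then obtain S where S: "S \<subseteq> Z" "3 * int (card Z) \<le> f S"
    by auto
  define y where "y z = (SOME y. y \<in> P z)" for z
  have y: "y z \<in> P z" if "z \<in> Z" for z
  proof -
    have "\<exists>y. y \<in> P z"
      using P(2)[OF that] by (metis card.empty equals0I zero_neq_numeral)
    then show ?thesis
      unfolding y_def by (rule someI_ex)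
  qed
  \<comment> \<open>Deletion: for each vertex all of whose partners lie in S, one partner is thrown
    out. On average (1/2 - 1/8) * card Z elements are left.\<close>
  define S' where "S' = S - y ` bad S"
  have fb: "finite (bad S)"
    using assms(1) unfolding bad_def by simp
  have "card S - card (y ` bad S) \<le> card S'"
    unfolding S'_def using fb by (intro diff_card_le_card_Diff) simp
  moreover have "card (y ` bad S) \<le> card (bad S)"
    using fb by (rule card_image_le)
  ultimately have "int (card S) - int (card (bad S)) \<le> int (card S')"
    by linarith
  then have "int (3 * card Z) \<le> int (8 * card S')"
    using S(2) unfolding f_def by simp
  then have "3 * card Z \<le> 8 * card S'"
    by (simp only: of_nat_le_iff)
  moreover have "\<exists>x \<in> P z. x \<notin> S'" if "z \<in> Z" for z
  proof (cases "z \<in> bad S")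
    case True
    then show ?thesis
      using y[OF that] unfolding S'_def by auto
  next
    case False
    then show ?thesis
      using that unfolding bad_def S'_def by auto
  qed
  moreover have "S' \<subseteq> Z"
    using S(1) unfolding S'_def by auto
  ultimately show ?thesis
    by blast
qed

text \<open>The minimum degree condition allows to attach trees to the cycle greedily.\<close>

definition rich_cycle :: "nat set \<Rightarrow> nat \<Rightarrow> nat \<Rightarrow> nat set set \<Rightarrow> bool" where
  "rich_cycle U l k A \<longleftrightarrow> (\<exists>R xs. R \<subseteq> U \<and> gpath A xs \<and> length xs = l \<and> set xs \<subseteq> R \<and>
     {last xs, hd xs} \<in> A \<and> (\<forall>u \<in> R. k \<le> card (nbrs A R u)))"

lemma rich_cycle_mono:
  assumes "rich_cycle U l k A" "A \<subseteq> A'" "finite U"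
  shows "rich_cycle U l k A'"
proof -
  obtain R xs where R: "R \<subseteq> U" "gpath A xs" "length xs = l" "set xs \<subseteq> R" "{last xs, hd xs} \<in> A"
    "\<forall>u \<in> R. k \<le> card (nbrs A R u)"
    using assms(1) unfolding rich_cycle_def by auto
  have "k \<le> card (nbrs A' R u)" if "u \<in> R" for u
    using R(6) that card_nbrs_mono[OF assms(2) finite_subset[OF R(1) assms(3)], of u] le_trans by blast
  then show ?thesis
    unfolding rich_cycle_def using R gpath_mono[OF R(2) assms(2)] assms(2)
    by (intro exI[of _ R] exI[of _ xs]) auto
qed

text \<open>First Enforcer kills pairs inside \<open>B\<close> while pairs with an unsaturated end (degree below
  \<open>32 * d\<close>) are open. Once half of \<open>B\<close> or half of \<open>W\<close> is saturated, Avoider's edges contain a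
  core \<open>Z\<close> of large minimum degree, and no pair at an unsaturated vertex of \<open>W\<close> has been taken by
  Enforcer. In the second phase the pairs between \<open>Z\<close> and a set \<open>W'\<close> of such vertices are open,
  Enforcer kills only at \<open>Sp \<subseteq> Z\<close>, and every vertex of \<open>Z\<close> has a partner outside \<open>Sp\<close>, with
  which it closes a cycle through any vertex of \<open>W'\<close> that Avoider has joined to it.\<close>

locale board =
  fixes U W B :: "nat set" and d k l h K0 :: nat
  assumes UWB: "U = W \<union> B" "W \<inter> B = {}" "finite U" "card W = 32 * h" "card B = 32 * h"
    and par: "3 \<le> l" "1 \<le> k" "k \<le> d" "l + 2 \<le> d" "1 \<le> h"
    and big: "2 * (K0 + (2048 * d * h + k * h + 1)) < h * h"
begin

abbreviation Good :: "nat set set \<Rightarrow> bool" where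
  "Good \<equiv> rich_cycle U l k"

abbreviation sat :: "nat set set \<Rightarrow> nat \<Rightarrow> bool" where
  "sat F u \<equiv> 32 * d \<le> deg F u"

section \<open>Positions on a single board\<close>

definition op1 :: "nat set set \<Rightarrow> nat set set" where
  "op1 F = {e \<in> pairs U. \<exists>u \<in> e. \<not> sat F u}"

text \<open>The supply of kills in the first phase. As it lies inside \<open>B\<close>, Enforcer
  leaves alone every pair at an unsaturated vertex of \<open>W\<close>.\<close>

definition Bun :: "nat set set \<Rightarrow> nat set set" where
  "Bun F = {e \<in> pairs U. e \<subseteq> B \<and> (\<forall>u \<in> e. \<not> sat F u)}"

text \<open>\<open>F\<close> are the open edges taken by Avoider, \<open>ch\<close> charges each of them to an end that was
  unsaturated when it was taken.\<close>

definition inv1 :: "nat set set \<Rightarrow> (nat set \<Rightarrow> nat) \<Rightarrow> nat \<Rightarrow> nat \<Rightarrow> nat set set \<Rightarrow> nat set set \<Rightarrow> bool" where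
  "inv1 F ch m \<kappa> A D \<longleftrightarrow> F \<subseteq> A \<and> A \<subseteq> pairs U \<and> D \<subseteq> pairs U \<and>
     (\<forall>e \<in> F. ch e \<in> e) \<and> (\<forall>u. card {e \<in> F. ch e = u} \<le> 32 * d) \<and>
     A \<inter> op1 F \<subseteq> F \<and> (\<forall>e \<in> D \<inter> op1 F. e \<subseteq> B) \<and> card (D \<inter> Bun F) \<le> \<kappa> \<and> m = card F"

text \<open>The state \<open>g\<close> records the open pairs and a flag. The flag says that the
  board has a rich cycle or at least h / 2 pairs that would close one.\<close>

definition st1 :: "nat \<Rightarrow> nat \<Rightarrow> nat set set \<times> bool \<Rightarrow> nat set set \<Rightarrow> nat set set \<Rightarrow> bool" where
  "st1 m \<kappa> g A D \<longleftrightarrow> (\<exists>F ch. inv1 F ch m \<kappa> A D \<and> g = (op1 F, False) \<and>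
     card {u \<in> W. sat F u} < 16 * h \<and> card {u \<in> B. sat F u} < 16 * h)"

definition base2 :: "nat set \<Rightarrow> nat set \<Rightarrow> nat set \<Rightarrow> nat set set \<Rightarrow> bool" where
  "base2 Z W' Sp A \<longleftrightarrow> Z \<subseteq> U \<and> W' \<subseteq> U \<and> Z \<inter> W' = {} \<and> card W' = h \<and> Sp \<subseteq> Z \<and> h \<le> card Sp \<and>
     (\<forall>z \<in> Z. k \<le> card (nbrs A Z z)) \<and> (\<forall>z \<in> Z. \<exists>y \<in> Z - Sp. partner A Z (l - 3) z y)"

abbreviation sat2 :: "nat set \<Rightarrow> nat set set \<Rightarrow> nat \<Rightarrow> bool" where
  "sat2 Z A v \<equiv> k \<le> card (nbrs A Z v)"

definition zw :: "nat set \<Rightarrow> nat set \<Rightarrow> nat set set" where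
  "zw Z W' = {{z, v} |z v. z \<in> Z \<and> v \<in> W'}"

text \<open>\<open>Q\<close> collects closing pairs, with a free one at every vertex of W' that has
  \<open>k\<close> neighbours in Z. They are kept open so that Enforcer does not use them up as
  junk. The sum in the last line counts the open moves of the second phase.\<close>

definition inv2 :: "nat set \<Rightarrow> nat set \<Rightarrow> nat set \<Rightarrow> nat set set \<Rightarrow> nat \<Rightarrow> nat \<Rightarrow>
    nat set set \<Rightarrow> nat set set \<Rightarrow> bool" where
  "inv2 Z W' Sp Q m \<kappa> A D \<longleftrightarrow> A \<subseteq> pairs U \<and> D \<subseteq> pairs U \<and> base2 Z W' Sp A \<and>
     (\<forall>v \<in> W'. \<not> sat2 Z A v \<longrightarrow> (\<forall>z \<in> Z - Sp. {z, v} \<notin> D)) \<and>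
     card (D \<inter> zw Sp {v \<in> W'. \<not> sat2 Z A v}) \<le> \<kappa> \<and>
     (\<forall>v \<in> W'. sat2 Z A v \<longrightarrow> (\<exists>z \<in> Z. {z, v} \<in> Q \<and> {z, v} \<notin> A \<union> D)) \<and>
     Q \<subseteq> zw Z {v \<in> W'. sat2 Z A v} \<and> (\<forall>p \<in> Q. Good (insert p A)) \<and>
     m \<le> 2048 * d * h + (\<Sum>v\<in>W'. min k (card (nbrs A Z v)))"

definition st2 :: "nat \<Rightarrow> nat \<Rightarrow> nat set set \<times> bool \<Rightarrow> nat set set \<Rightarrow> nat set set \<Rightarrow> bool" where
  "st2 m \<kappa> g A D \<longleftrightarrow> (\<exists>Z W' Sp Q. inv2 Z W' Sp Q m \<kappa> A D \<and>
     g = (zw Z {v \<in> W'. \<not> sat2 Z A v} \<union> Q, h \<le> 2 * card {v \<in> W'. sat2 Z A v}))"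

definition st3 :: "nat \<Rightarrow> nat \<Rightarrow> nat set set \<times> bool \<Rightarrow> nat set set \<Rightarrow> nat set set \<Rightarrow> bool" where
  "st3 m \<kappa> g A D \<longleftrightarrow> Good A \<and> A \<subseteq> pairs U \<and> D \<subseteq> pairs U \<and> g = ({}, True) \<and>
     m \<le> 2048 * d * h + k * h + 1"

definition R :: "nat \<Rightarrow> nat \<Rightarrow> nat set set \<times> bool \<Rightarrow> nat set set \<Rightarrow> nat set set \<Rightarrow> bool" where
  "R m \<kappa> g A D \<longleftrightarrow> st1 m \<kappa> g A D \<or> st2 m \<kappa> g A D \<or> st3 m \<kappa> g A D"

lemma finWB: "finite W" "finite B"
  using UWB by auto

lemma big': "K0 + 2048 * d * h < h * h"
  by (rule le_less_trans[OF _ big]) simp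

lemma card_U: "card U = 64 * h"
  using UWB card_Un_disjoint[OF finWB UWB(2)] by simp

lemma finite_sub: "A \<subseteq> pairs U \<Longrightarrow> finite A"
  using finite_pairs[OF UWB(3)] finite_subset by blast

lemma Good_mono: "Good A \<Longrightarrow> A \<subseteq> A' \<Longrightarrow> Good A'"
  using rich_cycle_mono UWB(3) by blast

lemma sat_mono: "F \<subseteq> F' \<Longrightarrow> finite F' \<Longrightarrow> sat F u \<Longrightarrow> sat F' u"
  unfolding deg_def using card_mono[of "{e \<in> F'. u \<in> e}" "{e \<in> F. u \<in> e}"] by force

section \<open>First phase: saturation\<close>

lemma inv1_D:
  assumes "inv1 F ch m \<kappa> A D"
  shows "F \<subseteq> A" "A \<subseteq> pairs U" "D \<subseteq> pairs U" "\<And>e. e \<in> F \<Longrightarrow> ch e \<in> e"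
    "\<And>u. card {e \<in> F. ch e = u} \<le> 32 * d" "A \<inter> op1 F \<subseteq> F" "\<And>e. e \<in> D \<Longrightarrow> e \<in> op1 F \<Longrightarrow> e \<subseteq> B"
    "card (D \<inter> Bun F) \<le> \<kappa>" "m = card F"
  using assms unfolding inv1_def by auto

lemma inv1_I:
  assumes "F \<subseteq> A" "A \<subseteq> pairs U" "D \<subseteq> pairs U" "\<And>e. e \<in> F \<Longrightarrow> ch e \<in> e"
    "\<And>u. card {e \<in> F. ch e = u} \<le> 32 * d" "A \<inter> op1 F \<subseteq> F" "\<And>e. e \<in> D \<Longrightarrow> e \<in> op1 F \<Longrightarrow> e \<subseteq> B"
    "card (D \<inter> Bun F) \<le> \<kappa>" "m = card F"
  shows "inv1 F ch m \<kappa> A D"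
  using assms unfolding inv1_def by auto

lemma inv1_sparse:
  assumes "inv1 F ch m \<kappa> A D" "Z \<subseteq> U"
  shows "card {e \<in> F. e \<subseteq> Z} \<le> 32 * d * card Z"
proof (rule charge_sparse)
  show "finite F"
    using inv1_D(1,2)[OF assms(1)] finite_sub finite_subset by blast
  show "finite Z"
    using assms(2) UWB(3) finite_subset by blast
qed (use inv1_D[OF assms(1)] in auto)

text \<open>The constant is 32 * d charges at each of 64 * h vertices.\<close>

lemma inv1_m:
  assumes "inv1 F ch m \<kappa> A D"
  shows "m \<le> 2048 * d * h"
proof -
  have "{e \<in> F. e \<subseteq> U} = F"
    using inv1_D(1,2)[OF assms] unfolding pairs_def by auto
  then show ?thesis
    using inv1_sparse[OF assms subset_refl] inv1_D(9)[OF assms] card_U by simp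
qed

lemma Bun_op1: "Bun F \<subseteq> op1 F"
proof
  fix e assume "e \<in> Bun F"
  then have e: "e \<in> pairs U" "\<forall>u \<in> e. \<not> sat F u"
    unfolding Bun_def by auto
  then have "e \<noteq> {}"
    unfolding pairs_def by auto
  then show "e \<in> op1 F"
    using e unfolding op1_def by auto
qed

lemma st1_junk:
  assumes "st1 m \<kappa> g A D" "y \<in> pairs U" "y \<notin> fst g"
  shows "st1 m \<kappa> g (insert y A) D" "st1 m \<kappa> g A (insert y D)"
proof -
  obtain F ch where F: "inv1 F ch m \<kappa> A D" "g = (op1 F, False)"
    "card {u \<in> W. sat F u} < 16 * h" "card {u \<in> B. sat F u} < 16 * h"
    using assms(1) unfolding st1_def by auto
  have y: "y \<notin> op1 F" "y \<notin> Bun F"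
    using assms(3) F(2) Bun_op1 by auto
  note I = inv1_D[OF F(1)]
  have "inv1 F ch m \<kappa> (insert y A) D"
    by (rule inv1_I) (use I y assms(2) in auto)
  then show "st1 m \<kappa> g (insert y A) D"
    unfolding st1_def using F by auto
  have "e \<subseteq> B" if "e \<in> insert y D" "e \<in> op1 F" for e
    using I(7)[of e] that y(1) by auto
  moreover have "insert y D \<inter> Bun F = D \<inter> Bun F"
    using y(2) by auto
  ultimately have "inv1 F ch m \<kappa> A (insert y D)"
    using I assms(2) by (intro inv1_I) simp_all
  then show "st1 m \<kappa> g A (insert y D)"
    unfolding st1_def using F by auto
qed

text \<open>More than 16 * h vertices of \<open>B\<close> are unsaturated, so \<open>Bun\<close> has
  at least h * h pairs. At most m + \<kappa> of them are claimed, and this is less than h * h by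
  \<open>big\<close>.\<close>

lemma st1_kill:
  assumes "st1 m \<kappa> g A D" "\<kappa> \<le> K0"
  shows "\<exists>y \<in> pairs U - (A \<union> D). y \<in> fst g \<and> st1 m (Suc \<kappa>) g A (insert y D)"
proof -
  obtain F ch where F: "inv1 F ch m \<kappa> A D" "g = (op1 F, False)"
    "card {u \<in> W. sat F u} < 16 * h" "card {u \<in> B. sat F u} < 16 * h"
    using assms(1) unfolding st1_def by auto
  note I = inv1_D[OF F(1)]
  let ?S = "B - {u \<in> B. sat F u}"
  have "card B - card {u \<in> B. sat F u} \<le> card ?S"
    using finWB by (intro diff_card_le_card_Diff) auto
  then have S: "16 * h \<le> card ?S"
    using F(4) UWB(5) by linarith
  have BunS: "Bun F = {e. e \<subseteq> ?S \<and> card e = 2}"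
    unfolding Bun_def pairs_def using UWB(1) by auto
  have "card (Bun F) = card ?S choose 2"
    unfolding BunS using finWB by (intro n_subsets) auto
  moreover have "h * h \<le> card ?S choose 2"
  proof -
    have "(16 * h) * (16 * h - 1) div 2 \<le> card ?S * (card ?S - 1) div 2"
      using S by (intro div_le_mono mult_le_mono) auto
    moreover have "(16 * h) * h div 2 \<le> (16 * h) * (16 * h - 1) div 2"
      using par(5) by (intro div_le_mono mult_le_mono2) linarith
    moreover have "(16 * h) * h div 2 = 8 * (h * h)"
      by simp
    ultimately show ?thesis
      unfolding choose_two by linarith
  qed
  ultimately have "h * h \<le> card (Bun F)"
    by simp
  moreover have "card (Bun F \<inter> (A \<union> D)) \<le> m + \<kappa>"
  proof -
    have "Bun F \<inter> (A \<union> D) \<subseteq> F \<union> (D \<inter> Bun F)"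
      using I(6) Bun_op1 by auto
    then have "card (Bun F \<inter> (A \<union> D)) \<le> card (F \<union> (D \<inter> Bun F))"
      using finite_sub I(1-3) finite_subset by (intro card_mono) auto
    also have "\<dots> \<le> card F + card (D \<inter> Bun F)"
      by (rule card_Un_le)
    finally show ?thesis
      using I(8,9) by linarith
  qed
  moreover have "m + \<kappa> < h * h"
    using inv1_m[OF F(1)] assms(2) big' by linarith
  ultimately have "Bun F \<inter> (A \<union> D) \<noteq> Bun F"
    by auto
  then obtain y where y: "y \<in> Bun F" "y \<notin> A \<union> D"
    by auto
  have yU: "y \<in> pairs U" "y \<subseteq> B"
    using y(1) unfolding Bun_def by auto
  have "card (insert y D \<inter> Bun F) \<le> Suc \<kappa>"
  proof -
    have "insert y D \<inter> Bun F = insert y (D \<inter> Bun F)"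
      using y by auto
    then show ?thesis
      using card_insert_le_m1[of "Suc \<kappa>" "D \<inter> Bun F" y] I(8) by simp
  qed
  moreover have "e \<subseteq> B" if "e \<in> insert y D" "e \<in> op1 F" for e
    using I(7)[of e] that yU(2) by auto
  ultimately have "inv1 F ch m (Suc \<kappa>) A (insert y D)"
    using I yU(1) by (intro inv1_I) simp_all
  then have "st1 m (Suc \<kappa>) g A (insert y D)"
    unfolding st1_def using F by auto
  moreover have "y \<in> fst g"
    using y(1) Bun_op1 F(2) by auto
  ultimately show ?thesis
    using y(2) yU by auto
qed

text \<open>The 16 * h saturated vertices force 256 * d * h edges in F. Removing h unsaturated
  vertices W' costs at most 32 * d * h of them. The core Z of the rest satisfies 160 * d * h \<le>
  31 * d * |Z|, because F has at most 32 * d * |Z| edges inside Z; so |Z| \<ge> 3 * h, and Sp with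
  3/8 of Z has at least h elements. An edge of Enforcer at W' would be open and hence inside
  \<open>B\<close>, which misses W'.\<close>

lemma core_exists:
  assumes I: "inv1 F ch m \<kappa> A D" and S: "S \<subseteq> U" "16 * h \<le> card S" "\<And>u. u \<in> S \<Longrightarrow> sat F u"
    and W: "card {u \<in> W. sat F u} \<le> 16 * h + 2"
  shows "\<exists>Z W' Sp. base2 Z W' Sp A \<and> (\<forall>e \<in> D. e \<inter> W' = {})"
proof -
  note J = inv1_D[OF I]
  have finF: "finite F"
    using finite_sub J(1,2) finite_subset by blast
  have "card W - card {u \<in> W. sat F u} \<le> card (W - {u \<in> W. sat F u})"
    using finWB by (intro diff_card_le_card_Diff) auto
  then have "h \<le> card (W - {u \<in> W. sat F u})"
    using W UWB(4) par(5) by linarith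
  then obtain W' where W': "W' \<subseteq> W - {u \<in> W. sat F u}" "card W' = h"
    by (meson obtain_subset_with_card_n)
  have W'U: "W' \<subseteq> U" "finite W'"
    using W'(1) UWB(1) finWB finite_subset by auto
  have unsat: "deg F v < 32 * d" if "v \<in> W'" for v
    using W'(1) that by auto
  let ?Y = "U - W'"
  have many: "256 * d * h \<le> card F"
  proof -
    have "(\<Sum>u\<in>S. 32 * d) \<le> (\<Sum>u\<in>S. deg F u)"
      using S(3) by (intro sum_mono) auto
    also have "\<dots> \<le> (\<Sum>u\<in>U. deg F u)"
      using S(1) UWB(3) by (intro sum_mono2) auto
    also have "\<dots> = 2 * card F"
      using finF UWB(3) J(1,2) by (intro sum_deg) auto
    finally have "card S * (32 * d) \<le> 2 * card F"
      by simp
    moreover have "16 * h * (32 * d) \<le> card S * (32 * d)"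
      using S(2) by (rule mult_le_mono1)
    ultimately have "16 * h * (32 * d) \<le> 2 * card F"
      by (rule order_trans[rotated])
    then show ?thesis
      by (simp add: mult.commute mult.left_commute)
  qed
  have "card F \<le> card {e \<in> F. e \<subseteq> ?Y} + 32 * d * h"
  proof -
    have "F \<subseteq> {e \<in> F. e \<subseteq> ?Y} \<union> (\<Union>v\<in>W'. {e \<in> F. v \<in> e})"
      using J(1,2) unfolding pairs_def by auto
    then have "card F \<le> card ({e \<in> F. e \<subseteq> ?Y} \<union> (\<Union>v\<in>W'. {e \<in> F. v \<in> e}))"
      using finF W'U by (intro card_mono) auto
    also have "\<dots> \<le> card {e \<in> F. e \<subseteq> ?Y} + card (\<Union>v\<in>W'. {e \<in> F. v \<in> e})"
      by (rule card_Un_le)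
    also have "card (\<Union>v\<in>W'. {e \<in> F. v \<in> e}) \<le> (\<Sum>v\<in>W'. deg F v)"
      unfolding deg_def by (rule card_UN_le[OF W'U(2)])
    also have "(\<Sum>v\<in>W'. deg F v) \<le> (\<Sum>v\<in>W'. 32 * d)"
      using unsat by (intro sum_mono) (simp add: less_imp_le)
    finally show ?thesis
      using W'(2) by (simp add: algebra_simps)
  qed
  then have Y: "224 * d * h \<le> card {e \<in> F. e \<subseteq> ?Y}"
    using many by linarith
  obtain Z where Z: "Z \<subseteq> ?Y" "\<forall>z \<in> Z. d \<le> card {e \<in> F. e \<subseteq> Z \<and> z \<in> e}"
    "card {e \<in> F. e \<subseteq> ?Y} + d * card Z \<le> card {e \<in> F. e \<subseteq> Z} + d * card ?Y"
    using dense_core[OF finF, of ?Y d] UWB(3) by auto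
  have finZ: "finite Z" "Z \<subseteq> U"
    using Z(1) UWB(3) finite_subset by auto
  have "card ?Y \<le> 64 * h"
    using card_U card_mono[OF UWB(3), of ?Y] by auto
  then have c1: "d * card ?Y \<le> 64 * (d * h)"
    using mult_le_mono2[of "card ?Y" "64 * h" d] by (simp only: mult.left_commute)
  have c2: "card {e \<in> F. e \<subseteq> Z} \<le> 32 * (d * card Z)"
    using inv1_sparse[OF I finZ(2)] by (simp only: mult.assoc)
  have c3: "224 * (d * h) \<le> card {e \<in> F. e \<subseteq> ?Y}"
    using Y by (simp only: mult.assoc)
  have "160 * (d * h) \<le> 31 * (d * card Z)"
    using c1 c2 c3 Z(3) by linarith
  then have "3 * (d * h) \<le> d * card Z"
    by linarith
  then have "d * (3 * h) \<le> d * card Z"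
    by (simp only: mult.left_commute)
  then have cardZ: "3 * h \<le> card Z"
    using par by simp
  have nb: "d \<le> card (nbrs F Z z)" if "z \<in> Z" for z
  proof -
    have "d \<le> card {e \<in> F. e \<subseteq> Z \<and> z \<in> e}"
      using Z(2) that by simp
    also have "\<dots> \<le> card (nbrs F Z z)"
      using J(1,2) finZ(1) unfolding pairs_def by (intro degree_le_nbrs) auto
    finally show ?thesis .
  qed
  have "\<exists>P. P \<subseteq> Z \<and> card P = 3 \<and> (\<forall>y \<in> P. partner F Z (l - 3) z y)" if "z \<in> Z" for z
  proof -
    have "l - 3 + 4 \<le> d"
      using par by linarith
    from three_partners[OF that finZ(1) nb this] show ?thesis
      by blast
  qed
  then obtain P where P: "\<And>z. z \<in> Z \<Longrightarrow> P z \<subseteq> Z \<and> card (P z) = 3 \<and> (\<forall>y \<in> P z. partner F Z (l - 3) z y)"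
    by metis
  obtain Sp where Sp: "Sp \<subseteq> Z" "3 * card Z \<le> 8 * card Sp" "\<forall>z \<in> Z. \<exists>y \<in> P z. y \<notin> Sp"
    using avoid_partners[OF finZ(1), of P] P by auto
  have pm: "partner A Z (l - 3) z y" if "partner F Z (l - 3) z y" for z y
    using that gpath_mono[OF _ J(1)] unfolding partner_def by auto
  have "base2 Z W' Sp A"
    unfolding base2_def
  proof (intro conjI ballI)
    fix z assume z: "z \<in> Z"
    show "k \<le> card (nbrs A Z z)"
      using nb[OF z] card_nbrs_mono[OF J(1) finZ(1), of z] par(3) by linarith
    obtain y where "y \<in> P z" "y \<notin> Sp"
      using Sp(3) z by auto
    then show "\<exists>y\<in>Z - Sp. partner A Z (l - 3) z y"
      using P[OF z] pm by (intro bexI[of _ y]) auto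
  qed (use finZ W'U W'(2) Z(1) Sp cardZ in auto)
  moreover have "e \<inter> W' = {}" if e: "e \<in> D" for e
  proof (rule ccontr)
    assume "e \<inter> W' \<noteq> {}"
    then obtain v where v: "v \<in> e" "v \<in> W'"
      by auto
    have "e \<in> op1 F"
      unfolding op1_def using e J(3) v unsat[OF v(2)] by (auto intro!: bexI[of _ v])
    then have "v \<in> B"
      using J(7)[OF e] v(1) by auto
    then show False
      using v(2) W'(1) UWB(2) by auto
  qed
  ultimately show ?thesis
    by blast
qed

section \<open>Second phase: closing pairs\<close>

text \<open>The cycle runs from v to z, along the path of l - 1 vertices to the partner y, and back
  through the new pair. Adding v to Z preserves the minimum degree because v has \<open>k\<close>
  neighbours there.\<close>

lemma Good_close:
  assumes b: "base2 Z W' Sp A" and v: "v \<in> W'" "sat2 Z A v"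
    and zy: "z \<in> nbrs A Z v" "partner A Z (l - 3) z y"
  shows "Good (insert {y, v} A)"
proof -
  obtain xs where xs: "gpath A xs" "set xs \<subseteq> Z" "hd xs = z" "last xs = y" "length xs = Suc (Suc (l - 3))"
    using zy(2) unfolding partner_def by auto
  have ne: "xs \<noteq> []"
    using xs(5) by auto
  let ?A = "insert {y, v} A"
  have finZ: "finite Z" "Z \<subseteq> U" "v \<in> U" "v \<notin> Z"
    using b v(1) UWB(3) finite_subset unfolding base2_def by auto
  have "gpath ?A (v # xs)"
    using xs ne zy(1) finZ(4) gpath_mono[OF xs(1), of ?A]
    unfolding gpath_def nbrs_def by (auto simp: successively_Cons insert_commute)
  moreover have "length (v # xs) = l"
    using xs(5) par(1) by simp
  moreover have "k \<le> card (nbrs ?A (insert v Z) u)" if u: "u \<in> insert v Z" for u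
  proof -
    have "nbrs A Z u \<subseteq> nbrs ?A (insert v Z) u"
      unfolding nbrs_def by auto
    then have "card (nbrs A Z u) \<le> card (nbrs ?A (insert v Z) u)"
      using finZ(1) by (intro card_mono) (auto simp: nbrs_def)
    moreover have "k \<le> card (nbrs A Z u)"
      using u v(2) b unfolding base2_def by auto
    ultimately show ?thesis
      by linarith
  qed
  ultimately show ?thesis
    unfolding rich_cycle_def using xs ne finZ
    by (intro exI[of _ "insert v Z"] exI[of _ "v # xs"]) auto
qed

lemma sat2_pair:
  assumes b: "base2 Z W' Sp A" and v: "v \<in> W'" "sat2 Z A v"
  shows "\<exists>y \<in> Z - Sp. Good (insert {y, v} A)"
proof -
  have "nbrs A Z v \<noteq> {}"
    using v(2) par(2) by auto
  then obtain z where z: "z \<in> nbrs A Z v"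
    by auto
  then have "z \<in> Z"
    unfolding nbrs_def by auto
  then obtain y where "y \<in> Z - Sp" "partner A Z (l - 3) z y"
    using b unfolding base2_def by auto
  then show ?thesis
    using Good_close[OF b v z] by auto
qed

lemma base2_mono:
  assumes "base2 Z W' Sp A" "A \<subseteq> A'"
  shows "base2 Z W' Sp A'"
proof -
  have finZ: "finite Z"
    using assms(1) UWB(3) finite_subset unfolding base2_def by auto
  have "k \<le> card (nbrs A' Z z)" if "k \<le> card (nbrs A Z z)" for z
    using that card_nbrs_mono[OF assms(2) finZ, of z] by linarith
  moreover have "partner A' Z (l - 3) z y" if "partner A Z (l - 3) z y" for z y
    using that gpath_mono[OF _ assms(2)] unfolding partner_def by auto
  ultimately show ?thesis
    using assms(1) unfolding base2_def by (elim conjE, intro conjI ballI) blast+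
qed

lemma inv2_D:
  assumes "inv2 Z W' Sp Q m \<kappa> A D"
  shows "A \<subseteq> pairs U" "D \<subseteq> pairs U" "base2 Z W' Sp A"
    "\<And>v z. v \<in> W' \<Longrightarrow> \<not> sat2 Z A v \<Longrightarrow> z \<in> Z - Sp \<Longrightarrow> {z, v} \<notin> D"
    "card (D \<inter> zw Sp {v \<in> W'. \<not> sat2 Z A v}) \<le> \<kappa>"
    "\<And>v. v \<in> W' \<Longrightarrow> sat2 Z A v \<Longrightarrow> \<exists>z \<in> Z. {z, v} \<in> Q \<and> {z, v} \<notin> A \<union> D"
    "Q \<subseteq> zw Z {v \<in> W'. sat2 Z A v}" "\<And>p. p \<in> Q \<Longrightarrow> Good (insert p A)"
    "m \<le> 2048 * d * h + (\<Sum>v\<in>W'. min k (card (nbrs A Z v)))"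
  using assms unfolding inv2_def by simp_all

lemma inv2_I:
  assumes "A \<subseteq> pairs U" "D \<subseteq> pairs U" "base2 Z W' Sp A"
    "\<And>v z. v \<in> W' \<Longrightarrow> \<not> sat2 Z A v \<Longrightarrow> z \<in> Z - Sp \<Longrightarrow> {z, v} \<notin> D"
    "card (D \<inter> zw Sp {v \<in> W'. \<not> sat2 Z A v}) \<le> \<kappa>"
    "\<And>v. v \<in> W' \<Longrightarrow> sat2 Z A v \<Longrightarrow> \<exists>z \<in> Z. {z, v} \<in> Q \<and> {z, v} \<notin> A \<union> D"
    "Q \<subseteq> zw Z {v \<in> W'. sat2 Z A v}" "\<And>p. p \<in> Q \<Longrightarrow> Good (insert p A)"
    "m \<le> 2048 * d * h + (\<Sum>v\<in>W'. min k (card (nbrs A Z v)))"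
  shows "inv2 Z W' Sp Q m \<kappa> A D"
  unfolding inv2_def by (intro conjI ballI impI; (rule assms; assumption))

lemma base2_D:
  assumes "base2 Z W' Sp A"
  shows "Z \<subseteq> U" "W' \<subseteq> U" "Z \<inter> W' = {}" "card W' = h" "Sp \<subseteq> Z" "h \<le> card Sp"
    "finite Z" "finite W'" "finite Sp"
proof -
  show *: "Z \<subseteq> U" "W' \<subseteq> U" "Z \<inter> W' = {}" "card W' = h" "Sp \<subseteq> Z" "h \<le> card Sp"
    using assms unfolding base2_def by simp_all
  show "finite Z" "finite W'" "finite Sp"
    using finite_subset[OF *(1) UWB(3)] finite_subset[OF *(2) UWB(3)]
      finite_subset[OF order_trans[OF *(5,1)] UWB(3)] by simp_all
qed

lemma zw_inj:
  assumes "Z \<inter> W' = {}" "z \<in> Z" "z' \<in> Z" "v \<in> W'" "v' \<in> W'" "{z, v} = {z', v'}"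
  shows "z = z'" "v = v'"
  using assms by (auto simp: doubleton_eq_iff)

lemma zw_mono: "Z \<subseteq> Z' \<Longrightarrow> W1 \<subseteq> W2 \<Longrightarrow> zw Z W1 \<subseteq> zw Z' W2"
  unfolding zw_def by auto

lemma nbrs_insert_other:
  assumes "\<And>z. z \<in> Z \<Longrightarrow> y \<noteq> {z, v}"
  shows "nbrs (insert y A) Z v = nbrs A Z v"
  using assms unfolding nbrs_def by (metis insert_commute insert_iff)

lemma sum_min_le:
  assumes "base2 Z W' Sp A"
  shows "(\<Sum>v\<in>W'. min k (card (nbrs A Z v))) \<le> k * h"
proof -
  have "(\<Sum>v\<in>W'. min k (card (nbrs A Z v))) \<le> (\<Sum>v\<in>W'. k)"
    by (intro sum_mono) simp
  then show ?thesis
    using base2_D(4)[OF assms] by (simp add: mult.commute)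
qed

lemma st2_junk:
  assumes "st2 m \<kappa> g A D" "y \<in> pairs U" "y \<notin> A \<union> D" "y \<notin> fst g"
  shows "st2 m \<kappa> g (insert y A) D" "st2 m \<kappa> g A (insert y D)"
proof -
  obtain Z W' Sp Q where inv: "inv2 Z W' Sp Q m \<kappa> A D" and
    g: "g = (zw Z {v \<in> W'. \<not> sat2 Z A v} \<union> Q, h \<le> 2 * card {v \<in> W'. sat2 Z A v})"
    using assms(1) unfolding st2_def by auto
  note I = inv2_D[OF inv]
  note b = base2_D[OF I(3)]
  have yQ: "y \<notin> Q"
    using assms(4) g by simp
  have ny: "y \<noteq> {z, v}" if "z \<in> Z" "v \<in> W'" "\<not> sat2 Z A v" for z v
    using assms(4) g that unfolding zw_def by auto
  let ?A = "insert y A"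
  have same: "sat2 Z ?A v \<longleftrightarrow> sat2 Z A v" if v: "v \<in> W'" for v
  proof (cases "sat2 Z A v")
    case True
    then show ?thesis
      using card_nbrs_mono[OF subset_insertI[of A y] b(7), of v] by auto
  next
    case False
    then show ?thesis
      using nbrs_insert_other[of Z y v A] ny[OF _ v False] by simp
  qed
  have us: "{v \<in> W'. \<not> sat2 Z ?A v} = {v \<in> W'. \<not> sat2 Z A v}"
    "{v \<in> W'. sat2 Z ?A v} = {v \<in> W'. sat2 Z A v}"
    using same by auto
  have "(\<Sum>v\<in>W'. min k (card (nbrs A Z v))) \<le> (\<Sum>v\<in>W'. min k (card (nbrs ?A Z v)))"
  proof (rule sum_mono)
    fix v assume "v \<in> W'"
    show "min k (card (nbrs A Z v)) \<le> min k (card (nbrs ?A Z v))"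
      using card_nbrs_mono[OF subset_insertI[of A y] b(7), of v] by auto
  qed
  then have m: "m \<le> 2048 * d * h + (\<Sum>v\<in>W'. min k (card (nbrs ?A Z v)))"
    using I(9) by linarith
  have "inv2 Z W' Sp Q m \<kappa> ?A D"
  proof (rule inv2_I)
    show "base2 Z W' Sp ?A"
      by (rule base2_mono[OF I(3)]) auto
    show "\<exists>z \<in> Z. {z, v} \<in> Q \<and> {z, v} \<notin> ?A \<union> D" if v: "v \<in> W'" "sat2 Z ?A v" for v
    proof -
      obtain z where z: "z \<in> Z" "{z, v} \<in> Q" "{z, v} \<notin> A \<union> D"
        using I(6)[OF v(1)] same[OF v(1)] v(2) by auto
      then have "{z, v} \<noteq> y"
        using yQ by auto
      then show ?thesis
        using z by auto
    qed
    show "Good (insert p ?A)" if "p \<in> Q" for p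
      by (rule Good_mono[OF I(8)[OF that]]) auto
  qed (use I assms(2) same us m in auto)
  then show "st2 m \<kappa> g ?A D"
    unfolding st2_def g by (intro exI[of _ Z] exI[of _ W'] exI[of _ Sp] exI[of _ Q]) (simp add: us)
  have "inv2 Z W' Sp Q m \<kappa> A (insert y D)"
  proof (rule inv2_I)
    show "{z, v} \<notin> insert y D" if "v \<in> W'" "\<not> sat2 Z A v" "z \<in> Z - Sp" for v z
      using I(4)[OF that] ny[of z v] that by auto
    have "y \<notin> zw Sp {v \<in> W'. \<not> sat2 Z A v}"
      using ny b(5) unfolding zw_def by auto
    then have "insert y D \<inter> zw Sp {v \<in> W'. \<not> sat2 Z A v} = D \<inter> zw Sp {v \<in> W'. \<not> sat2 Z A v}"
      by auto
    then show "card (insert y D \<inter> zw Sp {v \<in> W'. \<not> sat2 Z A v}) \<le> \<kappa>"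
      using I(5) by simp
    show "\<exists>z \<in> Z. {z, v} \<in> Q \<and> {z, v} \<notin> A \<union> insert y D" if v: "v \<in> W'" "sat2 Z A v" for v
    proof -
      obtain z where z: "z \<in> Z" "{z, v} \<in> Q" "{z, v} \<notin> A \<union> D"
        using I(6)[OF v] by auto
      then have "{z, v} \<noteq> y"
        using yQ by auto
      then show ?thesis
        using z by auto
    qed
  qed (use I assms(2) in auto)
  then show "st2 m \<kappa> g A (insert y D)"
    unfolding st2_def g by (intro exI[of _ Z] exI[of _ W'] exI[of _ Sp] exI[of _ Q]) simp
qed

text \<open>At least h / 2 vertices of W' lack \<open>k\<close> neighbours in Z, so together with Sp
  they form at least h * h / 2 pairs. Avoider owns fewer than \<open>k\<close> at each such vertex,
  and at most \<kappa> have been killed.\<close>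

lemma st2_kill:
  assumes "st2 m \<kappa> g A D" "\<not> snd g" "\<kappa> \<le> K0"
  shows "\<exists>y \<in> pairs U - (A \<union> D). y \<in> fst g \<and> st2 m (Suc \<kappa>) g A (insert y D)"
proof -
  obtain Z W' Sp Q where inv: "inv2 Z W' Sp Q m \<kappa> A D" and
    g: "g = (zw Z {v \<in> W'. \<not> sat2 Z A v} \<union> Q, h \<le> 2 * card {v \<in> W'. sat2 Z A v})"
    using assms(1) unfolding st2_def by auto
  note I = inv2_D[OF inv]
  note b = base2_D[OF I(3)]
  define N where "N = {v \<in> W'. \<not> sat2 Z A v}"
  have N: "finite N" "N \<subseteq> W'"
    using b(8) unfolding N_def by auto
  have "W' = N \<union> {v \<in> W'. sat2 Z A v}"
    unfolding N_def by auto
  then have "card W' \<le> card N + card {v \<in> W'. sat2 Z A v}"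
    using card_Un_le[of N "{v \<in> W'. sat2 Z A v}"] by simp
  then have cN: "h \<le> 2 * card N" "card N \<le> h"
    using assms(2) g b(4) card_mono[OF b(8) N(2)] by simp_all
  have inj: "inj_on (\<lambda>(z, v). {z, v}) (Sp \<times> N)"
  proof (rule inj_onI, clarify)
    fix z v z' v' assume "z \<in> Sp" "v \<in> N" "z' \<in> Sp" "v' \<in> N" "{z, v} = {z', v'}"
    then show "z = z' \<and> v = v'"
      using zw_inj[OF b(3), of z z' v v'] b(5) N(2) by auto
  qed
  have zwS: "zw Sp N = (\<lambda>(z, v). {z, v}) ` (Sp \<times> N)"
    unfolding zw_def by auto
  have "card (zw Sp N) = card Sp * card N"
    unfolding zwS using card_image[OF inj] by (simp add: card_cartesian_product)
  moreover have "h * card N \<le> card Sp * card N"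
    using b(6) by (rule mult_le_mono1)
  ultimately have c1: "h * h \<le> 2 * card (zw Sp N)"
    using mult_le_mono2[OF cN(1), of h] by (simp only: mult.left_commute)
  have c2: "card (zw Sp N \<inter> A) \<le> k * h"
  proof -
    have "zw Sp N \<inter> A \<subseteq> (\<Union>v\<in>N. (\<lambda>z. {v, z}) ` nbrs A Z v)"
    proof
      fix p assume "p \<in> zw Sp N \<inter> A"
      then obtain z v where p: "p = {z, v}" "z \<in> Sp" "v \<in> N" "{z, v} \<in> A"
        unfolding zw_def by auto
      then have "p = {v, z}" "z \<in> nbrs A Z v"
        using b(5) unfolding nbrs_def by (auto simp: insert_commute)
      then show "p \<in> (\<Union>v\<in>N. (\<lambda>z. {v, z}) ` nbrs A Z v)"
        using p(3) by blast
    qed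
    moreover have fn: "finite (nbrs A Z v)" for v
      using b(7) unfolding nbrs_def by simp
    ultimately have "card (zw Sp N \<inter> A) \<le> card (\<Union>v\<in>N. (\<lambda>z. {v, z}) ` nbrs A Z v)"
      using N(1) by (intro card_mono) auto
    also have "\<dots> \<le> (\<Sum>v\<in>N. card ((\<lambda>z. {v, z}) ` nbrs A Z v))"
      by (rule card_UN_le[OF N(1)])
    also have "\<dots> \<le> (\<Sum>v\<in>N. k)"
    proof (rule sum_mono)
      fix v assume "v \<in> N"
      then have "card (nbrs A Z v) \<le> k"
        unfolding N_def by simp
      then show "card ((\<lambda>z. {v, z}) ` nbrs A Z v) \<le> k"
        using card_image_le[OF fn, of "\<lambda>z. {v, z}" v] by linarith
    qed
    also have "\<dots> \<le> k * h"
      using cN(2) by (simp add: mult.commute)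
    finally show ?thesis .
  qed
  have c3: "card (zw Sp N \<inter> D) \<le> K0"
    using I(5) assms(3) unfolding N_def by (simp add: Int_commute)
  have "2 * (K0 + k * h) < h * h"
    by (rule le_less_trans[OF _ big]) simp
  then have "card (zw Sp N \<inter> A) + card (zw Sp N \<inter> D) < card (zw Sp N)"
    using c1 c2 c3 unfolding distrib_left by linarith
  moreover have "card (zw Sp N \<inter> (A \<union> D)) \<le> card (zw Sp N \<inter> A) + card (zw Sp N \<inter> D)"
    unfolding Int_Un_distrib by (rule card_Un_le)
  ultimately have "zw Sp N \<inter> (A \<union> D) \<noteq> zw Sp N"
    by auto
  then obtain y where y: "y \<in> zw Sp N" "y \<notin> A \<union> D"
    by auto
  then obtain z v where zv: "y = {z, v}" "z \<in> Sp" "v \<in> W'" "\<not> sat2 Z A v"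
    unfolding zw_def N_def by auto
  have zZ: "z \<in> Z" "z \<in> U" "v \<in> U" "z \<noteq> v"
    using zv b by auto
  then have yU: "y \<in> pairs U"
    unfolding pairs_def zv(1) by auto
  have "inv2 Z W' Sp Q m (Suc \<kappa>) A (insert y D)"
  proof (rule inv2_I)
    show "{z', v'} \<notin> insert y D" if "v' \<in> W'" "\<not> sat2 Z A v'" "z' \<in> Z - Sp" for v' z'
    proof -
      have "{z', v'} \<noteq> y"
        using zw_inj(1)[OF b(3), of z' z v' v] that zv zZ by auto
      then show ?thesis
        using I(4)[OF that] by auto
    qed
    have "insert y D \<inter> zw Sp N = insert y (D \<inter> zw Sp N)"
      using y(1) by auto
    then show "card (insert y D \<inter> zw Sp {v \<in> W'. \<not> sat2 Z A v}) \<le> Suc \<kappa>"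
      using card_insert_le_m1[of "Suc \<kappa>" "D \<inter> zw Sp N" y] I(5) unfolding N_def by simp
    show "\<exists>z' \<in> Z. {z', v'} \<in> Q \<and> {z', v'} \<notin> A \<union> insert y D" if v': "v' \<in> W'" "sat2 Z A v'" for v'
    proof -
      obtain z' where z': "z' \<in> Z" "{z', v'} \<in> Q" "{z', v'} \<notin> A \<union> D"
        using I(6)[OF v'] by auto
      have "{z', v'} \<noteq> y"
        using zw_inj(2)[OF b(3), of z' z v' v] z'(1) v' zv zZ by auto
      then show ?thesis
        using z' by auto
    qed
  qed (use I yU in auto)
  then have "st2 m (Suc \<kappa>) g A (insert y D)"
    unfolding st2_def g by (intro exI[of _ Z] exI[of _ W'] exI[of _ Sp] exI[of _ Q]) simp
  moreover have "y \<in> fst g"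
    unfolding g zw_def using zv zZ(1) by auto
  ultimately show ?thesis
    using y(2) yU by auto
qed

text \<open>Enforcer has nothing at W' yet, so the killed pairs of the second phase number zero,
  whatever \<kappa> has been inherited. The closing pairs are not Avoider's either, for otherwise A
  would already contain a rich cycle.\<close>

lemma reach2:
  assumes b2: "base2 Z W' Sp A" and AD: "A \<subseteq> pairs U" "D \<subseteq> pairs U"
    and D: "\<forall>e \<in> D. e \<inter> W' = {}" and m: "m \<le> 2048 * d * h"
  shows "\<exists>g. R m \<kappa> g A D"
proof (cases "Good A")
  case True
  then have "st3 m \<kappa> ({}, True) A D"
    unfolding st3_def using AD m by simp
  then show ?thesis
    unfolding R_def by blast
next
  case False
  have "\<exists>f. \<forall>v \<in> {v \<in> W'. sat2 Z A v}. f v \<in> Z - Sp \<and> Good (insert {f v, v} A)"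
    using sat2_pair[OF b2] by (intro bchoice) auto
  then obtain f where f: "\<And>v. v \<in> W' \<Longrightarrow> sat2 Z A v \<Longrightarrow> f v \<in> Z - Sp \<and> Good (insert {f v, v} A)"
    by auto
  define Q where "Q = (\<lambda>v. {f v, v}) ` {v \<in> W'. sat2 Z A v}"
  have Dz: "{z, v} \<notin> D" if "v \<in> W'" for z v
    using D that by auto
  have "inv2 Z W' Sp Q m \<kappa> A D"
  proof (rule inv2_I)
    have "D \<inter> zw Sp {v \<in> W'. \<not> sat2 Z A v} = {}"
      using Dz unfolding zw_def by auto
    then show "card (D \<inter> zw Sp {v \<in> W'. \<not> sat2 Z A v}) \<le> \<kappa>"
      by simp
    show "\<exists>z \<in> Z. {z, v} \<in> Q \<and> {z, v} \<notin> A \<union> D" if v: "v \<in> W'" "sat2 Z A v" for v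
    proof -
      have "{f v, v} \<notin> A"
        using f[OF v] False insert_absorb[of "{f v, v}" A] by metis
      then show ?thesis
        using f[OF v] Dz[OF v(1)] v unfolding Q_def by (intro bexI[of _ "f v"]) auto
    qed
    show "Q \<subseteq> zw Z {v \<in> W'. sat2 Z A v}"
      unfolding Q_def zw_def using f by auto
    show "Good (insert p A)" if "p \<in> Q" for p
      using that f unfolding Q_def by auto
  qed (use AD b2 Dz m in auto)
  then show ?thesis
    unfolding R_def st2_def by blast
qed

text \<open>A pair of \<open>Q\<close> completes a rich cycle at once. Any other open pair raises
  the degree of some unsaturated v of W' by one; if v thereby becomes saturated, a closing pair at v
  joins \<open>Q\<close>.\<close>

lemma st2_open:
  assumes "st2 m \<kappa> g A D" "y \<in> pairs U" "y \<notin> A \<union> D" "y \<in> fst g"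
  shows "\<exists>g'. R (Suc m) \<kappa> g' (insert y A) D"
proof -
  obtain Z W' Sp Q where inv: "inv2 Z W' Sp Q m \<kappa> A D" and
    g: "g = (zw Z {v \<in> W'. \<not> sat2 Z A v} \<union> Q, h \<le> 2 * card {v \<in> W'. sat2 Z A v})"
    using assms(1) unfolding st2_def by auto
  note I = inv2_D[OF inv]
  note b = base2_D[OF I(3)]
  let ?A = "insert y A"
  have A': "?A \<subseteq> pairs U"
    using I(1) assms(2) by auto
  have b': "base2 Z W' Sp ?A"
    by (rule base2_mono[OF I(3)]) auto
  show ?thesis
  proof (cases "Good ?A")
    case True
    have "Suc m \<le> 2048 * d * h + k * h + 1"
      using I(9) sum_min_le[OF I(3)] by linarith
    then have "st3 (Suc m) \<kappa> ({}, True) ?A D"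
      unfolding st3_def using True A' I(2) by simp
    then show ?thesis
      unfolding R_def by blast
  next
    case notGood: False
    then have "y \<notin> Q"
      using I(8) by auto
    then obtain z v where zv: "y = {z, v}" "z \<in> Z" "v \<in> W'" "\<not> sat2 Z A v"
      using assms(4) g unfolding zw_def by auto
    have other: "nbrs ?A Z v' = nbrs A Z v'" if "v' \<in> W'" "v' \<noteq> v" for v'
      by (rule nbrs_insert_other) (use zw_inj(2)[OF b(3) zv(2) _ zv(3) that(1)] that(2) zv(1) in auto)
    have nv: "nbrs ?A Z v = insert z (nbrs A Z v)"
    proof -
      have "z \<noteq> v"
        using b(3) zv by auto
      then show ?thesis
        using zv(1,2) unfolding nbrs_def by (auto simp: doubleton_eq_iff)
    qed
    have "z \<notin> nbrs A Z v"
      using assms(3) zv(1) unfolding nbrs_def by (auto simp: insert_commute)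
    then have cnv: "card (nbrs ?A Z v) = Suc (card (nbrs A Z v))"
      unfolding nv using b(7) by (simp add: nbrs_def)
    have satm: "sat2 Z ?A v'" if "v' \<in> W'" "sat2 Z A v'" for v'
      using card_nbrs_mono[OF subset_insertI[of A y] b(7), of v'] that(2) by linarith
    have "(\<Sum>v'\<in>W'. min k (card (nbrs ?A Z v'))) =
        min k (card (nbrs ?A Z v)) + (\<Sum>v'\<in>W' - {v}. min k (card (nbrs ?A Z v')))"
      by (rule sum.remove[OF b(8) zv(3)])
    also have "(\<Sum>v'\<in>W' - {v}. min k (card (nbrs ?A Z v'))) =
        (\<Sum>v'\<in>W' - {v}. min k (card (nbrs A Z v')))"
      using other by (intro sum.cong) auto
    also have "min k (card (nbrs ?A Z v)) = Suc (min k (card (nbrs A Z v)))"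
      using cnv zv(4) by simp
    finally have "(\<Sum>v'\<in>W'. min k (card (nbrs ?A Z v'))) = Suc (\<Sum>v'\<in>W'. min k (card (nbrs A Z v')))"
      using sum.remove[OF b(8) zv(3), of "\<lambda>v'. min k (card (nbrs A Z v'))"] by simp
    then have m: "Suc m \<le> 2048 * d * h + (\<Sum>v'\<in>W'. min k (card (nbrs ?A Z v')))"
      using I(9) by simp
    have "zw Z {v \<in> W'. sat2 Z A v} \<subseteq> zw Z {v \<in> W'. sat2 Z ?A v}"
      by (rule zw_mono) (use satm in auto)
    then have Qsub: "Q \<subseteq> zw Z {v \<in> W'. sat2 Z ?A v}"
      using I(7) by (rule order_trans[rotated])
    have QGood: "Good (insert p ?A)" if "p \<in> Q" for p
      by (rule Good_mono[OF I(8)[OF that]]) auto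
    obtain Q' where Q': "Q \<subseteq> Q'" "Q' \<subseteq> zw Z {v \<in> W'. sat2 Z ?A v}" "\<forall>p \<in> Q'. Good (insert p ?A)"
      "sat2 Z ?A v \<longrightarrow> (\<exists>z \<in> Z. {z, v} \<in> Q' \<and> {z, v} \<notin> ?A \<union> D)"
    proof (cases "sat2 Z ?A v")
      case False
      then show ?thesis
        using that[of Q] Qsub QGood by simp
    next
      case True
      obtain x where x: "x \<in> Z - Sp" "Good (insert {x, v} ?A)"
        using sat2_pair[OF b' zv(3) True] by auto
      have "{x, v} \<notin> ?A"
        using x(2) notGood insert_absorb[of "{x, v}" ?A] by metis
      \<comment> \<open>Before this move v was unsaturated, and at such vertices Enforcer has taken
        pairs to Z only at \<open>Sp\<close>, which x avoids.\<close>
      moreover have "{x, v} \<notin> D"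
        by (rule I(4)[OF zv(3,4) x(1)])
      moreover have "{x, v} \<in> zw Z {v \<in> W'. sat2 Z ?A v}"
        using x(1) zv(3) True unfolding zw_def by auto
      ultimately show ?thesis
        using that[of "insert {x, v} Q"] x Qsub QGood by auto
    qed
    have "inv2 Z W' Sp Q' (Suc m) \<kappa> ?A D"
    proof (rule inv2_I)
      show "{z', v'} \<notin> D" if "v' \<in> W'" "\<not> sat2 Z ?A v'" "z' \<in> Z - Sp" for v' z'
        using I(4)[of v' z'] satm that by auto
      have "zw Sp {v \<in> W'. \<not> sat2 Z ?A v} \<subseteq> zw Sp {v \<in> W'. \<not> sat2 Z A v}"
        by (rule zw_mono) (use satm in auto)
      then have "card (D \<inter> zw Sp {v \<in> W'. \<not> sat2 Z ?A v}) \<le> card (D \<inter> zw Sp {v \<in> W'. \<not> sat2 Z A v})"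
        using finite_sub[OF I(2)] by (intro card_mono) auto
      then show "card (D \<inter> zw Sp {v \<in> W'. \<not> sat2 Z ?A v}) \<le> \<kappa>"
        using I(5) by linarith
      show "\<exists>z' \<in> Z. {z', v'} \<in> Q' \<and> {z', v'} \<notin> ?A \<union> D" if v': "v' \<in> W'" "sat2 Z ?A v'" for v'
      proof (cases "v' = v")
        case True
        then show ?thesis
          using Q'(4) v'(2) by simp
      next
        case False
        then have "sat2 Z A v'"
          using other[OF v'(1)] v'(2) by simp
        then obtain z' where z': "z' \<in> Z" "{z', v'} \<in> Q" "{z', v'} \<notin> A \<union> D"
          using I(6)[OF v'(1)] by auto
        have "{z', v'} \<noteq> y"
          using zw_inj(2)[OF b(3), of z' z v' v] z'(1) v'(1) zv False by auto
        then show ?thesis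
          using z' Q'(1) by auto
      qed
      show "Good (insert p ?A)" if "p \<in> Q'" for p
        using Q'(3) that by simp
    qed (use A' I(2) b' Q'(2) m in auto)
    then show ?thesis
      unfolding R_def st2_def by blast
  qed
qed

text \<open>The new edge is charged to an unsaturated end u. All charges at u are edges at u, so
  there are at most 32 * d of them. If half of a side is now saturated, \<open>core_exists\<close>
  opens the second phase.\<close>

lemma st1_open:
  assumes "st1 m \<kappa> g A D" "y \<in> pairs U" "y \<notin> A \<union> D" "y \<in> fst g"
  shows "\<exists>g'. R (Suc m) \<kappa> g' (insert y A) D"
proof -
  obtain F ch where F: "inv1 F ch m \<kappa> A D" "g = (op1 F, False)"
    "card {u \<in> W. sat F u} < 16 * h" "card {u \<in> B. sat F u} < 16 * h"
    using assms(1) unfolding st1_def by auto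
  note I = inv1_D[OF F(1)]
  have finF: "finite F"
    using finite_sub I(1,2) finite_subset by blast
  obtain u where u: "u \<in> y" "\<not> sat F u"
    using assms(4) F(2) unfolding op1_def by auto
  let ?F = "insert y F" and ?ch = "ch(y := u)" and ?A = "insert y A"
  have yF: "y \<notin> F"
    using I(1) assms(3) by auto
  have mono: "sat ?F x" if "sat F x" for x
    by (rule sat_mono[OF _ _ that]) (use finF in auto)
  have op1: "op1 ?F \<subseteq> op1 F"
    using mono unfolding op1_def by auto
  have inv: "inv1 ?F ?ch (Suc m) \<kappa> ?A D"
  proof (rule inv1_I)
    show "?ch e \<in> e" if "e \<in> ?F" for e
      using that I(4) u(1) by auto
    show "card {e \<in> ?F. ?ch e = x} \<le> 32 * d" for x
    proof (cases "x = u")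
      case False
      then have "{e \<in> ?F. ?ch e = x} = {e \<in> F. ch e = x}"
        using yF by auto
      then show ?thesis
        using I(5) by simp
    next
      case True
      have "{e \<in> ?F. ?ch e = x} \<subseteq> insert y {e \<in> F. u \<in> e}"
        using I(4) True by auto
      then have "card {e \<in> ?F. ?ch e = x} \<le> card (insert y {e \<in> F. u \<in> e})"
        using finF by (intro card_mono) auto
      also have "\<dots> \<le> Suc (deg F u)"
        unfolding deg_def by (rule card_insert_le_m1) auto
      finally show ?thesis
        using u(2) by linarith
    qed
    have "Bun ?F \<subseteq> Bun F"
      using mono unfolding Bun_def by auto
    then have "card (D \<inter> Bun ?F) \<le> card (D \<inter> Bun F)"
      using finite_sub[OF I(3)] by (intro card_mono) auto
    then show "card (D \<inter> Bun ?F) \<le> \<kappa>"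
      using I(8) by linarith
    show "e \<subseteq> B" if "e \<in> D" "e \<in> op1 ?F" for e
      using I(7) that op1 by auto
    show "?A \<inter> op1 ?F \<subseteq> ?F"
      using I(6) op1 by auto
    show "Suc m = card ?F"
      using I(9) finF yF by simp
  qed (use I(1-3) assms(2) in auto)
  note J = inv1_D[OF inv]
  have AD: "?A \<subseteq> pairs U" "D \<subseteq> pairs U"
    by (fact J)+
  \<comment> \<open>One edge can saturate both of its ends, hence the slack of two.\<close>
  have cW: "card {x \<in> W. sat ?F x} \<le> 16 * h + 2"
  proof -
    have "{x \<in> W. sat ?F x} \<subseteq> {x \<in> W. sat F x} \<union> y"
    proof
      fix x assume x: "x \<in> {x \<in> W. sat ?F x}"
      show "x \<in> {x \<in> W. sat F x} \<union> y"
      proof (cases "x \<in> y")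
        case False
        then have "{e \<in> ?F. x \<in> e} = {e \<in> F. x \<in> e}"
          by auto
        then show ?thesis
          using x unfolding deg_def by simp
      qed simp
    qed
    moreover have y2: "card y = 2" "finite y"
      using assms(2) unfolding pairs_def by (auto intro: card_ge_0_finite)
    ultimately have "card {x \<in> W. sat ?F x} \<le> card ({x \<in> W. sat F x} \<union> y)"
      using finWB by (intro card_mono) auto
    also have "\<dots> \<le> card {x \<in> W. sat F x} + card y"
      by (rule card_Un_le)
    finally show ?thesis
      using F(3) y2(1) by linarith
  qed
  have trig: "\<exists>g'. R (Suc m) \<kappa> g' ?A D" if S: "S \<subseteq> U" "16 * h \<le> card S" "\<And>x. x \<in> S \<Longrightarrow> sat ?F x" for S
  proof -
    obtain Z W' Sp where Z: "base2 Z W' Sp ?A" "\<forall>e \<in> D. e \<inter> W' = {}"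
      using core_exists[OF inv S cW] by auto
    show ?thesis
      by (rule reach2[OF Z(1) AD Z(2) inv1_m[OF inv]])
  qed
  consider "card {x \<in> W. sat ?F x} < 16 * h" "card {x \<in> B. sat ?F x} < 16 * h"
    | "16 * h \<le> card {x \<in> W. sat ?F x}" | "16 * h \<le> card {x \<in> B. sat ?F x}"
    by linarith
  then show ?thesis
  proof cases
    case 1
    then have "st1 (Suc m) \<kappa> (op1 ?F, False) ?A D"
      unfolding st1_def using inv by (intro exI[of _ ?F] exI[of _ ?ch]) simp
    then show ?thesis
      unfolding R_def by blast
  next
    case 2
    then show ?thesis
      using UWB(1) by (intro trig) auto
  next
    case 3
    then show ?thesis
      using UWB(1) by (intro trig) auto
  qed
qed

section \<open>Both phases combined\<close>

lemma R_sub: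
  assumes "R m \<kappa> g A D"
  shows "A \<subseteq> pairs U" "D \<subseteq> pairs U" "m \<le> 2048 * d * h + k * h + 1"
proof -
  consider "st1 m \<kappa> g A D" | "st2 m \<kappa> g A D" | "st3 m \<kappa> g A D"
    using assms unfolding R_def by auto
  then have "A \<subseteq> pairs U \<and> D \<subseteq> pairs U \<and> m \<le> 2048 * d * h + k * h + 1"
  proof cases
    case 1
    then obtain F ch where F: "inv1 F ch m \<kappa> A D"
      unfolding st1_def by auto
    show ?thesis
      using inv1_m[OF F] inv1_D[OF F] by auto
  next
    case 2
    then obtain Z W' Sp Q where inv: "inv2 Z W' Sp Q m \<kappa> A D"
      unfolding st2_def by auto
    show ?thesis
      using inv2_D(1,2,9)[OF inv] sum_min_le[OF inv2_D(3)[OF inv]] by auto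
  next
    case 3
    then show ?thesis
      unfolding st3_def by auto
  qed
  then show "A \<subseteq> pairs U" "D \<subseteq> pairs U" "m \<le> 2048 * d * h + k * h + 1"
    by auto
qed

lemma R_junk:
  assumes "R m \<kappa> g A D" "y \<in> pairs U" "y \<notin> A \<union> D" "y \<notin> fst g"
  shows "R m \<kappa> g (insert y A) D" "R m \<kappa> g A (insert y D)"
proof -
  have "st3 m \<kappa> g (insert y A) D \<and> st3 m \<kappa> g A (insert y D)" if "st3 m \<kappa> g A D"
    using that assms(2) Good_mono[of A "insert y A"] unfolding st3_def by auto
  then show "R m \<kappa> g (insert y A) D" "R m \<kappa> g A (insert y D)"
    using assms(1) st1_junk[OF _ assms(2,4)] st2_junk[OF _ assms(2-4)] unfolding R_def by auto
qed

lemma R_kill: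
  assumes "R m \<kappa> g A D" "\<not> snd g" "\<kappa> \<le> K0"
  shows "\<exists>y \<in> pairs U - (A \<union> D). y \<in> fst g \<and> R m (Suc \<kappa>) g A (insert y D)"
proof -
  have "\<not> st3 m \<kappa> g A D"
    using assms(2) unfolding st3_def by auto
  then consider "st1 m \<kappa> g A D" | "st2 m \<kappa> g A D"
    using assms(1) unfolding R_def by auto
  then show ?thesis
  proof cases
    case 1
    show ?thesis
      using st1_kill[OF 1 assms(3)] unfolding R_def by auto
  next
    case 2
    show ?thesis
      using st2_kill[OF 2 assms(2,3)] unfolding R_def by auto
  qed
qed

lemma R_open:
  assumes "R m \<kappa> g A D" "y \<in> pairs U" "y \<notin> A \<union> D" "y \<in> fst g"
  shows "\<exists>g'. R (Suc m) \<kappa> g' (insert y A) D"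
proof -
  have "\<not> st3 m \<kappa> g A D"
    using assms(4) unfolding st3_def by auto
  then have "st1 m \<kappa> g A D \<or> st2 m \<kappa> g A D"
    using assms(1) unfolding R_def by auto
  then show ?thesis
    using st1_open[OF _ assms(2-4)] st2_open[OF _ assms(2-4)] by metis
qed

lemma R_initial: "R 0 0 (op1 {}, False) {} {}"
proof -
  have "inv1 {} (\<lambda>_. 0) 0 0 {} {}"
    by (rule inv1_I) auto
  moreover have "\<not> sat {} u" for u
    using par unfolding deg_def by simp
  ultimately have "st1 0 0 (op1 {}, False) {} {}"
    unfolding st1_def using par(5) by auto
  then show ?thesis
    unfolding R_def by blast
qed

text \<open>One pair of \<open>Q\<close> is chosen at each saturated v of W'. These pairs are
  distinct since Z and W' are disjoint, and at least h / 2 vertices are saturated.\<close>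

lemma R_ready:
  assumes "R m \<kappa> g A D" "snd g"
  shows "Good A \<or> (\<exists>Q \<subseteq> pairs U - (A \<union> D). h \<le> 2 * card Q \<and> (\<forall>p \<in> Q. Good (insert p A)))"
proof -
  consider "st2 m \<kappa> g A D" | "st3 m \<kappa> g A D"
    using assms unfolding R_def st1_def by auto
  then show ?thesis
  proof cases
    case 2
    then show ?thesis
      unfolding st3_def by simp
  next
    case 1
    then obtain Z W' Sp Q where inv: "inv2 Z W' Sp Q m \<kappa> A D" and
      g: "g = (zw Z {v \<in> W'. \<not> sat2 Z A v} \<union> Q, h \<le> 2 * card {v \<in> W'. sat2 Z A v})"
      unfolding st2_def by auto
    note I = inv2_D[OF inv]
    note b = base2_D[OF I(3)]
    have "\<exists>f. \<forall>v \<in> {v \<in> W'. sat2 Z A v}. f v \<in> Z \<and> {f v, v} \<in> Q \<and> {f v, v} \<notin> A \<union> D"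
      using I(6) by (intro bchoice) auto
    then obtain f where f: "\<And>v. v \<in> W' \<Longrightarrow> sat2 Z A v \<Longrightarrow> f v \<in> Z \<and> {f v, v} \<in> Q \<and> {f v, v} \<notin> A \<union> D"
      by auto
    let ?S = "{v \<in> W'. sat2 Z A v}"
    define Q' where "Q' = (\<lambda>v. {f v, v}) ` ?S"
    have "inj_on (\<lambda>v. {f v, v}) ?S"
    proof (rule inj_onI)
      fix x y assume "x \<in> ?S" "y \<in> ?S" "{f x, x} = {f y, y}"
      then show "x = y"
        using zw_inj(2)[OF b(3), of "f x" "f y" x y] f by simp
    qed
    then have "card Q' = card ?S"
      unfolding Q'_def by (rule card_image)
    then have hQ: "h \<le> 2 * card Q'"
      using assms(2) g by simp
    have Qp: "Q' \<subseteq> pairs U - (A \<union> D)"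
    proof
      fix p assume "p \<in> Q'"
      then obtain v where v: "p = {f v, v}" "v \<in> W'" "sat2 Z A v"
        unfolding Q'_def by auto
      have "f v \<in> U" "v \<in> U" "f v \<noteq> v"
        using f[OF v(2,3)] b v(2) by auto
      then show "p \<in> pairs U - (A \<union> D)"
        using f[OF v(2,3)] v(1) unfolding pairs_def by auto
    qed
    have "Good (insert p A)" if p: "p \<in> Q'" for p
    proof -
      obtain v where "p = {f v, v}" "v \<in> W'" "sat2 Z A v"
        using p unfolding Q'_def by auto
      then show ?thesis
        using I(8) f by simp
    qed
    then show ?thesis
      by (intro disjI2 exI[of _ Q'] conjI ballI Qp hQ)
  qed
qed

end

section \<open>Playing on all boards simultaneously\<close>

lemma pairs_disjoint:
  assumes "U \<inter> U' = {}" "e \<in> pairs U" "e \<in> pairs U'"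
  shows False
proof -
  have "e \<subseteq> U \<inter> U'" "card e = 2"
    using assms unfolding pairs_def by auto
  then show False
    using assms(1) by auto
qed

text \<open>Kills need not be spread evenly over the boards, so each board gets the kill budget of
  the whole game. It is still below the supply because \<open>q\<close> does not grow with
  n.\<close>

locale boards =
  fixes H :: "'a graph" and n b q :: nat and Us Ws Bs :: "nat \<Rightarrow> nat set" and ls :: "nat \<Rightarrow> nat"
    and d k h :: nat
  assumes Us: "\<And>i. i < q \<Longrightarrow> Us i \<subseteq> {..<n}"
    and disj: "\<And>i j. i < q \<Longrightarrow> j < q \<Longrightarrow> i \<noteq> j \<Longrightarrow> Us i \<inter> Us j = {}"
    and board: "\<And>i. i < q \<Longrightarrow> board (Us i) (Ws i) (Bs i) d k (ls i) h
      (b * (q * (2048 * d * h + k * h + 1) + 1))"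
    and target: "\<And>A. (\<And>i. i < q \<Longrightarrow> rich_cycle (Us i) (ls i) k A) \<Longrightarrow> contains_copy ({..<n}, A) H"
    and close: "2 * (b * (q + 1)) < h"
begin

abbreviation Rb where
  "Rb i \<equiv> board.R (Us i) (Ws i) (Bs i) d k (ls i) h"

definition R :: "nat \<Rightarrow> nat \<Rightarrow> (nat \<Rightarrow> nat set set \<times> bool) \<Rightarrow> nat set set \<Rightarrow> nat set set \<Rightarrow> bool" where
  "R m \<kappa> g A D \<longleftrightarrow> A \<union> D \<subseteq> complete_edges n \<and>
     (\<exists>ms ks. m = (\<Sum>i<q. ms i) \<and> \<kappa> = (\<Sum>i<q. ks i) \<and>
       (\<forall>i<q. Rb i (ms i) (ks i) (g i) (A \<inter> pairs (Us i)) (D \<inter> pairs (Us i))))"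

definition op :: "(nat \<Rightarrow> nat set set \<times> bool) \<Rightarrow> nat set set" where
  "op g = {e. \<exists>i<q. e \<in> pairs (Us i) \<and> e \<in> fst (g i)}"

definition ready :: "(nat \<Rightarrow> nat set set \<times> bool) \<Rightarrow> bool" where
  "ready g \<longleftrightarrow> (\<forall>i<q. snd (g i))"

lemma pairs_complete: "i < q \<Longrightarrow> pairs (Us i) \<subseteq> complete_edges n"
  using Us unfolding pairs_def complete_edges_def by blast

lemma Int_insert: "insert y A \<inter> P = (if y \<in> P then insert y (A \<inter> P) else A \<inter> P)"
  by auto

lemma R_junk:
  assumes R: "R m \<kappa> g A D" and y: "y \<in> unc n A D" "y \<notin> op g"
  shows "R m \<kappa> g (insert y A) D" "R m \<kappa> g A (insert y D)"
proof -
  obtain ms ks where ms: "m = (\<Sum>i<q. ms i)" "\<kappa> = (\<Sum>i<q. ks i)"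
    "\<And>i. i < q \<Longrightarrow> Rb i (ms i) (ks i) (g i) (A \<inter> pairs (Us i)) (D \<inter> pairs (Us i))"
    and AD: "A \<union> D \<subseteq> complete_edges n"
    using R unfolding R_def by auto
  have yc: "y \<in> complete_edges n" "y \<notin> A \<union> D"
    using y unfolding unc_def by auto
  have "Rb i (ms i) (ks i) (g i) (insert y A \<inter> pairs (Us i)) (D \<inter> pairs (Us i)) \<and>
    Rb i (ms i) (ks i) (g i) (A \<inter> pairs (Us i)) (insert y D \<inter> pairs (Us i))" if i: "i < q" for i
  proof (cases "y \<in> pairs (Us i)")
    case False
    then show ?thesis
      using ms(3)[OF i] by (simp add: Int_insert)
  next
    case True
    have "y \<notin> A \<inter> pairs (Us i) \<union> D \<inter> pairs (Us i)" "y \<notin> fst (g i)"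
      using yc(2) y(2) True i unfolding op_def by auto
    then show ?thesis
      using board.R_junk[OF board[OF i] ms(3)[OF i] True] True by (simp add: Int_insert)
  qed
  then show "R m \<kappa> g (insert y A) D" "R m \<kappa> g A (insert y D)"
    unfolding R_def using ms(1,2) AD yc(1) by blast+
qed

lemma sum_upd:
  fixes ms :: "nat \<Rightarrow> nat"
  assumes "i < q"
  shows "(\<Sum>j<q. (ms(i := Suc (ms i))) j) = Suc (\<Sum>j<q. ms j)"
proof -
  have i: "i \<in> {..<q}"
    using assms by simp
  have "(\<Sum>j<q. (ms(i := Suc (ms i))) j) = Suc (ms i) + (\<Sum>j\<in>{..<q} - {i}. (ms(i := Suc (ms i))) j)"
    using sum.remove[OF finite_lessThan i, of "ms(i := Suc (ms i))"] by simp
  also have "(\<Sum>j\<in>{..<q} - {i}. (ms(i := Suc (ms i))) j) = (\<Sum>j\<in>{..<q} - {i}. ms j)"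
    by (intro sum.cong) auto
  finally show ?thesis
    using sum.remove[OF finite_lessThan i, of ms] by simp
qed

lemma R_kill:
  assumes R: "R m \<kappa> g A D" and nr: "\<not> ready g" and \<kappa>: "\<kappa> \<le> b * (q * (2048 * d * h + k * h + 1) + 1)"
  shows "\<exists>y \<in> unc n A D \<inter> op g. R m (Suc \<kappa>) g A (insert y D)"
proof -
  obtain ms ks where ms: "m = (\<Sum>i<q. ms i)" "\<kappa> = (\<Sum>i<q. ks i)"
    "\<And>i. i < q \<Longrightarrow> Rb i (ms i) (ks i) (g i) (A \<inter> pairs (Us i)) (D \<inter> pairs (Us i))"
    and AD: "A \<union> D \<subseteq> complete_edges n"
    using R unfolding R_def by auto
  obtain i where i: "i < q" "\<not> snd (g i)"
    using nr unfolding ready_def by auto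
  have "ks i \<le> \<kappa>"
    unfolding ms(2) using i(1) by (intro member_le_sum) auto
  then have "ks i \<le> b * (q * (2048 * d * h + k * h + 1) + 1)"
    using \<kappa> by (rule order_trans)
  from board.R_kill[OF board[OF i(1)] ms(3)[OF i(1)] i(2) this] obtain y where
    y: "y \<in> pairs (Us i)" "y \<notin> A \<union> D" "y \<in> fst (g i)"
      "Rb i (ms i) (Suc (ks i)) (g i) (A \<inter> pairs (Us i)) (insert y (D \<inter> pairs (Us i)))"
    by auto
  have yc: "y \<in> complete_edges n"
    using y(1) pairs_complete[OF i(1)] by auto
  have "Rb j (ms j) ((ks(i := Suc (ks i))) j) (g j) (A \<inter> pairs (Us j)) (insert y D \<inter> pairs (Us j))"
    if j: "j < q" for j
  proof (cases "j = i")
    case True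
    then show ?thesis
      using y by (simp add: Int_insert)
  next
    case False
    then have "y \<notin> pairs (Us j)"
      using pairs_disjoint[OF disj[OF i(1) j]] y(1) by auto
    then show ?thesis
      using False ms(3)[OF j] by (simp add: Int_insert)
  qed
  moreover have "Suc \<kappa> = (\<Sum>j<q. (ks(i := Suc (ks i))) j)"
    using sum_upd[OF i(1)] ms(2) by simp
  moreover have "A \<union> insert y D \<subseteq> complete_edges n"
    using AD yc by auto
  ultimately have "R m (Suc \<kappa>) g A (insert y D)"
    unfolding R_def using ms(1) by blast
  moreover have "y \<in> unc n A D \<inter> op g"
    using y yc i(1) unfolding unc_def op_def by auto
  ultimately show ?thesis
    by (rule bexI)
qed

lemma R_open:
  assumes R: "R m \<kappa> g A D" and y: "y \<in> unc n A D" "y \<in> op g"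
  shows "\<exists>g'. R (Suc m) \<kappa> g' (insert y A) D"
proof -
  obtain ms ks where ms: "m = (\<Sum>i<q. ms i)" "\<kappa> = (\<Sum>i<q. ks i)"
    "\<And>i. i < q \<Longrightarrow> Rb i (ms i) (ks i) (g i) (A \<inter> pairs (Us i)) (D \<inter> pairs (Us i))"
    and AD: "A \<union> D \<subseteq> complete_edges n"
    using R unfolding R_def by auto
  obtain i where i: "i < q" "y \<in> pairs (Us i)" "y \<in> fst (g i)"
    using y(2) unfolding op_def by auto
  have yc: "y \<in> complete_edges n" "y \<notin> A \<inter> pairs (Us i) \<union> D \<inter> pairs (Us i)"
    using y unfolding unc_def by auto
  from board.R_open[OF board[OF i(1)] ms(3)[OF i(1)] i(2) yc(2) i(3)] obtain gi where
    gi: "Rb i (Suc (ms i)) (ks i) gi (insert y (A \<inter> pairs (Us i))) (D \<inter> pairs (Us i))"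
    by auto
  have "Rb j ((ms(i := Suc (ms i))) j) (ks j) ((g(i := gi)) j) (insert y A \<inter> pairs (Us j)) (D \<inter> pairs (Us j))"
    if j: "j < q" for j
  proof (cases "j = i")
    case True
    then show ?thesis
      using gi i(2) by (simp add: Int_insert)
  next
    case False
    then have "y \<notin> pairs (Us j)"
      using pairs_disjoint[OF disj[OF i(1) j]] i(2) by auto
    then show ?thesis
      using False ms(3)[OF j] by (simp add: Int_insert)
  qed
  moreover have "Suc m = (\<Sum>j<q. (ms(i := Suc (ms i))) j)"
    using sum_upd[OF i(1)] ms(1) by simp
  moreover have "insert y A \<union> D \<subseteq> complete_edges n"
    using AD yc by auto
  ultimately have "R (Suc m) \<kappa> (g(i := gi)) (insert y A) D"
    unfolding R_def using ms(2) by blast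
  then show ?thesis
    by (intro exI[of _ "g(i := gi)"])
qed

lemma R_bound:
  assumes "R m \<kappa> g A D"
  shows "m \<le> q * (2048 * d * h + k * h + 1)"
proof -
  obtain ms ks where ms: "m = (\<Sum>i<q. ms i)"
    "\<And>i. i < q \<Longrightarrow> Rb i (ms i) (ks i) (g i) (A \<inter> pairs (Us i)) (D \<inter> pairs (Us i))"
    using assms unfolding R_def by auto
  have "m \<le> (\<Sum>i<q. 2048 * d * h + k * h + 1)"
    unfolding ms(1)
  proof (rule sum_mono)
    fix i assume "i \<in> {..<q}"
    then show "ms i \<le> 2048 * d * h + k * h + 1"
      using board.R_sub(3)[OF board ms(2)] by simp
  qed
  then show ?thesis
    by simp
qed

lemma Good_mono: "i < q \<Longrightarrow> rich_cycle (Us i) (ls i) k A \<Longrightarrow> A \<subseteq> A' \<Longrightarrow> rich_cycle (Us i) (ls i) k A'"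
  using rich_cycle_mono finite_subset[OF Us] by blast

text \<open>Once every board has at least \<open>h / 2 > b * (q + 1)\<close> closing pairs, Enforcer can afford to kill
  closing pairs.\<close>

definition R2 :: "(nat \<Rightarrow> nat set set) \<Rightarrow> nat \<Rightarrow> nat \<Rightarrow> nat set \<Rightarrow> nat set set \<Rightarrow> nat set set \<Rightarrow> bool" where
  "R2 Q m \<kappa> J A D \<longleftrightarrow> J \<subseteq> {..<q} \<and> m + card J = q \<and>
     (\<forall>i \<in> {..<q} - J. rich_cycle (Us i) (ls i) k A) \<and>
     (\<forall>i \<in> J. Q i \<subseteq> pairs (Us i) - A \<and> h \<le> 2 * card (Q i) \<and> card (D \<inter> Q i) \<le> \<kappa> \<and>
        (\<forall>p \<in> Q i. rich_cycle (Us i) (ls i) k (insert p A)))"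

text \<open>J contains the boards that may still lack a rich cycle. Every open move finishes one, so
  there are at most q open moves and b * (q + 1) kills, fewer than the closing pairs of any single
  board.\<close>

lemma R2_pressure: "pressure H n b q (R2 Q) (\<lambda>J. \<Union>i\<in>J. Q i) (\<lambda>_ J. J = {})"
proof (rule pressure.intro)
  fix m \<kappa> J A D assume R: "R2 Q m \<kappa> J A D"
  have J: "J \<subseteq> {..<q}" "m + card J = q" "\<And>i. i < q \<Longrightarrow> i \<notin> J \<Longrightarrow> rich_cycle (Us i) (ls i) k A"
    "\<And>i. i \<in> J \<Longrightarrow> Q i \<subseteq> pairs (Us i) - A" "\<And>i. i \<in> J \<Longrightarrow> h \<le> 2 * card (Q i)"
    "\<And>i. i \<in> J \<Longrightarrow> card (D \<inter> Q i) \<le> \<kappa>"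
    "\<And>i p. i \<in> J \<Longrightarrow> p \<in> Q i \<Longrightarrow> rich_cycle (Us i) (ls i) k (insert p A)"
    using R unfolding R2_def by simp_all
  have iq: "i < q" if "i \<in> J" for i
    using J(1) that by auto
  have finQ: "finite (Q i)" if "i \<in> J" for i
    using J(4)[OF that] pairs_complete[OF iq[OF that]] finite_complete_edges
    by (meson Diff_subset finite_subset)
  show "m \<le> q"
    using J(2) by simp
  show "reply H n b A D" if "J = {}"
    by (rule reply_goal[OF target]) (use J(3) that in auto)
  show "R2 Q m \<kappa> J A (insert y D)" if "y \<notin> (\<Union>i\<in>J. Q i)" for y
  proof -
    have "insert y D \<inter> Q i = D \<inter> Q i" if "i \<in> J" for i
      using that \<open>y \<notin> (\<Union>i\<in>J. Q i)\<close> by auto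
    then show ?thesis
      using R unfolding R2_def by simp
  qed
  show "R2 Q m \<kappa> J (insert y A) D" if y: "y \<notin> (\<Union>i\<in>J. Q i)" for y
    unfolding R2_def
  proof (intro conjI ballI)
    show "rich_cycle (Us i) (ls i) k (insert y A)" if "i \<in> {..<q} - J" for i
      using that J(3) Good_mono[of i A "insert y A"] by auto
    show "rich_cycle (Us i) (ls i) k (insert p (insert y A))" if "i \<in> J" "p \<in> Q i" for i p
      by (rule Good_mono[OF iq[OF that(1)] J(7)[OF that]]) auto
    show "Q i \<subseteq> pairs (Us i) - insert y A" if "i \<in> J" for i
      using J(4)[OF that] y that by auto
  qed (use J in auto)
  show "\<exists>y\<in>unc n A D \<inter> (\<Union>i\<in>J. Q i). R2 Q m (Suc \<kappa>) J A (insert y D)"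
    if "J \<noteq> {}" "\<kappa> \<le> b * (q + 1)"
  proof -
    obtain i where i: "i \<in> J"
      using \<open>J \<noteq> {}\<close> by auto
    have "card (D \<inter> Q i) < card (Q i)"
      using J(5,6)[OF i] that(2) close by linarith
    then have "D \<inter> Q i \<noteq> Q i"
      by auto
    then obtain y where y: "y \<in> Q i" "y \<notin> D"
      by auto
    have "card (insert y D \<inter> Q j) \<le> Suc \<kappa>" if "j \<in> J" for j
    proof -
      have "insert y D \<inter> Q j \<subseteq> insert y (D \<inter> Q j)"
        by auto
      then have "card (insert y D \<inter> Q j) \<le> card (insert y (D \<inter> Q j))"
        using finQ[OF that] by (intro card_mono) auto
      also have "\<dots> \<le> Suc (card (D \<inter> Q j))"
        by (rule card_insert_le_m1) auto
      finally show ?thesis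
        using J(6)[OF that] by linarith
    qed
    then have "R2 Q m (Suc \<kappa>) J A (insert y D)"
      unfolding R2_def using J by simp
    moreover have "y \<in> unc n A D \<inter> (\<Union>i\<in>J. Q i)"
      using y i J(4)[OF i] pairs_complete[OF iq[OF i]] unfolding unc_def by auto
    ultimately show ?thesis
      by (rule bexI)
  qed
  show "\<exists>J'. R2 Q (Suc m) \<kappa> J' (insert y A) D" if yJ: "y \<in> (\<Union>i\<in>J. Q i)" for y
  proof -
    obtain i where i: "i \<in> J" "y \<in> Q i"
      using yJ by auto
    have yi: "y \<in> pairs (Us i)"
      using J(4)[OF i(1)] i(2) by auto
    have "R2 Q (Suc m) \<kappa> (J - {i}) (insert y A) D"
      unfolding R2_def
    proof (intro conjI ballI)
      show "Suc m + card (J - {i}) = q"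
        using J(2) card.remove[OF finite_subset[OF J(1) finite_lessThan] i(1)] by linarith
      show "rich_cycle (Us j) (ls j) k (insert y A)" if j: "j \<in> {..<q} - (J - {i})" for j
      proof (cases "j = i")
        case True
        then show ?thesis
          using J(7)[OF i] by simp
      next
        case False
        then show ?thesis
          using j J(3) Good_mono[of j A "insert y A"] by auto
      qed
      show "rich_cycle (Us j) (ls j) k (insert p (insert y A))" if "j \<in> J - {i}" "p \<in> Q j" for j p
        by (rule Good_mono[of _ "insert p A"]) (use that iq J(7) in auto)
      show "Q j \<subseteq> pairs (Us j) - insert y A" if j: "j \<in> J - {i}" for j
      proof -
        have "y \<notin> pairs (Us j)"
          using pairs_disjoint[OF disj[OF iq[OF i(1)] iq, of j] yi] j by auto
        then show ?thesis
          using J(4)[of j] j by auto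
      qed
    qed (use J in auto)
    then show ?thesis
      by (intro exI[of _ "J - {i}"])
  qed
qed

lemma reply_if_ready:
  assumes R: "R m \<kappa> g A D" and "ready g"
  shows "reply H n b A D"
proof -
  obtain ms ks where ms:
    "\<And>i. i < q \<Longrightarrow> Rb i (ms i) (ks i) (g i) (A \<inter> pairs (Us i)) (D \<inter> pairs (Us i))"
    using R unfolding R_def by auto
  define J where "J = {i. i < q \<and> \<not> rich_cycle (Us i) (ls i) k A}"
  have "\<exists>Q \<subseteq> pairs (Us i) - (A \<union> D). h \<le> 2 * card Q \<and>
      (\<forall>p \<in> Q. rich_cycle (Us i) (ls i) k (insert p A))" if i: "i \<in> J" for i
  proof -
    have iq: "i < q" and nG: "\<not> rich_cycle (Us i) (ls i) k A"
      using i unfolding J_def by auto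
    have "\<not> rich_cycle (Us i) (ls i) k (A \<inter> pairs (Us i))"
      using nG Good_mono[OF iq, of "A \<inter> pairs (Us i)" A] by auto
    moreover have "snd (g i)"
      using assms(2) iq unfolding ready_def by simp
    ultimately obtain Q where Q: "Q \<subseteq> pairs (Us i) - (A \<inter> pairs (Us i) \<union> D \<inter> pairs (Us i))"
      "h \<le> 2 * card Q" "\<forall>p \<in> Q. rich_cycle (Us i) (ls i) k (insert p (A \<inter> pairs (Us i)))"
      using board.R_ready[OF board[OF iq] ms[OF iq]] by auto
    have "rich_cycle (Us i) (ls i) k (insert p A)" if "p \<in> Q" for p
      by (rule Good_mono[OF iq, of "insert p (A \<inter> pairs (Us i))"]) (use Q(3) that in auto)
    moreover have "Q \<subseteq> pairs (Us i) - (A \<union> D)"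
      using Q(1) by auto
    ultimately show ?thesis
      using Q(2) by auto
  qed
  then have "\<exists>Q. \<forall>i \<in> J. Q i \<subseteq> pairs (Us i) - (A \<union> D) \<and> h \<le> 2 * card (Q i) \<and>
      (\<forall>p \<in> Q i. rich_cycle (Us i) (ls i) k (insert p A))"
    by (intro bchoice) auto
  then obtain Q where Q: "\<And>i. i \<in> J \<Longrightarrow> Q i \<subseteq> pairs (Us i) - (A \<union> D)" "\<And>i. i \<in> J \<Longrightarrow> h \<le> 2 * card (Q i)"
      "\<And>i p. i \<in> J \<Longrightarrow> p \<in> Q i \<Longrightarrow> rich_cycle (Us i) (ls i) k (insert p A)"
    by auto
  have J: "J \<subseteq> {..<q}"
    unfolding J_def by auto
  then have cJ: "card J \<le> q"
    using card_mono[OF finite_lessThan J] by simp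
  have "D \<inter> Q i = {}" "Q i \<subseteq> pairs (Us i) - A" if "i \<in> J" for i
    using Q(1)[OF that] by auto
  \<comment> \<open>\<open>m\<close> starts at the number of boards that already have a rich cycle,
    so that it reaches q when J is empty.\<close>
  then have "R2 Q (q - card J) 0 J A D"
    unfolding R2_def using J cJ Q(2,3) by (auto simp: J_def)
  then show ?thesis
    by (rule pressure.reply_if_R[OF R2_pressure]) simp
qed

lemma R_pressure: "pressure H n b (q * (2048 * d * h + k * h + 1)) R op (\<lambda>_. ready)"
proof (rule pressure.intro)
  fix m \<kappa> g A D assume R: "R m \<kappa> g A D"
  show "m \<le> q * (2048 * d * h + k * h + 1)"
    by (rule R_bound[OF R])
  show "reply H n b A D" if "ready g"
    by (rule reply_if_ready[OF R that])
  show "R m \<kappa> g (insert y A) D" "R m \<kappa> g A (insert y D)" if "y \<in> unc n A D" "y \<notin> op g" for y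
    by (rule R_junk[OF R that])+
  show "\<exists>y\<in>unc n A D \<inter> op g. R m (Suc \<kappa>) g A (insert y D)"
    if "\<not> ready g" "\<kappa> \<le> b * (q * (2048 * d * h + k * h + 1) + 1)"
    by (rule R_kill[OF R that])
  show "\<exists>g'. R (Suc m) \<kappa> g' (insert y A) D" if "y \<in> unc n A D" "y \<in> op g" for y
    by (rule R_open[OF R that])
qed

theorem ewin_boards: "ewin H n b {} {}"
proof (cases "q = 0")
  case True
  then show ?thesis
    using target by (intro ewin.goal) auto
next
  case False
  define g where "g i = (board.op1 (Us i) d {}, False)" for i
  have "R 0 0 g {} {}"
    unfolding R_def g_def using board.R_initial[OF board]
    by (auto intro!: exI[of _ "\<lambda>_. 0"])
  moreover have "\<not> ready g"
    unfolding ready_def g_def using False by auto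
  ultimately show ?thesis
    by (rule pressure.ewin_if_R[OF R_pressure])
qed

end

section \<open>Embedding a sparse graph into rich sets with cycles\<close>

context fin_graph
begin

lemma hin_pairs: "hin V \<subseteq> pairs V"
  unfolding hin_def pairs_def using edge_card by auto

lemma card_nbrs_edges:
  assumes "V \<subseteq> verts H" "x \<in> V"
  shows "card (nbrs (edges H) V x) = deg (hin V) x"
proof (rule antisym)
  have fin: "finite V"
    using assms(1) finite_subset finite_verts by blast
  have "inj_on (\<lambda>y. {x, y}) (nbrs (edges H) V x)"
    by (auto simp: inj_on_def doubleton_eq_iff)
  moreover have "(\<lambda>y. {x, y}) ` nbrs (edges H) V x \<subseteq> {e \<in> hin V. x \<in> e}"
    using assms(2) unfolding nbrs_def hin_def by auto
  ultimately show "card (nbrs (edges H) V x) \<le> deg (hin V) x"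
    unfolding deg_def by (rule card_inj_on_le) simp
  have "{e \<in> hin V. x \<in> e} = {e \<in> edges H. e \<subseteq> V \<and> x \<in> e}"
    unfolding hin_def by auto
  then show "deg (hin V) x \<le> card (nbrs (edges H) V x)"
    unfolding deg_def using degree_le_nbrs[OF edge_card fin, where z = x] by simp
qed

text \<open>In a longest path the end has both neighbours on the path. The one that is not its
  predecessor must be the first vertex, since an inner vertex would have three neighbours. The
  resulting cycle uses up the degree two of its vertices, so no edge leaves it.\<close>

lemma cycle_component:
  assumes V: "V \<subseteq> verts H" "V \<noteq> {}" and two: "\<And>x. x \<in> V \<Longrightarrow> card (nbrs (edges H) V x) = 2"
  shows "\<exists>ys. distinct ys \<and> set ys \<subseteq> V \<and> 3 \<le> length ys \<and>
    (\<forall>j<length ys. \<forall>x \<in> V. {ys ! j, x} \<in> edges H \<longrightarrow> x = ys ! (Suc j mod length ys) \<or>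
      (\<exists>i<length ys. x = ys ! i \<and> j = Suc i mod length ys))"
proof -
  define P where "P ys \<longleftrightarrow> gpath (edges H) ys \<and> set ys \<subseteq> V \<and> ys \<noteq> []" for ys
  have fin: "finite V"
    using V(1) finite_subset finite_verts by blast
  obtain x0 where "x0 \<in> V"
    using V(2) by auto
  then have "P [x0]"
    unfolding P_def gpath_def by auto
  moreover have "\<forall>ys. P ys \<longrightarrow> length ys < Suc (card V)"
    unfolding P_def gpath_def using card_mono[OF fin] by (auto simp: distinct_card[symmetric] less_Suc_eq_le)
  ultimately have "\<exists>ys. P ys \<and> (\<forall>zs. P zs \<longrightarrow> length zs \<le> length ys)"
    by (rule ex_has_greatest_nat)
  then obtain ys where ys: "P ys" and mx: "\<And>zs. P zs \<Longrightarrow> length zs \<le> length ys"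
    by auto
  define L where "L = length ys"
  have dist: "distinct ys" and sub: "set ys \<subseteq> V" and ne: "ys \<noteq> []"
    using ys unfolding P_def gpath_def by auto
  have L0: "0 < L"
    using ne unfolding L_def by simp
  have inV: "ys ! j \<in> V" if "j < L" for j
    using sub that unfolding L_def by auto
  have step: "{ys ! j, ys ! Suc j} \<in> edges H" if "Suc j < L" for j
    using ys that unfolding P_def gpath_def L_def successively_conv_nth by auto
  have neq: "ys ! i \<noteq> ys ! j" if "i < L" "j < L" "i \<noteq> j" for i j
    using dist that unfolding L_def by (simp add: nth_eq_iff_index_eq)
  have nb: "ys ! i \<in> nbrs (edges H) V (ys ! j)" if "i < L" "{ys ! j, ys ! i} \<in> edges H" for i j
    using that inV unfolding nbrs_def by simp
  have last: "last ys = ys ! (L - 1)"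
    using ne unfolding L_def by (rule last_conv_nth)
  have lastN: "nbrs (edges H) V (last ys) \<subseteq> set ys - {last ys}"
  proof
    fix y assume y: "y \<in> nbrs (edges H) V (last ys)"
    have "y \<in> set ys"
    proof (rule ccontr)
      assume "y \<notin> set ys"
      then have "P (ys @ [y])"
        using gpath_extend[of "edges H" ys y] ys y unfolding P_def nbrs_def by auto
      then show False
        using mx by fastforce
    qed
    moreover have "y \<noteq> last ys"
      using y edge_neq unfolding nbrs_def by auto
    ultimately show "y \<in> set ys - {last ys}"
      by simp
  qed
  have "last ys \<in> V"
    using sub ne by auto
  then have "2 \<le> card (set ys - {last ys})"
    using card_mono[OF _ lastN] two by simp
  then have L3: "3 \<le> L"
    using ne dist unfolding L_def by (simp add: distinct_card)
  have "nbrs (edges H) V (last ys) \<noteq> {ys ! (L - 2)}"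
    using two[OF \<open>last ys \<in> V\<close>] by auto
  moreover have "nbrs (edges H) V (last ys) \<noteq> {}"
    using two[OF \<open>last ys \<in> V\<close>] by auto
  ultimately obtain w where w: "w \<in> nbrs (edges H) V (last ys)" "w \<noteq> ys ! (L - 2)"
    by blast
  then obtain i where i: "i < L" "w = ys ! i"
    using lastN unfolding L_def by (metis DiffD1 in_mono in_set_conv_nth)
  have i': "i \<noteq> L - 1" "i \<noteq> L - 2"
    using w i lastN last by auto
  have closing: "{ys ! (L - 1), ys ! i} \<in> edges H"
    using w(1) unfolding nbrs_def i(2) last by simp
  have "i = 0"
  proof (rule ccontr)
    assume i0: "i \<noteq> 0"
    have "{ys ! (i - 1), ys ! Suc i, ys ! (L - 1)} \<subseteq> nbrs (edges H) V (ys ! i)"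
      using nb[of "i - 1" i] nb[of "Suc i" i] nb[of "L - 1" i] step[of i] step[of "i - 1"] closing i i' i0
      by (auto simp: insert_commute)
    moreover have "card {ys ! (i - 1), ys ! Suc i, ys ! (L - 1)} = 3"
      using neq[of "i - 1" "Suc i"] neq[of "i - 1" "L - 1"] neq[of "Suc i" "L - 1"] i i' i0 by auto
    moreover have "finite (nbrs (edges H) V (ys ! i))"
      using fin unfolding nbrs_def by simp
    ultimately have "3 \<le> card (nbrs (edges H) V (ys ! i))"
      by (metis card_mono)
    then show False
      using two[OF inV[OF i(1)]] by simp
  qed
  have cyc: "{ys ! j, ys ! (Suc j mod L)} \<in> edges H" if "j < L" for j
  proof (cases "Suc j < L")
    case True
    then show ?thesis
      using step by simp
  next
    case False
    then have "j = L - 1" "Suc j mod L = 0"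
      using that by (auto simp: mod_if)
    then show ?thesis
      using closing \<open>i = 0\<close> by simp
  qed
  have "x = ys ! (Suc j mod L) \<or> (\<exists>i<L. x = ys ! i \<and> j = Suc i mod L)"
    if j: "j < L" and x: "x \<in> V" "{ys ! j, x} \<in> edges H" for j x
  proof -
    \<comment> \<open>The cyclic predecessor of j. It differs from the successor because the cycle
      has at least three vertices.\<close>
    define p where "p = (if j = 0 then L - 1 else j - 1)"
    have p: "p < L" "Suc p mod L = j" "p \<noteq> Suc j mod L"
      using j L3 unfolding p_def by (auto simp: mod_if)
    have s: "Suc j mod L < L"
      using L0 by simp
    have "{ys ! (Suc j mod L), ys ! p} \<subseteq> nbrs (edges H) V (ys ! j)"
      using nb[OF s cyc[OF j]] nb[OF p(1)] cyc[OF p(1)] p(2) by (simp add: insert_commute)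
    moreover have "card {ys ! (Suc j mod L), ys ! p} = card (nbrs (edges H) V (ys ! j))"
      using neq[OF s p(1)] p(3) two[OF inV[OF j]] by auto
    moreover have "finite (nbrs (edges H) V (ys ! j))"
      using fin unfolding nbrs_def by simp
    ultimately have "{ys ! (Suc j mod L), ys ! p} = nbrs (edges H) V (ys ! j)"
      by (intro card_subset_eq)
    moreover have "x \<in> nbrs (edges H) V (ys ! j)"
      using x unfolding nbrs_def by simp
    ultimately have "x = ys ! (Suc j mod L) \<or> x = ys ! p"
      by auto
    then show ?thesis
      using p(1,2) by auto
  qed
  then show ?thesis
    using dist sub L3 unfolding L_def by (intro exI[of _ ys]) auto
qed

text \<open>A vertex of degree at most one is attached inside the rich set that contains the image
  of its neighbour; an isolated vertex may go next to any vertex of a rich set, for which J has to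
  be nonempty. A cycle is placed on the prescribed cycle of a board of the same length, and that
  board is given up.\<close>

lemma embedding:
  fixes A :: "nat set set"
  assumes sparse: "\<And>S. S \<subseteq> verts H \<Longrightarrow> card (hin S) \<le> card S"
    and I: "finite I" and R: "\<And>i. i \<in> I \<Longrightarrow> gpath A (xs i) \<and> length (xs i) = ls i \<and> set (xs i) \<subseteq> R i \<and>
      {last (xs i), hd (xs i)} \<in> A \<and> (\<forall>u \<in> R i. k \<le> card (nbrs A (R i) u))"
    and disj: "\<And>i j. i \<in> I \<Longrightarrow> j \<in> I \<Longrightarrow> i \<noteq> j \<Longrightarrow> R i \<inter> R j = {}"
    and l3: "\<And>i. i \<in> I \<Longrightarrow> 3 \<le> ls i"
  shows "V \<subseteq> verts H \<Longrightarrow> card V \<le> k \<Longrightarrow> J \<subseteq> I \<Longrightarrow> V = {} \<or> J \<noteq> {} \<Longrightarrow>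
    (\<And>l. 3 \<le> l \<Longrightarrow> l \<le> k \<Longrightarrow> card V \<le> card {i \<in> J. ls i = l}) \<Longrightarrow>
    \<exists>\<phi>. inj_on \<phi> V \<and> \<phi> ` V \<subseteq> (\<Union>i\<in>J. R i) \<and> (\<forall>e \<in> hin V. \<phi> ` e \<in> A)"
proof (induction "card V" arbitrary: V J rule: less_induct)
  case less
  have fin: "finite V"
    using less.prems(1) finite_subset finite_verts by blast
  show ?case
  proof (cases "V = {}")
    case True
    then show ?thesis
      using edge_card unfolding hin_def by fastforce
  next
    case ne: False
    then obtain i0 where i0: "i0 \<in> J"
      using less.prems(4) by auto
    show ?thesis
    proof (cases "\<exists>x \<in> V. deg (hin V) x \<le> 1")
      case True
      then obtain x where x: "x \<in> V" "card {e \<in> hin V. x \<in> e} \<le> 1"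
        unfolding deg_def by auto
      have cV: "card V = Suc (card (V - {x}))"
        using card.remove[OF fin x(1)] .
      have le: "card (V - {x}) \<le> card V"
        using cV by simp
      have "\<exists>\<phi>. inj_on \<phi> (V - {x}) \<and> \<phi> ` (V - {x}) \<subseteq> (\<Union>i\<in>J. R i) \<and> (\<forall>e \<in> hin (V - {x}). \<phi> ` e \<in> A)"
      proof (rule less.hyps)
        show "card (V - {x}) < card V"
          using cV by simp
        show "V - {x} \<subseteq> verts H"
          using less.prems(1) by auto
        show "card (V - {x}) \<le> k"
          using le less.prems(2) by (rule order_trans)
        show "card (V - {x}) \<le> card {i \<in> J. ls i = l}" if "3 \<le> l" "l \<le> k" for l
          using le less.prems(5)[OF that] by (rule order_trans)
        show "V - {x} = {} \<or> J \<noteq> {}"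
          using i0 by auto
      qed (rule less.prems(3))
      then obtain \<phi> where \<phi>: "inj_on \<phi> (V - {x})" "\<phi> ` (V - {x}) \<subseteq> (\<Union>i\<in>J. R i)"
        "\<And>e. e \<in> hin (V - {x}) \<Longrightarrow> \<phi> ` e \<in> A"
        by auto
      have "\<exists>u \<in> (\<Union>i\<in>J. R i). \<forall>e \<in> hin V. x \<in> e \<longrightarrow> (\<exists>y. e = {x, y} \<and> y \<noteq> x \<and> u = \<phi> y)"
      proof (cases "{e \<in> hin V. x \<in> e} = {}")
        case True
        have "xs i0 \<noteq> []"
          using R[of i0] l3[of i0] i0 less.prems(3) by fastforce
        then have "hd (xs i0) \<in> R i0"
          using R[OF subsetD[OF less.prems(3) i0]] hd_in_set by blast
        then show ?thesis
          using True i0 by auto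
      next
        case False
        then obtain e where e: "e \<in> hin V" "x \<in> e"
          by auto
        then obtain y where y: "e = {x, y}" "y \<noteq> x"
          using edge_card[of e] unfolding hin_def by (auto simp: card_2_iff)
        have "e' = e" if "e' \<in> hin V" "x \<in> e'" for e'
          using card_le_Suc0_iff_eq[of "{e \<in> hin V. x \<in> e}"] x(2) e that by auto
        moreover have "\<phi> y \<in> (\<Union>i\<in>J. R i)"
          using \<phi>(2) e y unfolding hin_def by auto
        ultimately show ?thesis
          using y by (intro bexI[of _ "\<phi> y"]) auto
      qed
      then obtain u where u: "u \<in> (\<Union>i\<in>J. R i)"
        "\<And>e. e \<in> hin V \<Longrightarrow> x \<in> e \<Longrightarrow> \<exists>y. e = {x, y} \<and> y \<noteq> x \<and> u = \<phi> y"
        by auto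
      obtain i where i: "i \<in> J" "u \<in> R i"
        using u(1) by auto
      \<comment> \<open>Fewer than \<open>k\<close> vertices are in use, while u has at least
        \<open>k\<close> neighbours in its rich set.\<close>
      have "card (\<phi> ` (V - {x})) < card (nbrs A (R i) u)"
        using card_image_le[of "V - {x}" \<phi>] fin cV less.prems(2,3) R[of i] i by fastforce
      then have "\<not> nbrs A (R i) u \<subseteq> \<phi> ` (V - {x})"
        using card_mono[of "\<phi> ` (V - {x})"] fin by (meson finite_Diff finite_imageI leD)
      then obtain v where v: "v \<in> R i" "{u, v} \<in> A" "v \<notin> \<phi> ` (V - {x})"
        unfolding nbrs_def by auto
      define \<psi> where "\<psi> = \<phi>(x := v)"
      have \<psi>x: "\<psi> x = v" and \<psi>: "\<And>y. y \<noteq> x \<Longrightarrow> \<psi> y = \<phi> y"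
        unfolding \<psi>_def by simp_all
      have im: "\<psi> ` S = \<phi> ` S" if "x \<notin> S" for S
        by (rule image_cong[OF refl], rule \<psi>) (use that in auto)
      have "inj_on \<psi> (insert x (V - {x}))"
        using \<phi>(1) v(3) \<psi>x im[of "V - {x}"] by (subst inj_on_insert) (auto simp: inj_on_def \<psi>)
      then have "inj_on \<psi> V"
        using x(1) by (simp add: insert_absorb)
      moreover have "\<psi> ` V \<subseteq> (\<Union>i\<in>J. R i)"
      proof
        fix z assume "z \<in> \<psi> ` V"
        then obtain y where y: "y \<in> V" "z = \<psi> y"
          by auto
        show "z \<in> (\<Union>i\<in>J. R i)"
          using y \<phi>(2) v(1) i(1) \<psi>x \<psi>[of y] by (cases "y = x") auto
      qed
      moreover have "\<psi> ` e \<in> A" if e: "e \<in> hin V" for e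
      proof (cases "x \<in> e")
        case True
        then obtain y where "e = {x, y}" "y \<noteq> x" "u = \<phi> y"
          using u(2)[OF e] by auto
        then show ?thesis
          using \<psi>x \<psi>[of y] v(2) by (simp add: insert_commute)
      next
        case False
        then have "e \<in> hin (V - {x})"
          using e unfolding hin_def by auto
        then show ?thesis
          using \<phi>(3) im[OF False] by simp
      qed
      ultimately show ?thesis
        by (intro exI[of _ \<psi>]) auto
    next
      case False
      then have ge: "2 \<le> deg (hin V) x" if "x \<in> V" for x
        using that by force
      \<comment> \<open>The average degree is at most two and every degree is at least two, so all
        degrees equal two.\<close>
      have sum: "(\<Sum>x\<in>V. deg (hin V) x) \<le> 2 * card V"
        using sum_deg[OF finite_hin fin hin_pairs] sparse[OF less.prems(1)] by simp
      have two: "card (nbrs (edges H) V x) = 2" if x: "x \<in> V" for x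
      proof -
        have "(\<Sum>x\<in>V - {x}. 2) \<le> (\<Sum>x\<in>V - {x}. deg (hin V) x)"
          using ge by (intro sum_mono) auto
        moreover have "card V = Suc (card (V - {x}))"
          using card.remove[OF fin x] .
        ultimately have "deg (hin V) x \<le> 2"
          using sum sum.remove[OF fin x, of "deg (hin V)"] by simp
        then show ?thesis
          using card_nbrs_edges[OF less.prems(1) x] ge[OF x] by simp
      qed
      obtain ys where ys: "distinct ys" "set ys \<subseteq> V" "3 \<le> length ys"
        and closed: "\<And>j x. j < length ys \<Longrightarrow> x \<in> V \<Longrightarrow> {ys ! j, x} \<in> edges H \<Longrightarrow>
          x = ys ! (Suc j mod length ys) \<or> (\<exists>i<length ys. x = ys ! i \<and> j = Suc i mod length ys)"
        using cycle_component[OF less.prems(1) ne two] by auto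
      define L where "L = length ys"
      have cys: "card (set ys) = L"
        unfolding L_def using ys(1) by (rule distinct_card)
      have L: "3 \<le> L" "L \<le> k"
        using ys(3) card_mono[OF fin ys(2)] less.prems(2) cys unfolding L_def by auto
      have "0 < card {i \<in> J. ls i = L}"
        using less_le_trans[OF _ less.prems(5)[OF L], of 0] ne fin by (simp only: card_gt_0_iff simp_thms)
      then obtain i where i: "i \<in> J" "ls i = L"
        by (auto simp: card_gt_0_iff)
      have iI: "i \<in> I"
        using i less.prems(3) by auto
      have cV: "card (V - set ys) + L = card V"
        using card_Diff_subset[OF _ ys(2)] card_mono[OF fin ys(2)] cys by simp
      have finJ: "finite J"
        using less.prems(3) I finite_subset by auto
      \<comment> \<open>The step costs at most one board of each length but removes at least three
        vertices, so the supply of boards stays sufficient.\<close>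
      have cnt: "card (V - set ys) \<le> card {j \<in> J - {i}. ls j = l}" if "3 \<le> l" "l \<le> k" for l
      proof -
        have "{j \<in> J. ls j = l} \<subseteq> insert i {j \<in> J - {i}. ls j = l}"
          by auto
        then have "card {j \<in> J. ls j = l} \<le> card (insert i {j \<in> J - {i}. ls j = l})"
          using finJ by (intro card_mono) auto
        also have "\<dots> \<le> Suc (card {j \<in> J - {i}. ls j = l})"
          by (rule card_insert_le_m1) auto
        finally show ?thesis
          using less.prems(5)[OF that] cV L by linarith
      qed
      have "\<exists>\<phi>. inj_on \<phi> (V - set ys) \<and> \<phi> ` (V - set ys) \<subseteq> (\<Union>i\<in>J - {i}. R i) \<and>
        (\<forall>e \<in> hin (V - set ys). \<phi> ` e \<in> A)"
      proof (rule less.hyps)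
        show "card (V - set ys) < card V" "card (V - set ys) \<le> k"
          using cV L less.prems(2) by linarith+
        show "V - set ys = {} \<or> J - {i} \<noteq> {}"
        proof (rule disjCI)
          assume "\<not> J - {i} \<noteq> {}"
          then have "{j \<in> J - {i}. ls j = L} = {}"
            by auto
          then have "card {j \<in> J - {i}. ls j = L} = 0"
            by (simp only: card.empty)
          then have "card (V - set ys) = 0"
            using cnt[OF L] by linarith
          then show "V - set ys = {}"
            using fin by simp
        qed
      qed (use less.prems(1,3) cnt in auto)
      then obtain \<phi> where \<phi>: "inj_on \<phi> (V - set ys)" "\<phi> ` (V - set ys) \<subseteq> (\<Union>i\<in>J - {i}. R i)"
        "\<And>e. e \<in> hin (V - set ys) \<Longrightarrow> \<phi> ` e \<in> A"
        by auto
      have Ri: "gpath A (xs i)" "length (xs i) = L" "set (xs i) \<subseteq> R i" "{last (xs i), hd (xs i)} \<in> A"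
        using R[OF iI] i(2) by auto
      have xne: "xs i \<noteq> []"
        using Ri(2) L by auto
      have cyc: "{xs i ! j, xs i ! (Suc j mod L)} \<in> A" if "j < L" for j
      proof (cases "Suc j < L")
        case True
        then show ?thesis
          using Ri(1,2) unfolding gpath_def successively_conv_nth by auto
      next
        case False
        then have "j = L - 1" "Suc j mod L = 0"
          using that by (auto simp: mod_if)
        then show ?thesis
          using Ri(4) Ri(2) by (simp add: last_conv_nth[OF xne] hd_conv_nth[OF xne])
      qed
      define \<psi> where "\<psi> v = (if v \<in> set ys then xs i ! (inv_into {..<L} ((!) ys) v) else \<phi> v)" for v
      have injy: "inj_on ((!) ys) {..<L}"
        using ys(1) unfolding L_def by (auto simp: inj_on_def nth_eq_iff_index_eq)
      have \<psi>y: "\<psi> (ys ! j) = xs i ! j" if "j < L" for j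
        using that inv_into_f_f[OF injy, of j] unfolding \<psi>_def L_def by auto
      have \<psi>n: "\<psi> v = \<phi> v" if "v \<notin> set ys" for v
        using that unfolding \<psi>_def by simp
      have idx: "\<exists>j<L. v = ys ! j" if "v \<in> set ys" for v
        using that unfolding L_def by (auto simp: in_set_conv_nth)
      have inR: "\<psi> v \<in> R i" if "v \<in> set ys" for v
        using idx[OF that] \<psi>y Ri(2,3) by (auto simp: subset_iff)
      have nin: "\<psi> v \<in> (\<Union>j\<in>J - {i}. R j)" if "v \<in> V - set ys" for v
        using \<phi>(2) that \<psi>n[of v] by auto
      have sep: "R i \<inter> (\<Union>j\<in>J - {i}. R j) = {}"
        using disj[OF iI] less.prems(3) by blast
      have "inj_on \<psi> (set ys \<union> (V - set ys))"
      proof (rule inj_on_Un[THEN iffD2], intro conjI)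
        show "inj_on \<psi> (set ys)"
        proof (rule inj_onI)
          fix v w assume vw: "v \<in> set ys" "w \<in> set ys" "\<psi> v = \<psi> w"
          obtain a c where ac: "a < L" "v = ys ! a" "c < L" "w = ys ! c"
            using idx vw(1,2) by blast
          then have "xs i ! a = xs i ! c"
            using vw(3) \<psi>y by simp
          then show "v = w"
            using ac Ri(1,2) unfolding gpath_def by (simp add: nth_eq_iff_index_eq)
        qed
        show "inj_on \<psi> (V - set ys)"
          using \<phi>(1) \<psi>n by (auto simp: inj_on_def)
        show "\<psi> ` (set ys - (V - set ys)) \<inter> \<psi> ` (V - set ys - set ys) = {}"
          using inR nin sep by blast
      qed
      moreover have "set ys \<union> (V - set ys) = V"
        using ys(2) by auto
      ultimately have "inj_on \<psi> V"
        by simp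
      moreover have "\<psi> ` V \<subseteq> (\<Union>i\<in>J. R i)"
        using inR nin i(1) by blast
      moreover have "\<psi> ` e \<in> A" if e: "e \<in> hin V" for e
      proof (cases "e \<inter> set ys = {}")
        case True
        then have "e \<in> hin (V - set ys)"
          using e unfolding hin_def by auto
        moreover have "\<psi> ` e = \<phi> ` e"
          using True \<psi>n by (intro image_cong) auto
        ultimately show ?thesis
          using \<phi>(3) by simp
      next
        case False
        then obtain j where j: "j < L" "ys ! j \<in> e"
          using idx by blast
        then obtain x where x: "e = {ys ! j, x}"
          using edge_card[of e] e unfolding hin_def by (auto simp: card_2_iff)
        have "x = ys ! (Suc j mod L) \<or> (\<exists>i<L. x = ys ! i \<and> j = Suc i mod L)"
          unfolding L_def by (rule closed) (use j(1) e x in \<open>auto simp: L_def hin_def\<close>)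
        then show ?thesis
        proof
          assume "x = ys ! (Suc j mod L)"
          then show ?thesis
            using cyc[OF j(1)] \<psi>y[OF j(1)] \<psi>y[of "Suc j mod L"] L unfolding x by simp
        next
          assume "\<exists>i<L. x = ys ! i \<and> j = Suc i mod L"
          then obtain a where a: "a < L" "x = ys ! a" "j = Suc a mod L"
            by auto
          then show ?thesis
            using cyc[OF a(1)] \<psi>y[OF a(1)] \<psi>y[OF j(1)] unfolding x by (simp add: insert_commute)
        qed
      qed
      ultimately show ?thesis
        by (intro exI[of _ \<psi>]) auto
    qed
  qed
qed

end

section \<open>The case of density one\<close>

lemma card_residue_class:
  assumes "r < k"
  shows "k \<le> card {i \<in> {..<k * k}. i mod k = r}"
proof -
  have "inj_on (\<lambda>t. t * k + r) {..<k}"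
    using assms by (auto simp: inj_on_def)
  moreover have "(\<lambda>t. t * k + r) ` {..<k} \<subseteq> {i \<in> {..<k * k}. i mod k = r}"
  proof (rule image_subsetI)
    fix t assume "t \<in> {..<k}"
    then have "Suc t * k \<le> k * k"
      by (intro mult_le_mono1) simp
    then show "t * k + r \<in> {i \<in> {..<k * k}. i mod k = r}"
      using assms by simp
  qed
  ultimately have "card {..<k} \<le> card {i \<in> {..<k * k}. i mod k = r}"
    by (rule card_inj_on_le) auto
  then show ?thesis
    by simp
qed

context fin_graph
begin

text \<open>The lengths \<open>3 + i mod k\<close> for i < k * k contain every length from 3 to
  \<open>k\<close> at least \<open>k\<close> times, as \<open>embedding\<close> requires. They can
  thus be fixed before the game.\<close>

lemma copy_if_rich_cycles:
  assumes sparse: "\<And>S. S \<subseteq> verts H \<Longrightarrow> card (hin S) \<le> card S" and k: "k = card (verts H)" "0 < k"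
    and Us: "\<And>i. i < k * k \<Longrightarrow> Us i \<subseteq> {..<n}"
    and disj: "\<And>i j. i < k * k \<Longrightarrow> j < k * k \<Longrightarrow> i \<noteq> j \<Longrightarrow> Us i \<inter> Us j = {}"
    and rich: "\<And>i. i < k * k \<Longrightarrow> rich_cycle (Us i) (3 + i mod k) k A"
  shows "contains_copy ({..<n}, A) H"
proof -
  define Q where "Q i p \<longleftrightarrow> fst p \<subseteq> Us i \<and> gpath A (snd p) \<and> length (snd p) = 3 + i mod k \<and>
      set (snd p) \<subseteq> fst p \<and> {last (snd p), hd (snd p)} \<in> A \<and> (\<forall>u \<in> fst p. k \<le> card (nbrs A (fst p) u))"
    for i p
  have "\<exists>p. Q i p" if "i < k * k" for i
    using rich[OF that] unfolding rich_cycle_def Q_def by (simp only: split_paired_Ex fst_conv snd_conv)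
  then obtain p where "\<And>i. i < k * k \<Longrightarrow> Q i (p i)"
    by metis
  note p = this[unfolded Q_def]
  have "\<exists>\<phi>. inj_on \<phi> (verts H) \<and> \<phi> ` verts H \<subseteq> (\<Union>i\<in>{..<k * k}. fst (p i)) \<and>
      (\<forall>e \<in> hin (verts H). \<phi> ` e \<in> A)"
  proof (rule embedding[where I = "{..<k * k}" and xs = "\<lambda>i. snd (p i)" and ls = "\<lambda>i. 3 + i mod k"
        and k = k])
    show "fst (p i) \<inter> fst (p j) = {}" if "i \<in> {..<k * k}" "j \<in> {..<k * k}" "i \<noteq> j" for i j
      using p[of i] p[of j] disj[of i j] that by auto
    show "verts H = {} \<or> {..<k * k} \<noteq> {}"
    proof -
      have "0 \<in> {..<k * k}"
        using k(2) by simp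
      then show ?thesis
        by blast
    qed
    show "card (verts H) \<le> card {i \<in> {..<k * k}. 3 + i mod k = l}" if "3 \<le> l" "l \<le> k" for l
    proof -
      have "{i \<in> {..<k * k}. 3 + i mod k = l} = {i \<in> {..<k * k}. i mod k = l - 3}"
        using that(1) by auto
      then show ?thesis
        using card_residue_class[of "l - 3" k] that k by simp
    qed
  qed (use sparse p k in auto)
  then obtain \<phi> where \<phi>: "inj_on \<phi> (verts H)" "\<phi> ` verts H \<subseteq> (\<Union>i\<in>{..<k * k}. fst (p i))"
      "\<And>e. e \<in> hin (verts H) \<Longrightarrow> \<phi> ` e \<in> A"
    by auto
  have "(\<Union>i\<in>{..<k * k}. fst (p i)) \<subseteq> {..<n}"
    using p Us by (meson UN_least lessThan_iff order_trans)
  then show ?thesis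
    unfolding contains_copy_def using \<phi> edge_sub unfolding hin_def by (intro exI[of _ \<phi>]) auto
qed

lemma ewin_sparse:
  assumes sparse: "\<And>S. S \<subseteq> verts H \<Longrightarrow> card (hin S) \<le> card S" and ne: "verts H \<noteq> {}"
  shows "\<exists>\<delta>>0. \<exists>n0. \<forall>n\<ge>n0. \<forall>b. real b \<le> \<delta> * real n \<longrightarrow> ewin H n b {} {}"
proof -
  define k where "k = card (verts H)"
  define q where "q = k * k"
  \<comment> \<open>The cycle lengths are at most k + 2, and \<open>board\<close> asks for l + 2
    \<le> d and k \<le> d.\<close>
  define d where "d = k + 5"
  define C where "C = 2048 * d + k + 1"
  define E where "E = q * C + 1"
  have k: "0 < k"
    using ne unfolding k_def by (simp add: card_gt_0_iff)
  then have q: "0 < q"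
    unfolding q_def by simp
  then have qE: "0 < 256 * q * E"
    unfolding E_def by simp
  \<comment> \<open>Boards have 64 * h vertices. On each there are at most C * h open moves, and E *
    h * b bounds the kill budget. The two hypotheses give 4 * C + 1 \<le> h and 4 * E * b \<le> h,
    so 2 * (E * b + C) < h, which is what \<open>big\<close> needs.\<close>
  have "ewin H n b {} {}" if n: "64 * q * (4 * C + 1) \<le> n" and b: "real b \<le> 1 / real (256 * q * E) * real n" for n b
  proof -
    define h where "h = n div (64 * q)"
    define Ws where "Ws i = {64 * h * i..<64 * h * i + 32 * h}" for i
    define Bs where "Bs i = {64 * h * i + 32 * h..<64 * h * Suc i}" for i
    define Us where "Us i = {64 * h * i..<64 * h * Suc i}" for i
    have "real (b * (256 * q * E)) \<le> real n"
      using b qE by (simp add: field_simps del: of_nat_mult add: of_nat_mult[symmetric])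
    then have "b * (256 * q * E) \<le> n"
      by (simp only: of_nat_le_iff)
    then have "(4 * E * b) * (64 * q) \<le> n"
      by (simp add: algebra_simps)
    then have hb: "4 * E * b \<le> h"
      unfolding h_def using q by (simp add: less_eq_div_iff_mult_less_eq)
    have "(4 * C + 1) * (64 * q) \<le> n"
      using n by (simp add: algebra_simps)
    then have hC: "4 * C + 1 \<le> h"
      unfolding h_def using q by (simp add: less_eq_div_iff_mult_less_eq)
    have h1: "1 \<le> h"
      using hC by simp
    have hq: "64 * h * q \<le> n"
      unfolding h_def by (metis mult.assoc mult.commute times_div_less_eq_dividend)
    have sub: "64 * h * Suc i \<le> n" if "i < q" for i
    proof -
      have "64 * h * Suc i \<le> 64 * h * q"
        using that by (intro mult_le_mono2) simp
      then show ?thesis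
        using hq by (rule order_trans)
    qed
    have dis: "Us i \<inter> Us j = {}" if "i < j" for i j
    proof -
      have "64 * h * Suc i \<le> 64 * h * j"
        using that by (intro mult_le_mono2) simp
      then show ?thesis
        unfolding Us_def by auto
    qed
    have M: "2048 * d * h + k * h + 1 \<le> C * h"
      using h1 unfolding C_def by (simp add: algebra_simps)
    have "q * (2048 * d * h + k * h + 1) + 1 \<le> q * (C * h) + h"
      using M h1 by (intro add_mono mult_le_mono2)
    also have "\<dots> = E * h"
      unfolding E_def by (simp add: algebra_simps)
    finally have "b * (q * (2048 * d * h + k * h + 1) + 1) + (2048 * d * h + k * h + 1) \<le> b * (E * h) + C * h"
      using M by (intro add_mono mult_le_mono2)
    also have "\<dots> = (E * b + C) * h"
      by (simp add: algebra_simps)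
    finally have "2 * (b * (q * (2048 * d * h + k * h + 1) + 1) + (2048 * d * h + k * h + 1)) \<le> 2 * ((E * b + C) * h)"
      by (rule mult_le_mono2)
    also have "\<dots> = (2 * (E * b + C)) * h"
      by (rule mult.assoc[symmetric])
    also have "\<dots> < h * h"
    proof -
      have "2 * (E * b + C) < h"
        using hb hC unfolding distrib_left by linarith
      then show ?thesis
        using h1 by simp
    qed
    finally have big: "2 * (b * (q * (2048 * d * h + k * h + 1) + 1) + (2048 * d * h + k * h + 1)) < h * h" .
    have Us_sub: "Us i \<subseteq> {..<n}" if "i < q" for i
      using sub[OF that] unfolding Us_def by auto
    have bds: "boards H n b q Us Ws Bs (\<lambda>i. 3 + i mod k) d k h"
    proof (rule boards.intro)
      show "Us i \<subseteq> {..<n}" if "i < q" for i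
        by (rule Us_sub[OF that])
      show disj: "Us i \<inter> Us j = {}" if "i < q" "j < q" "i \<noteq> j" for i j
        using dis[of i j] dis[of j i] that by (auto simp: neq_iff)
      show "board (Us i) (Ws i) (Bs i) d k (3 + i mod k) h (b * (q * (2048 * d * h + k * h + 1) + 1))"
        if "i < q" for i
      proof (rule board.intro)
        have "i mod k < k"
          using k by simp
        then show "3 + i mod k + 2 \<le> d"
          unfolding d_def by simp
      qed (use big h1 k in \<open>auto simp: Us_def Ws_def Bs_def d_def\<close>)
      have "b * (q + 1) \<le> E * b"
        unfolding E_def C_def by (simp add: algebra_simps)
      then show "2 * (b * (q + 1)) < h"
        using hb hC by linarith
      show "contains_copy ({..<n}, A) H" if "\<And>i. i < q \<Longrightarrow> rich_cycle (Us i) (3 + i mod k) k A" for A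
        by (rule copy_if_rich_cycles[OF sparse k_def k, where Us = Us])
          (use that Us_sub disj in \<open>simp_all only: q_def\<close>)
    qed
    show ?thesis
      by (rule boards.ewin_boards[OF bds])
  qed
  moreover have "0 < 1 / real (256 * q * E)"
    using qE by (simp only: zero_less_divide_1_iff of_nat_0_less_iff)
  ultimately show ?thesis
    by blast
qed

section \<open>Densities and thresholds\<close>

lemma density_le:
  assumes "S \<subseteq> verts H" "S \<noteq> {}"
  shows "real (card (hin S)) / real (card S) \<le> max_density H"
  unfolding max_density_def
proof (rule Max_ge)
  have "{real (card (edges F)) / real (card (verts F)) |F. subgraph F H \<and> card (verts F) \<ge> 1} \<subseteq>
      (\<lambda>F. real (card (edges F)) / real (card (verts F))) ` (Pow (verts H) \<times> Pow (edges H))"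
    unfolding subgraph_def by fastforce
  then show "finite {real (card (edges F)) / real (card (verts F)) |F. subgraph F H \<and> card (verts F) \<ge> 1}"
    by (rule finite_subset) simp
  have "finite S"
    using assms(1) finite_subset finite_verts by blast
  then have "card S \<ge> 1"
    using assms(2) by (simp add: Suc_le_eq card_gt_0_iff)
  moreover have "subgraph (S, hin S) H"
    unfolding subgraph_def simple_graph_def hin_def using assms(1) edge_card by auto
  ultimately show "real (card (hin S)) / real (card S) \<in>
      {real (card (edges F)) / real (card (verts F)) |F. subgraph F H \<and> card (verts F) \<ge> 1}"
    by (intro CollectI exI[of _ "(S, hin S)"]) simp
qed

lemma hin_verts: "hin (verts H) = edges H"
  unfolding hin_def using edge_sub by auto

lemma card_hin_le:
  assumes "S \<subseteq> verts H" "S \<noteq> {}"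
  shows "real (card (hin S)) \<le> max_density H * real (card S)"
proof -
  have "finite S"
    using assms(1) finite_subset finite_verts by blast
  then have "0 < real (card S)"
    using assms(2) by (simp add: card_gt_0_iff)
  then show ?thesis
    using density_le[OF assms] by (simp add: divide_le_eq)
qed

text \<open>Enforcer must take everything after Avoider's first edge. An injective map sends
  distinct edges of H to distinct pairs, so a single edge contains no copy.\<close>

lemma not_enforcer_wins:
  assumes "card (edges H) \<ge> 2" "n \<ge> 2" "card (complete_edges n) \<le> b"
  shows "\<not> enforcer_wins H n b"
proof
  assume "enforcer_wins H n b"
  then obtain \<sigma> where \<sigma>: "legal_strategy n b \<sigma>"
    "\<And>h. play n \<sigma> h \<Longrightarrow> unclaimed n h = {} \<Longrightarrow> contains_copy ({..<n}, avoider_edges h) H"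
    unfolding enforcer_wins_def winning_strategy_def by auto
  define e :: "nat set" where "e = {0, 1}"
  have un: "unclaimed n [] = complete_edges n"
    unfolding unclaimed_def avoider_edges_def enforcer_edges_def by simp
  have e: "e \<in> unclaimed n []"
    unfolding un e_def complete_edges_def using assms(2) by auto
  have "\<sigma> [] e \<subseteq> complete_edges n - {e}" "card (\<sigma> [] e) = min b (card (complete_edges n - {e}))"
    using \<sigma>(1)[unfolded legal_strategy_def, rule_format, OF play.start e] unfolding un by simp_all
  moreover have "card (complete_edges n - {e}) \<le> b"
    using assms(3) card_mono[OF finite_complete_edges Diff_subset] by (rule order_trans[rotated])
  ultimately have "\<sigma> [] e = complete_edges n - {e}"
    by (intro card_subset_eq finite_Diff finite_complete_edges) (simp_all only: min.absorb2)
  then have "unclaimed n [(e, \<sigma> [] e)] = {}"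
    unfolding unclaimed_def avoider_edges_def enforcer_edges_def by auto
  moreover have "play n \<sigma> [(e, \<sigma> [] e)]"
    using play.round[OF play.start e] by simp
  ultimately have "contains_copy ({..<n}, {e}) H"
    using \<sigma>(2)[of "[(e, \<sigma> [] e)]"] unfolding avoider_edges_def by simp
  then obtain \<phi> where \<phi>: "inj_on \<phi> (verts H)" "\<And>e'. e' \<in> edges H \<Longrightarrow> \<phi> ` e' = e"
    unfolding contains_copy_def by auto
  have "e1 = e2" if "e1 \<in> edges H" "e2 \<in> edges H" for e1 e2
    using inj_on_image_eq_iff[OF \<phi>(1) edge_sub[OF that(1)] edge_sub[OF that(2)]] \<phi>(2) that by simp
  then have "card (edges H) \<le> 1"
    using card_le_Suc0_iff_eq[OF finite_edges] by auto
  then show False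
    using assms(1) by simp
qed

text \<open>\<open>GREATEST\<close> is meaningful only for a bounded set of candidates; the bound
  comes from \<open>not_enforcer_wins\<close>.\<close>

lemma lower_threshold_ge:
  assumes "card (edges H) \<ge> 2" "n \<ge> 2" "\<And>b. 1 \<le> b \<Longrightarrow> b \<le> K \<Longrightarrow> enforcer_wins H n b"
  shows "K \<le> lower_threshold H n"
  unfolding lower_threshold_def
proof (rule Greatest_le_nat)
  show "\<forall>b. 1 \<le> b \<and> b \<le> K \<longrightarrow> enforcer_wins H n b"
    using assms(3) by simp
  show "y \<le> card (complete_edges n)" if "\<forall>b. 1 \<le> b \<and> b \<le> y \<longrightarrow> enforcer_wins H n b" for y
  proof (rule ccontr)
    assume "\<not> y \<le> card (complete_edges n)"
    then show False
      using that[rule_format, of y] not_enforcer_wins[OF assms(1,2), of y] by simp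
  qed
qed

text \<open>A tree in H with t edges has density t / (t + 1) \<le> m(H), which is a * t \<le> 1 for
  a = 1 / m(H) - 1. Hence (c * n^a)^t is at most c * n, the size that \<open>ewin_forest\<close>
  permits.\<close>

lemma ewin_density_less_1:
  assumes m: "max_density H < 1" "0 < max_density H" and ne: "verts H \<noteq> {}"
  shows "\<exists>c>0. \<exists>n0. \<forall>n\<ge>n0. \<forall>b. real b \<le> c * real n powr (1 / max_density H) \<longrightarrow> ewin H n b {} {}"
proof -
  have forest: "forest H"
  proof (unfold_locales)
    fix S assume S: "S \<subseteq> verts H" "S \<noteq> {}"
    then have "0 < card S"
      using finite_subset[OF S(1) finite_verts] by (simp add: card_gt_0_iff)
    then have "max_density H * real (card S) < real (card S)"
      using m(1) by simp
    then show "card (hin S) < card S"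
      using card_hin_le[OF S] by linarith
  qed
  obtain \<delta> n0 where \<delta>: "0 < \<delta>" and win: "\<And>n lam b. n0 \<le> n \<Longrightarrow> 1 \<le> lam \<Longrightarrow> real b \<le> lam * real n \<Longrightarrow>
      (\<And>S. forest.conn H S \<Longrightarrow> lam ^ (card S - 1) \<le> \<delta> * real n) \<Longrightarrow> ewin H n b {} {}"
    using forest.ewin_forest[OF forest ne] by blast
  define c where "c = min 1 \<delta>"
  define a where "a = 1 / max_density H - 1"
  have c: "0 < c" "c \<le> 1" "c \<le> \<delta>"
    using \<delta> unfolding c_def by auto
  have a: "0 < a"
    using m unfolding a_def by simp
  have "ewin H n b {} {}" if n: "max n0 (nat \<lceil>1 / \<delta>\<rceil> + 1) \<le> n"
    and b: "real b \<le> c * real n powr (1 / max_density H)" for n b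
  proof -
    \<comment> \<open>\<open>ewin_forest\<close> needs \<open>lam\<close> to be at least 1; where
      the maximum is 1, the condition on trees reduces to 1 \<le> \<delta> * n.\<close>
    define lam where "lam = max 1 (c * real n powr a)"
    have n1: "1 \<le> real n" "n0 \<le> n"
      using n by auto
    have "1 / \<delta> \<le> real n"
      using n by linarith
    then have n\<delta>: "1 \<le> \<delta> * real n"
      using \<delta> by (simp add: field_simps)
    have "real n powr (1 / max_density H) = real n powr (a + 1)"
      unfolding a_def by simp
    also have "\<dots> = real n powr a * real n"
      using n1 by (simp add: powr_add)
    finally have "real b \<le> c * real n powr a * real n"
      using b by simp
    also have "\<dots> \<le> lam * real n"
      unfolding lam_def by (intro mult_right_mono) auto
    finally have "real b \<le> lam * real n" .
    moreover have "lam ^ (card S - 1) \<le> \<delta> * real n" if S: "forest.conn H S" for S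
    proof (cases "lam = 1 \<or> card S \<le> 1")
      case True
      then show ?thesis
        using n\<delta> by auto
    next
      case False
      define t where "t = card S - 1"
      have t: "0 < t" "card S = t + 1" "card (hin S) = t" "S \<subseteq> verts H"
        using S False unfolding forest.conn_def[OF forest] t_def by auto
      have "real t \<le> max_density H * real (t + 1)"
        using card_hin_le[of S] t by fastforce
      then have "a * real t \<le> 1"
        using m t(1) unfolding a_def by (simp add: field_simps)
      have "lam = c * real n powr a"
        using False unfolding lam_def by auto
      then have "lam ^ t = c ^ t * (real n powr a) ^ t"
        by (simp add: power_mult_distrib)
      also have "\<dots> = c ^ t * real n powr (a * real t)"
        using n1 by (simp add: powr_powr[symmetric] powr_realpow)
      also have "\<dots> \<le> c ^ 1 * real n powr 1"
        using n1 c t(1) \<open>a * real t \<le> 1\<close> by (intro mult_mono power_decreasing powr_mono) auto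
      also have "\<dots> \<le> \<delta> * real n"
        using c n1 by (auto intro: mult_right_mono)
      finally show ?thesis
        unfolding t_def .
    qed
    moreover have "1 \<le> lam"
      unfolding lam_def by simp
    ultimately show ?thesis
      using win[OF n1(2)] by blast
  qed
  then show ?thesis
    using c(1) by blast
qed

lemma ewin_density_1:
  assumes "max_density H = 1" "verts H \<noteq> {}"
  shows "\<exists>c>0. \<exists>n0. \<forall>n\<ge>n0. \<forall>b. real b \<le> c * real n powr (1 / max_density H) \<longrightarrow> ewin H n b {} {}"
proof -
  have "card (hin S) \<le> card S" if "S \<subseteq> verts H" for S
  proof (cases "S = {}")
    case True
    have "hin {} = {}"
      using edge_card unfolding hin_def by fastforce
    then show ?thesis
      using True by simp
  next
    case False
    then show ?thesis
      using card_hin_le[OF that] assms(1) by simp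
  qed
  then show ?thesis
    using ewin_sparse[OF _ assms(2)] assms(1) by simp
qed

end

theorem theorem1p2:
  fixes H :: "'a graph"
  assumes "finite_simple_graph H"
    and "card (edges H) \<ge> 2"
    and "max_density H \<le> 1"
  shows "(\<lambda>n. real (lower_threshold H n)) \<in> \<Omega>(\<lambda>n. real n powr (1 / max_density H))"
proof -
  interpret fin_graph H
    by unfold_locales (rule assms(1))
  have ne: "verts H \<noteq> {}"
  proof
    assume "verts H = {}"
    then have "edges H = {}"
      using edge_card edge_sub by fastforce
    then show False
      using assms(2) by simp
  qed
  have "0 < real (card (edges H)) / real (card (verts H))"
    using assms(2) ne by (intro divide_pos_pos) (simp_all only: of_nat_0_less_iff card_gt_0_iff, auto)
  also have "\<dots> \<le> max_density H"
    using density_le[OF subset_refl ne] by (simp add: hin_verts)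
  finally have m0: "0 < max_density H" .
  obtain c n0 where c: "0 < c"
    and win: "\<And>n b. n0 \<le> n \<Longrightarrow> real b \<le> c * real n powr (1 / max_density H) \<Longrightarrow> ewin H n b {} {}"
    using ewin_density_less_1[OF _ m0 ne] ewin_density_1[OF _ ne] assms(3)
    by (cases "max_density H = 1") fastforce+
  show ?thesis
  proof (rule landau_omega.bigI)
    show "0 < c / 2"
      using c by simp
    show "\<forall>\<^sub>F n in sequentially. c / 2 * norm (real n powr (1 / max_density H)) \<le> norm (real (lower_threshold H n))"
      unfolding eventually_sequentially
    proof (intro exI[of _ "max n0 (max 2 (nat \<lceil>2 / c\<rceil>))"] allI impI)
      fix n assume "max n0 (max 2 (nat \<lceil>2 / c\<rceil>)) \<le> n"
      then have n: "n0 \<le> n" "2 \<le> n" "2 / c \<le> real n"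
        by linarith+
      define X where "X = real n powr (1 / max_density H)"
      have "real n = real n powr 1"
        using n by simp
      also have "\<dots> \<le> X"
        unfolding X_def using n m0 assms(3) by (intro powr_mono) auto
      finally have "real n \<le> X" .
      then have "2 / c \<le> X"
        using n(3) by linarith
      \<comment> \<open>Rounding a number that is at least 2 down loses at most a factor of two,
        hence the constant c / 2.\<close>
      then have X: "2 \<le> c * X"
        using c by (simp add: field_simps)
      define K where "K = nat \<lfloor>c * X\<rfloor>"
      have "K \<le> lower_threshold H n"
      proof (rule lower_threshold_ge[OF assms(2) n(2)])
        fix b assume "b \<le> K"
        then have "real b \<le> c * X"
          unfolding K_def using X by linarith
        then show "enforcer_wins H n b"
          using win[OF n(1)] enforcer_wins_if_ewin unfolding X_def by blast
      qed
      moreover have "c / 2 * X \<le> real K"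
        unfolding K_def using X by linarith
      ultimately have "c / 2 * X \<le> real (lower_threshold H n)"
        by linarith
      then show "c / 2 * norm (real n powr (1 / max_density H)) \<le> norm (real (lower_threshold H n))"
        unfolding X_def by simp
    qed
  qed
qed

end
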